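(* Let $g$ be a Riemannian metric on the two-sphere $S^2$ and let $\sigma$ be a non-exact oscillating 2-form on $S^2$. Then there exists a constant $\tau_+(g,\sigma)>0$ such that for almost every $k\in(0,\tau_+(g,\sigma))$ the energy level $E^{-1}(k)$ carries at least two geometrically distinct closed magnetic geodesics.
   Context: $E:TS^2\to\mathbb R$ is the kinetic energy $E(q,v)=\frac12\|v\|_q^2$ of $g$. A 2-form $\sigma=f\mu_g$ on $S^2$ ($\mu_g$ the area form of $g$) is oscillating if its density $f$ takes both positive and negative values. The magnetic flow of $(g,\sigma)$ is the flow on $TS^2$ which over any open set $U$ where $\sigma=d\theta$ is the Euler-Lagrange flow of $(q,v)\mapsto\frac12\|v\|_q^2+\theta_q(v)$ (these local flows glue together and preserve $E$). A closed magnetic geodesic with energy $k$ is a periodic curve $\gamma$ such that $(\gamma,\dot\gamma)$ is an orbit of this flow in $E^{-1}(k)$. Closed magnetic geodesics are geometrically distinct if they are not iterates of each other, where curves differing only by a translation of the time parameter (change of base point) are identified. *)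

theory Defs
  imports "HOL-Analysis.Analysis"
begin

section \<open>Smooth maps\<close>

primrec Ck_on :: "nat \<Rightarrow> 'a::euclidean_space set \<Rightarrow> ('a \<Rightarrow> 'b::euclidean_space) \<Rightarrow> bool" where
  "Ck_on 0 W f \<longleftrightarrow> continuous_on W f"
| "Ck_on (Suc n) W f \<longleftrightarrow>
     (\<forall>x\<in>W. f differentiable (at x)) \<and>
     (\<forall>v. Ck_on n W (\<lambda>x. frechet_derivative f (at x) v))"

text \<open>A map on an arbitrary subset \<open>A\<close> of a Euclidean space is smooth if near each point of \<open>A\<close> it
  extends to a \<open>C\<^sup>\<infinity>\<close> map on an open subset of the ambient space.\<close>

definition smooth_on :: "'a::euclidean_space set \<Rightarrow> ('a \<Rightarrow> 'b::euclidean_space) \<Rightarrow> bool" where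
  "smooth_on A f \<longleftrightarrow>
     (\<forall>x\<in>A. \<exists>W F. open W \<and> x \<in> W \<and> (\<forall>n. Ck_on n W F) \<and> (\<forall>y\<in>W \<inter> A. F y = f y))"


section \<open>The two-sphere and its tensor fields\<close>

definition S2 :: "(real^3) set" where
  "S2 = sphere 0 1"

definition tangent_space :: "real^3 \<Rightarrow> (real^3) set" where
  "tangent_space q = {v. v \<bullet> q = 0}"

text \<open>In what follows \<open>U\<close> is a relatively open subset of the sphere.\<close>

definition vector_field_on :: "(real^3) set \<Rightarrow> (real^3 \<Rightarrow> real^3) \<Rightarrow> bool" where
  "vector_field_on U X \<longleftrightarrow> smooth_on U X \<and> (\<forall>q\<in>U. X q \<in> tangent_space q)"

text \<open>Forms and metrics take ambient vectors as arguments, but only their values on tangent vectors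
  matter. A covariant tensor field is smooth if its values on smooth vector fields are smooth.\<close>

definition one_form_on :: "(real^3) set \<Rightarrow> (real^3 \<Rightarrow> real^3 \<Rightarrow> real) \<Rightarrow> bool" where
  "one_form_on U \<theta> \<longleftrightarrow>
     (\<forall>q\<in>U. \<forall>u\<in>tangent_space q. \<forall>v\<in>tangent_space q. \<forall>a b.
        \<theta> q (a *\<^sub>R u + b *\<^sub>R v) = a * \<theta> q u + b * \<theta> q v) \<and>
     (\<forall>X. vector_field_on U X \<longrightarrow> smooth_on U (\<lambda>q. \<theta> q (X q)))"

definition bilinear_field_on :: "(real^3) set \<Rightarrow> (real^3 \<Rightarrow> real^3 \<Rightarrow> real^3 \<Rightarrow> real) \<Rightarrow> bool" where
  "bilinear_field_on U B \<longleftrightarrow>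
     (\<forall>q\<in>U. \<forall>u\<in>tangent_space q. \<forall>v\<in>tangent_space q. \<forall>w\<in>tangent_space q. \<forall>a b.
        B q (a *\<^sub>R u + b *\<^sub>R v) w = a * B q u w + b * B q v w \<and>
        B q w (a *\<^sub>R u + b *\<^sub>R v) = a * B q w u + b * B q w v) \<and>
     (\<forall>X Y. vector_field_on U X \<and> vector_field_on U Y \<longrightarrow> smooth_on U (\<lambda>q. B q (X q) (Y q)))"

definition riemannian_metric :: "(real^3 \<Rightarrow> real^3 \<Rightarrow> real^3 \<Rightarrow> real) \<Rightarrow> bool" where
  "riemannian_metric g \<longleftrightarrow>
     bilinear_field_on S2 g \<and>
     (\<forall>q\<in>S2. \<forall>u\<in>tangent_space q. \<forall>v\<in>tangent_space q. g q u v = g q v u) \<and>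
     (\<forall>q\<in>S2. \<forall>v\<in>tangent_space q. v \<noteq> 0 \<longrightarrow> g q v v > 0)"

definition two_form :: "(real^3 \<Rightarrow> real^3 \<Rightarrow> real^3 \<Rightarrow> real) \<Rightarrow> bool" where
  "two_form \<sigma> \<longleftrightarrow>
     bilinear_field_on S2 \<sigma> \<and> (\<forall>q\<in>S2. \<forall>v\<in>tangent_space q. \<sigma> q v v = 0)"

text \<open>The Riemannian area form, the sphere being oriented by its outward normal \<open>q\<close>: it is the square
  root of the Gram determinant, with the sign of \<open>det (q, u, v)\<close>.\<close>

definition area_form ::
  "(real^3 \<Rightarrow> real^3 \<Rightarrow> real^3 \<Rightarrow> real) \<Rightarrow> real^3 \<Rightarrow> real^3 \<Rightarrow> real^3 \<Rightarrow> real" where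
  "area_form g q u v = sgn (q \<bullet> cross3 u v) * sqrt (g q u u * g q v v - (g q u v)\<^sup>2)"

definition density_of ::
  "(real^3 \<Rightarrow> real^3 \<Rightarrow> real^3 \<Rightarrow> real) \<Rightarrow> (real^3 \<Rightarrow> real^3 \<Rightarrow> real^3 \<Rightarrow> real) \<Rightarrow> (real^3 \<Rightarrow> real) \<Rightarrow> bool"
where
  "density_of g \<sigma> f \<longleftrightarrow>
     (\<forall>q\<in>S2. \<forall>u\<in>tangent_space q. \<forall>v\<in>tangent_space q. \<sigma> q u v = f q * area_form g q u v)"

definition oscillating ::
  "(real^3 \<Rightarrow> real^3 \<Rightarrow> real^3 \<Rightarrow> real) \<Rightarrow> (real^3 \<Rightarrow> real^3 \<Rightarrow> real^3 \<Rightarrow> real) \<Rightarrow> bool" where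
  "oscillating g \<sigma> \<longleftrightarrow>
     (\<exists>f. density_of g \<sigma> f \<and> (\<exists>q\<in>S2. f q > 0) \<and> (\<exists>q\<in>S2. f q < 0))"


section \<open>Local parametrizations and the exterior derivative\<close>

text \<open>\<open>\<phi>\<close> is a diffeomorphism from the open set \<open>V\<close> of the plane onto a relatively open subset of the
  sphere.\<close>

definition local_param :: "(real^2) set \<Rightarrow> (real^2 \<Rightarrow> real^3) \<Rightarrow> bool" where
  "local_param V \<phi> \<longleftrightarrow>
     open V \<and> openin (top_of_set S2) (\<phi> ` V) \<and> inj_on \<phi> V \<and>
     smooth_on V \<phi> \<and> smooth_on (\<phi> ` V) (inv_into V \<phi>)"

definition tangent_map :: "(real^2 \<Rightarrow> real^3) \<Rightarrow> real^2 \<Rightarrow> real^2 \<Rightarrow> real^3" where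
  "tangent_map \<phi> x w = frechet_derivative \<phi> (at x) w"

definition pullback1 ::
  "(real^2 \<Rightarrow> real^3) \<Rightarrow> (real^3 \<Rightarrow> real^3 \<Rightarrow> real) \<Rightarrow> real^2 \<Rightarrow> real^2 \<Rightarrow> real" where
  "pullback1 \<phi> \<theta> x u = \<theta> (\<phi> x) (tangent_map \<phi> x u)"

definition pullback2 ::
  "(real^2 \<Rightarrow> real^3) \<Rightarrow> (real^3 \<Rightarrow> real^3 \<Rightarrow> real^3 \<Rightarrow> real) \<Rightarrow> real^2 \<Rightarrow> real^2 \<Rightarrow> real^2 \<Rightarrow> real" where
  "pullback2 \<phi> \<sigma> x u v = \<sigma> (\<phi> x) (tangent_map \<phi> x u) (tangent_map \<phi> x v)"

definition ext_deriv_plane ::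
  "(real^2 \<Rightarrow> real^2 \<Rightarrow> real) \<Rightarrow> real^2 \<Rightarrow> real^2 \<Rightarrow> real^2 \<Rightarrow> real" where
  "ext_deriv_plane \<alpha> x u v =
     frechet_derivative (\<lambda>y. \<alpha> y v) (at x) u - frechet_derivative (\<lambda>y. \<alpha> y u) (at x) v"

text \<open>\<open>\<theta>\<close> is a smooth 1-form on \<open>U\<close> with \<open>d\<theta> = \<sigma>\<close> on \<open>U\<close>; the latter equation is expressed in local
  coordinates by \<open>d(\<phi>\<^sup>* \<theta>) = \<phi>\<^sup>* \<sigma>\<close>.\<close>

definition primitive_on ::
  "(real^3) set \<Rightarrow> (real^3 \<Rightarrow> real^3 \<Rightarrow> real^3 \<Rightarrow> real) \<Rightarrow> (real^3 \<Rightarrow> real^3 \<Rightarrow> real) \<Rightarrow> bool" where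
  "primitive_on U \<sigma> \<theta> \<longleftrightarrow>
     one_form_on U \<theta> \<and>
     (\<forall>V \<phi>. local_param V \<phi> \<and> \<phi> ` V \<subseteq> U \<longrightarrow>
        (\<forall>x\<in>V. \<forall>u v. ext_deriv_plane (pullback1 \<phi> \<theta>) x u v = pullback2 \<phi> \<sigma> x u v))"

definition exact_form :: "(real^3 \<Rightarrow> real^3 \<Rightarrow> real^3 \<Rightarrow> real) \<Rightarrow> bool" where
  "exact_form \<sigma> \<longleftrightarrow> (\<exists>\<theta>. primitive_on S2 \<sigma> \<theta>)"


section \<open>Magnetic geodesics\<close>

definition kinetic_energy ::
  "(real^3 \<Rightarrow> real^3 \<Rightarrow> real^3 \<Rightarrow> real) \<Rightarrow> real^3 \<Rightarrow> real^3 \<Rightarrow> real" where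
  "kinetic_energy g q v = g q v v / 2"

definition energy_level ::
  "(real^3 \<Rightarrow> real^3 \<Rightarrow> real^3 \<Rightarrow> real) \<Rightarrow> real \<Rightarrow> ((real^3) \<times> (real^3)) set" where
  "energy_level g k = {(q, v). q \<in> S2 \<and> v \<in> tangent_space q \<and> kinetic_energy g q v = k}"

definition magnetic_lagrangian ::
  "(real^3 \<Rightarrow> real^3 \<Rightarrow> real^3 \<Rightarrow> real) \<Rightarrow> (real^3 \<Rightarrow> real^3 \<Rightarrow> real) \<Rightarrow> real^3 \<Rightarrow> real^3 \<Rightarrow> real" where
  "magnetic_lagrangian g \<theta> q v = kinetic_energy g q v + \<theta> q v"

text \<open>The Euler-Lagrange equation \<open>d/dt (\<partial>l/\<partial>w (c, c')) = \<partial>l/\<partial>x (c, c')\<close> for the coordinate expressions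
  \<open>l\<close> of the Lagrangian and \<open>c\<close> of the curve, in every local parametrization with image in \<open>U\<close> and at
  every time at which the curve is in that image.\<close>

definition euler_lagrange_on ::
  "(real^3) set \<Rightarrow> (real^3 \<Rightarrow> real^3 \<Rightarrow> real) \<Rightarrow> (real \<Rightarrow> real^3) \<Rightarrow> bool" where
  "euler_lagrange_on U L \<gamma> \<longleftrightarrow>
     (\<forall>V \<phi>. local_param V \<phi> \<and> \<phi> ` V \<subseteq> U \<longrightarrow>
       (let l = (\<lambda>x w. L (\<phi> x) (tangent_map \<phi> x w));
            c = (\<lambda>t. inv_into V \<phi> (\<gamma> t));
            c' = (\<lambda>t. vector_derivative c (at t))
        in \<forall>t. \<gamma> t \<in> \<phi> ` V \<longrightarrow>
             (\<forall>e. ((\<lambda>s. frechet_derivative (\<lambda>w. l (c s) w) (at (c' s)) e)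
                     has_real_derivative
                   frechet_derivative (\<lambda>x. l x (c' t)) (at (c t)) e) (at t))))"

text \<open>\<open>\<gamma>\<close> is the projection of an orbit of the magnetic flow, that is, \<open>(\<gamma>, \<gamma>')\<close> is an orbit of it:
  over every open \<open>U\<close> on which \<open>\<sigma> = d\<theta>\<close>, \<open>\<gamma>\<close> solves the Euler-Lagrange equation of the Lagrangian
  with magnetic term \<open>\<theta>\<close>. Every point has such a neighbourhood \<open>U\<close>.\<close>

definition magnetic_geodesic ::
  "(real^3 \<Rightarrow> real^3 \<Rightarrow> real^3 \<Rightarrow> real) \<Rightarrow> (real^3 \<Rightarrow> real^3 \<Rightarrow> real^3 \<Rightarrow> real) \<Rightarrow> (real \<Rightarrow> real^3) \<Rightarrow> bool"
where
  "magnetic_geodesic g \<sigma> \<gamma> \<longleftrightarrow>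
     smooth_on UNIV \<gamma> \<and> range \<gamma> \<subseteq> S2 \<and>
     (\<forall>U \<theta>. openin (top_of_set S2) U \<and> primitive_on U \<sigma> \<theta> \<longrightarrow>
        euler_lagrange_on U (magnetic_lagrangian g \<theta>) \<gamma>)"

definition closed_magnetic_geodesic ::
  "(real^3 \<Rightarrow> real^3 \<Rightarrow> real^3 \<Rightarrow> real) \<Rightarrow> (real^3 \<Rightarrow> real^3 \<Rightarrow> real^3 \<Rightarrow> real) \<Rightarrow> real \<Rightarrow>
     (real \<Rightarrow> real^3) \<Rightarrow> bool" where
  "closed_magnetic_geodesic g \<sigma> k \<gamma> \<longleftrightarrow>
     magnetic_geodesic g \<sigma> \<gamma> \<and>
     (\<exists>T>0. \<forall>t. \<gamma> (t + T) = \<gamma> t) \<and>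
     (\<forall>t. (\<gamma> t, vector_derivative \<gamma> (at t)) \<in> energy_level g k)"

text \<open>A closed curve is represented by a periodic map on the whole real line, without a choice of
  period. All its iterates (the same curve, run through over a multiple of the period) are then the
  same map, so two closed magnetic geodesics are iterates of one another up to a change of base point
  iff the maps differ by a time translation.\<close>

definition geometrically_distinct :: "(real \<Rightarrow> real^3) \<Rightarrow> (real \<Rightarrow> real^3) \<Rightarrow> bool" where
  "geometrically_distinct \<gamma>\<^sub>1 \<gamma>\<^sub>2 \<longleftrightarrow> \<not> (\<exists>s. \<forall>t. \<gamma>\<^sub>2 t = \<gamma>\<^sub>1 (t + s))"

end

theory Submission
  imports Defs
begin

text \<open>Orbits of low energy feel a strong magnetic field: where the density \<open>f\<close> of \<open>\<sigma>\<close> is not zero, an orbit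
  of speed \<open>\<epsilon>\<close> runs along nearly closed curves of size \<open>\<epsilon> / \<bar>f\<bar>\<close>, which drift slowly along the level sets
  of \<open>f\<close>. The drift can be stopped near the maximum of \<open>f\<close> and near its minimum. Since \<open>f\<close> oscillates, its
  maximum is positive and its minimum negative, which yields on every energy level below some threshold one
  closed orbit in \<open>{f > 0}\<close> and another one in \<open>{f < 0}\<close>; being disjoint, they are geometrically distinct.
  The maximum may be attained on a circle, say, so that no index or degree of the gradient of \<open>f\<close> would detect
  the closed orbit; the argument is variational, by a Lyapunov-Schmidt reduction to finitely many variables.

  Stereographic projection from a point with \<open>f < 0\<close> maps \<open>{f > 0}\<close> into the plane, where the metric has an
  orthonormal coframe \<open>\<xi>1, \<xi>2\<close> and the unit covectors at \<open>x\<close> are \<open>\<xi>(x, t) = cos t \<xi>1 + sin t \<xi>2\<close>. On an energy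
  level the magnetic form has the primitive \<open>a + \<epsilon> \<xi>\<close>, where \<open>a\<close> is a primitive of the pulled back form \<open>\<beta>\<close>.
  As long as \<open>B = \<beta> + \<epsilon> curl \<xi>\<close> is positive the angle \<open>t\<close> can serve as time, and the orbits are the solutions of
  \<open>x' = \<epsilon> F(x, t)\<close> with \<open>F = J \<partial>\<^sub>t\<xi> / B\<close>, which is periodic in \<open>t\<close>. A contraction argument gives through
  every point \<open>x0\<close> of a compact set a periodic solution of \<open>x' = \<epsilon> F(x, t) - \<mu>\<close> with a constant \<open>\<mu>\<close> in the plane
  (\<open>loop_exists\<close>). Its action, the integral of \<open>a + \<epsilon> \<xi>\<close>, is a function of \<open>x0\<close> which increases to first
  order if \<open>x0\<close> moves in the direction \<open>J \<mu>\<close> (\<open>action_increase\<close>), so that \<open>\<mu> = 0\<close> at its interior maxima.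
  On the other hand it equals \<open>- \<pi> \<epsilon>\<^sup>2 / f(x0)\<close> up to terms of order \<open>\<epsilon>\<^sup>3\<close> (\<open>action_value\<close>), whence its
  maximum over a compact set \<open>{f \<ge> max f / 2}\<close> is attained in the interior (\<open>planar_orbit\<close>).

  It remains to return to the sphere. In terms of the coframe the Euler-Lagrange equation in an arbitrary local
  parametrization is an identity between exterior derivatives (\<open>euler_lagrange_in_coordinates\<close>), and these
  commute with changes of coordinates (\<open>ext_deriv_pullback\<close>). The minimum of \<open>f\<close> is reduced to the maximum by
  a chart of the opposite orientation.\<close>

section \<open>Calculus of smooth maps\<close>

definition Cinf_on :: "'a::euclidean_space set \<Rightarrow> ('a \<Rightarrow> 'b::euclidean_space) \<Rightarrow> bool" where
  "Cinf_on W f \<longleftrightarrow> (\<forall>n. Ck_on n W f)"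

lemma Ck_on_cong:
  assumes "open W" "Ck_on n W f" "\<And>x. x \<in> W \<Longrightarrow> f x = g x"
  shows "Ck_on n W g"
  using assms(2,3)
proof (induction n arbitrary: f g)
  case 0
  then show ?case by (simp cong: continuous_on_cong)
next
  case (Suc n)
  have d: "(g has_derivative frechet_derivative f (at x)) (at x)" if "x \<in> W" for x
  proof (rule has_derivative_transform_within_open[OF _ \<open>open W\<close> that])
    show "(f has_derivative frechet_derivative f (at x)) (at x)"
      using Suc.prems(1) that by (simp add: frechet_derivative_works[symmetric])
  qed (use Suc.prems(2) in auto)
  then have "frechet_derivative f (at x) = frechet_derivative g (at x)" if "x \<in> W" for x
    using frechet_derivative_at[OF d[OF that]] by simp
  moreover have "Ck_on n W (\<lambda>x. frechet_derivative f (at x) v)" for v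
    using Suc.prems(1) by simp
  ultimately have "Ck_on n W (\<lambda>x. frechet_derivative g (at x) v)" for v
    by - (rule Suc.IH[of "\<lambda>x. frechet_derivative f (at x) v"], simp_all)
  then show ?case using d by (auto simp: differentiable_def)
qed

lemma Ck_on_SucI:
  assumes "open W" "\<And>x. x \<in> W \<Longrightarrow> (f has_derivative f' x) (at x)"
    and "\<And>v. Ck_on n W (\<lambda>x. f' x v)"
  shows "Ck_on (Suc n) W f"
proof -
  have "frechet_derivative f (at x) = f' x" if "x \<in> W" for x
    using assms(2)[OF that] by (simp add: frechet_derivative_at[symmetric])
  then have "Ck_on n W (\<lambda>x. frechet_derivative f (at x) v)" for v
    by (intro Ck_on_cong[OF assms(1) assms(3)[of v]]) simp
  then show ?thesis using assms(2) by (auto simp: differentiable_def)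
qed

lemma Ck_on_SucD:
  assumes "Ck_on (Suc n) W f"
  shows "x \<in> W \<Longrightarrow> (f has_derivative frechet_derivative f (at x)) (at x)"
    and "Ck_on n W (\<lambda>x. frechet_derivative f (at x) v)"
  using assms by (auto simp: frechet_derivative_works[symmetric])

lemma Ck_on_Suc_imp: "Ck_on (Suc n) W f \<Longrightarrow> Ck_on n W f"
proof (induction n arbitrary: f)
  case 0
  then show ?case
    by (auto intro!: continuous_at_imp_continuous_on differentiable_imp_continuous_within)
next
  case (Suc n)
  have "f differentiable (at x)" if "x \<in> W" for x
    using Suc.prems that by (metis Ck_on.simps(2))
  moreover have "Ck_on n W (\<lambda>x. frechet_derivative f (at x) v)" for v
    by (rule Suc.IH) (use Suc.prems in \<open>metis Ck_on.simps(2)\<close>)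
  ultimately show ?case by (simp only: Ck_on.simps) blast
qed

lemma Ck_on_subset: "Ck_on n W f \<Longrightarrow> V \<subseteq> W \<Longrightarrow> Ck_on n V f"
  by (induction n arbitrary: f) (auto intro: continuous_on_subset)

lemma Ck_on_local:
  assumes "\<And>x. x \<in> W \<Longrightarrow> \<exists>V. open V \<and> x \<in> V \<and> Ck_on n V f"
  shows "Ck_on n W f"
  using assms
proof (induction n arbitrary: f)
  case 0
  have "isCont f x" if "x \<in> W" for x
    using 0[OF that] by (auto simp: continuous_on_eq_continuous_at)
  then show ?case by (simp add: continuous_at_imp_continuous_on)
next
  case (Suc n)
  show ?case
    unfolding Ck_on.simps
  proof (intro conjI ballI allI)
    fix x assume "x \<in> W" then show "f differentiable at x" using Suc.prems by fastforce
  next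
    fix v show "Ck_on n W (\<lambda>x. frechet_derivative f (at x) v)"
      by (rule Suc.IH) (use Suc.prems in fastforce)
  qed
qed

lemma Ck_on_const: "open W \<Longrightarrow> Ck_on n W (\<lambda>x. c)"
proof (induction n arbitrary: c)
  case (Suc n)
  show ?case by (rule Ck_on_SucI[where f' = "\<lambda>x v. 0"]) (use Suc in \<open>auto intro: Suc.prems\<close>)
qed simp

lemma Ck_on_linear: "open W \<Longrightarrow> bounded_linear f \<Longrightarrow> Ck_on n W f"
proof (cases n)
  case 0
  assume "bounded_linear f" then show ?thesis using 0 by (simp add: linear_continuous_on)
next
  case (Suc n)
  assume a: "open W" "bounded_linear f"
  show ?thesis unfolding Suc
    by (rule Ck_on_SucI[where f' = "\<lambda>x. f"])
       (use a in \<open>auto intro: bounded_linear_imp_has_derivative Ck_on_const\<close>)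
qed

lemma Ck_on_add:
  assumes "open W" "Ck_on n W f" "Ck_on n W g"
  shows "Ck_on n W (\<lambda>x. f x + g x)"
  using assms(2,3)
proof (induction n arbitrary: f g)
  case (Suc n)
  show ?case
    by (rule Ck_on_SucI[OF \<open>open W\<close> has_derivative_add[OF Ck_on_SucD(1)[OF Suc.prems(1)] Ck_on_SucD(1)[OF Suc.prems(2)]]])
       (auto intro!: Suc.IH Ck_on_SucD(2) Suc.prems assms(1))
qed (auto intro: continuous_intros)

lemma Ck_on_bilinear:
  assumes "open W" "bounded_bilinear pr" "Ck_on n W f" "Ck_on n W g"
  shows "Ck_on n W (\<lambda>x. pr (f x) (g x))"
  using assms(3,4)
proof (induction n arbitrary: f g)
  case 0
  then show ?case by (simp add: bounded_bilinear.continuous_on[OF assms(2)])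
next
  case (Suc n)
  show ?case
    by (rule Ck_on_SucI[OF \<open>open W\<close> bounded_bilinear.FDERIV[OF assms(2) Ck_on_SucD(1)[OF Suc.prems(1)] Ck_on_SucD(1)[OF Suc.prems(2)]]])
       (auto intro!: Suc.IH Ck_on_SucD(2) Ck_on_Suc_imp[OF Suc.prems(1)] Ck_on_Suc_imp[OF Suc.prems(2)]
          Suc.prems assms(1) Ck_on_add)
qed

lemma Ck_on_sum:
  assumes "open W" "\<And>i. i \<in> I \<Longrightarrow> Ck_on n W (f i)"
  shows "Ck_on n W (\<lambda>x. \<Sum>i\<in>I. f i x)"
  using assms(2) by (induction I rule: infinite_finite_induct)
    (auto intro: Ck_on_const Ck_on_add \<open>open W\<close>)

text \<open>The derivative of \<open>h\<close> is expanded in a basis: the partial derivatives of \<open>f\<close> are again composed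
  with \<open>h\<close> alone, and the induction hypothesis applies to them.\<close>

lemma Ck_on_compose:
  assumes "open W" "open V" "Ck_on n V f" "Ck_on n W h" "h ` W \<subseteq> V"
  shows "Ck_on n W (\<lambda>x. f (h x))"
  using assms(3,4)
proof (induction n arbitrary: f)
  case 0
  then show ?case using continuous_on_compose2 assms(5) by (simp, blast)
next
  case (Suc n)
  define f' where "f' = (\<lambda>x. frechet_derivative f (at x))"
  define h' where "h' = (\<lambda>x. frechet_derivative h (at x))"
  have f': "(f has_derivative f' x) (at x)" if "x \<in> V" for x
    unfolding f'_def by (rule Ck_on_SucD(1)[OF Suc.prems(1) that])
  have h': "(h has_derivative h' x) (at x)" if "x \<in> W" for x
    unfolding h'_def by (rule Ck_on_SucD(1)[OF Suc.prems(2) that])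
  have d: "((\<lambda>x. f (h x)) has_derivative (\<lambda>v. \<Sum>i\<in>Basis. (h' x v \<bullet> i) *\<^sub>R f' (h x) i)) (at x)" if "x \<in> W" for x
  proof -
    have "h x \<in> V" using that assms(5) by auto
    then have l: "linear (f' (h x))" using f' has_derivative_linear by blast
    have "f' (h x) (h' x v) = (\<Sum>i\<in>Basis. (h' x v \<bullet> i) *\<^sub>R f' (h x) i)" for v
      by (subst euclidean_representation[symmetric]) (simp add: linear_sum[OF l] linear_scale[OF l])
    moreover have "((\<lambda>x. f (h x)) has_derivative (\<lambda>v. f' (h x) (h' x v))) (at x)"
      by (rule has_derivative_compose[OF h'[OF that] f'[OF \<open>h x \<in> V\<close>]])
    ultimately show ?thesis by simp
  qed
  show ?case
  proof (rule Ck_on_SucI[OF \<open>open W\<close> d])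
    fix v
    have 1: "Ck_on n W (\<lambda>x. h' x v \<bullet> i)" for i
      by (rule Ck_on_bilinear[OF assms(1) bounded_bilinear_inner])
         (auto intro: Ck_on_const assms(1) Ck_on_SucD(2)[OF Suc.prems(2)] simp: h'_def)
    have 2: "Ck_on n W (\<lambda>x. f' (h x) i)" for i
      by (rule Suc.IH) (auto intro: Ck_on_SucD(2)[OF Suc.prems(1)] Ck_on_Suc_imp[OF Suc.prems(2)] simp: f'_def)
    show "Ck_on n W (\<lambda>x. \<Sum>i\<in>Basis. (h' x v \<bullet> i) *\<^sub>R f' (h x) i)"
      by (intro Ck_on_sum Ck_on_bilinear[OF assms(1) bounded_bilinear_scaleR] 1 2 assms(1))
  qed (use assms in auto)
qed

lemma Cinf_on_has_derivative:
  "Cinf_on W f \<Longrightarrow> x \<in> W \<Longrightarrow> (f has_derivative frechet_derivative f (at x)) (at x)"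
  unfolding Cinf_on_def using Ck_on_SucD(1) by blast

lemma Cinf_on_frechet: "Cinf_on W f \<Longrightarrow> Cinf_on W (\<lambda>x. frechet_derivative f (at x) v)"
  unfolding Cinf_on_def using Ck_on_SucD(2) by blast

lemma Cinf_on_continuous: "Cinf_on W f \<Longrightarrow> continuous_on W f"
  unfolding Cinf_on_def by (metis Ck_on.simps(1))

lemma Cinf_on_cong: "open W \<Longrightarrow> Cinf_on W f \<Longrightarrow> (\<And>x. x \<in> W \<Longrightarrow> f x = g x) \<Longrightarrow> Cinf_on W g"
  unfolding Cinf_on_def using Ck_on_cong by blast

lemma Cinf_on_subset: "Cinf_on W f \<Longrightarrow> V \<subseteq> W \<Longrightarrow> Cinf_on V f"
  unfolding Cinf_on_def using Ck_on_subset by blast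

lemma Cinf_on_const: "open W \<Longrightarrow> Cinf_on W (\<lambda>x. c)"
  by (simp add: Cinf_on_def Ck_on_const)

lemma Cinf_on_linear: "open W \<Longrightarrow> bounded_linear f \<Longrightarrow> Cinf_on W f"
  by (simp add: Cinf_on_def Ck_on_linear)

lemma Cinf_on_id: "open W \<Longrightarrow> Cinf_on W (\<lambda>x. x)"
  by (simp add: Cinf_on_linear bounded_linear_ident)

lemma Cinf_on_bilinear:
  "open W \<Longrightarrow> bounded_bilinear pr \<Longrightarrow> Cinf_on W f \<Longrightarrow> Cinf_on W g \<Longrightarrow> Cinf_on W (\<lambda>x. pr (f x) (g x))"
  by (simp add: Cinf_on_def Ck_on_bilinear)

lemma Cinf_on_compose:
  "Cinf_on V f \<Longrightarrow> Cinf_on W h \<Longrightarrow> open W \<Longrightarrow> open V \<Longrightarrow> h ` W \<subseteq> V \<Longrightarrow> Cinf_on W (\<lambda>x. f (h x))"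
  by (simp add: Cinf_on_def Ck_on_compose)

lemma Cinf_on_add:
  "open W \<Longrightarrow> Cinf_on W f \<Longrightarrow> Cinf_on W g \<Longrightarrow> Cinf_on W (\<lambda>x. f x + g x)"
  by (simp add: Cinf_on_def Ck_on_add)

lemma Cinf_on_sum:
  "open W \<Longrightarrow> (\<And>i. i \<in> I \<Longrightarrow> Cinf_on W (f i)) \<Longrightarrow> Cinf_on W (\<lambda>x. \<Sum>i\<in>I. f i x)"
  by (simp add: Cinf_on_def Ck_on_sum)

lemma Cinf_on_bounded_linear:
  "open W \<Longrightarrow> bounded_linear L \<Longrightarrow> Cinf_on W f \<Longrightarrow> Cinf_on W (\<lambda>x. L (f x))"
  by (rule Cinf_on_compose[where V = UNIV]) (auto intro: Cinf_on_linear)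

lemma Cinf_on_minus: "open W \<Longrightarrow> Cinf_on W f \<Longrightarrow> Cinf_on W (\<lambda>x. - f x)"
  by (rule Cinf_on_bounded_linear[OF _ bounded_linear_minus[OF bounded_linear_ident]])

lemma Cinf_on_diff:
  "open W \<Longrightarrow> Cinf_on W f \<Longrightarrow> Cinf_on W g \<Longrightarrow> Cinf_on W (\<lambda>x. f x - g x)"
  using Cinf_on_add[of W f "\<lambda>x. - g x"] Cinf_on_minus[of W g] by simp

lemmas Cinf_on_scaleR = Cinf_on_bilinear[OF _ bounded_bilinear_scaleR]
lemmas Cinf_on_inner = Cinf_on_bilinear[OF _ bounded_bilinear_inner]

lemma Cinf_on_mult:
  fixes f g :: "'a::euclidean_space \<Rightarrow> real"
  shows "open W \<Longrightarrow> Cinf_on W f \<Longrightarrow> Cinf_on W g \<Longrightarrow> Cinf_on W (\<lambda>x. f x * g x)"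
  by (rule Cinf_on_bilinear[OF _ bounded_bilinear_mult])

lemma Cinf_on_power:
  fixes f :: "'a::euclidean_space \<Rightarrow> real"
  shows "open W \<Longrightarrow> Cinf_on W f \<Longrightarrow> Cinf_on W (\<lambda>x. f x ^ n)"
  by (induction n) (auto intro: Cinf_on_const Cinf_on_mult)

lemma bounded_linear_Pair_zero: "bounded_linear (\<lambda>x. (x, 0))" "bounded_linear (\<lambda>y. (0, y))"
  by (auto intro: bounded_linear_intros bounded_linear_Pair bounded_linear_ident bounded_linear_zero)

lemma Cinf_on_Pair:
  assumes "open W" "Cinf_on W f" "Cinf_on W g"
  shows "Cinf_on W (\<lambda>x. (f x, g x))"
proof -
  have "Cinf_on W (\<lambda>x. (f x, 0) + (0, g x))"
    by (intro Cinf_on_add Cinf_on_bounded_linear[OF _ bounded_linear_Pair_zero(1)]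
        Cinf_on_bounded_linear[OF _ bounded_linear_Pair_zero(2)] assms)
  then show ?thesis by simp
qed

lemma Cinf_on_nth: "open W \<Longrightarrow> Cinf_on W f \<Longrightarrow> Cinf_on W (\<lambda>x. f x $ i)"
  by (rule Cinf_on_bounded_linear[OF _ bounded_linear_vec_nth])

lemma Cinf_on_fst: "open W \<Longrightarrow> Cinf_on W f \<Longrightarrow> Cinf_on W (\<lambda>x. fst (f x))"
  by (rule Cinf_on_bounded_linear[OF _ bounded_linear_fst])

lemma Cinf_on_snd: "open W \<Longrightarrow> Cinf_on W f \<Longrightarrow> Cinf_on W (\<lambda>x. snd (f x))"
  by (rule Cinf_on_bounded_linear[OF _ bounded_linear_snd])

lemma Ck_on_inverse: "Ck_on n (- {0}) (inverse :: real \<Rightarrow> real)"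
proof (induction n)
  case 0
  show ?case by (auto intro!: continuous_intros)
next
  case (Suc n)
  have o: "open (- {0::real})" by auto
  show ?case
  proof (rule Ck_on_SucI[OF o, where f' = "\<lambda>x v. - (inverse x * v * inverse x)"])
    fix v :: real
    have "Ck_on n (- {0}) (\<lambda>x::real. (- v) * (inverse x * inverse x))"
      by (intro Ck_on_bilinear[OF o bounded_bilinear_mult] Ck_on_const o Suc)
    then show "Ck_on n (- {0}) (\<lambda>x::real. - (inverse x * v * inverse x))" by (simp add: ac_simps)
  qed (auto intro!: derivative_eq_intros)
qed

lemma Cinf_on_inverse:
  fixes f :: "'a::euclidean_space \<Rightarrow> real"
  assumes "open W" "Cinf_on W f" "\<And>x. x \<in> W \<Longrightarrow> f x \<noteq> 0"
  shows "Cinf_on W (\<lambda>x. inverse (f x))"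
  by (rule Cinf_on_compose[where V = "-{0}"])
     (use assms in \<open>auto simp: Cinf_on_def Ck_on_inverse\<close>)

lemma Cinf_on_divide:
  fixes f g :: "'a::euclidean_space \<Rightarrow> real"
  assumes "open W" "Cinf_on W f" "Cinf_on W g" "\<And>x. x \<in> W \<Longrightarrow> g x \<noteq> 0"
  shows "Cinf_on W (\<lambda>x. f x / g x)"
  unfolding divide_inverse by (intro Cinf_on_mult Cinf_on_inverse assms)

lemma Ck_on_sqrt: "Ck_on n {0<..} sqrt"
proof (induction n)
  case 0
  show ?case by (auto intro!: continuous_intros)
next
  case (Suc n)
  have o: "open {0::real<..}" by auto
  have i: "Ck_on n {0<..} (\<lambda>x. inverse (sqrt x))"
    by (rule Ck_on_compose[OF _ _ Ck_on_inverse Suc]) auto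
  have "Ck_on n {0<..} (\<lambda>x. inverse (sqrt x) * (1 / 2) * v)" for v
    by (intro Ck_on_bilinear[OF o bounded_bilinear_mult] Ck_on_const o i)
  then have *: "Ck_on n {0<..} (\<lambda>x. inverse (sqrt x) / 2 * v)" for v by simp
  show ?case
    by (rule Ck_on_SucI[OF o DERIV_real_sqrt[unfolded has_field_derivative_def] *]) auto
qed

lemma Cinf_on_sqrt:
  fixes f :: "'a::euclidean_space \<Rightarrow> real"
  assumes "open W" "Cinf_on W f" "\<And>x. x \<in> W \<Longrightarrow> f x > 0"
  shows "Cinf_on W (\<lambda>x. sqrt (f x))"
  by (rule Cinf_on_compose[where V = "{0<..}"])
     (use assms in \<open>auto simp: Cinf_on_def Ck_on_sqrt\<close>)

lemma Ck_on_sin_cos: "Ck_on n UNIV (sin :: real \<Rightarrow> real) \<and> Ck_on n UNIV (cos :: real \<Rightarrow> real)"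
proof (induction n)
  case 0
  show ?case by (auto intro!: continuous_intros)
next
  case (Suc n)
  have m: "Ck_on n UNIV (\<lambda>x::real. f x * v)" if "Ck_on n UNIV f" for f and v :: real
    by (rule Ck_on_bilinear[OF open_UNIV bounded_bilinear_mult that Ck_on_const[OF open_UNIV]])
  have "Ck_on n UNIV (\<lambda>x::real. - sin x)"
    by (rule Ck_on_compose[OF open_UNIV open_UNIV Ck_on_linear[OF open_UNIV bounded_linear_minus[OF bounded_linear_ident]]])
       (use Suc in auto)
  then have *: "Ck_on n UNIV (\<lambda>x::real. cos x * v)" "Ck_on n UNIV (\<lambda>x::real. - sin x * v)" for v
    using Suc m by blast+
  show ?case
  proof
    show "Ck_on (Suc n) UNIV (sin :: real \<Rightarrow> real)"
      by (rule Ck_on_SucI[OF open_UNIV DERIV_sin[unfolded has_field_derivative_def] *(1)])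
    show "Ck_on (Suc n) UNIV (cos :: real \<Rightarrow> real)"
      by (rule Ck_on_SucI[OF open_UNIV DERIV_cos[unfolded has_field_derivative_def] *(2)])
  qed
qed

lemma Cinf_on_sin: "open W \<Longrightarrow> Cinf_on W f \<Longrightarrow> Cinf_on W (\<lambda>x. sin (f x :: real))"
  and Cinf_on_cos: "open W \<Longrightarrow> Cinf_on W f \<Longrightarrow> Cinf_on W (\<lambda>x. cos (f x :: real))"
  using Cinf_on_compose[of UNIV sin W f] Cinf_on_compose[of UNIV cos W f] Ck_on_sin_cos
  by (auto simp: Cinf_on_def)

lemmas Cinf_intros = Cinf_on_const Cinf_on_id Cinf_on_add Cinf_on_diff Cinf_on_minus Cinf_on_scaleR
  Cinf_on_inner Cinf_on_mult Cinf_on_power Cinf_on_Pair Cinf_on_nth Cinf_on_fst Cinf_on_snd Cinf_on_sum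
  Cinf_on_inverse Cinf_on_divide Cinf_on_sqrt Cinf_on_sin Cinf_on_cos

text \<open>Bootstrapping: a solution of an autonomous smooth differential equation gains one derivative
  from each application of the equation.\<close>

lemma Cinf_on_ode_solution:
  fixes y :: "real \<Rightarrow> 'a::euclidean_space"
  assumes "Cinf_on UNIV H" "\<And>t. (y has_vector_derivative H (y t)) (at t)"
  shows "Cinf_on UNIV y"
  unfolding Cinf_on_def
proof
  fix n show "Ck_on n UNIV y"
  proof (induction n)
    case 0
    show ?case using assms(2)
      by (auto intro!: continuous_at_imp_continuous_on has_vector_derivative_continuous)
  next
    case (Suc n)
    have H: "Ck_on n UNIV H" using assms(1) by (simp add: Cinf_on_def)
    show ?case
    proof (rule Ck_on_SucI[where f' = "\<lambda>t v. v *\<^sub>R H (y t)"])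
      show "(y has_derivative (\<lambda>v. v *\<^sub>R H (y x))) (at x)" for x
        using assms(2)[of x] by (simp add: has_vector_derivative_def)
      show "Ck_on n UNIV (\<lambda>x. v *\<^sub>R H (y x))" for v
        by (intro Ck_on_bilinear[OF _ bounded_bilinear_scaleR] Ck_on_const Ck_on_compose[OF _ _ H Suc]) auto
    qed auto
  qed
qed

lemma smooth_on_open_iff:
  assumes "open A" shows "smooth_on A f \<longleftrightarrow> Cinf_on A f"
proof
  assume "Cinf_on A f" then show "smooth_on A f"
    using assms by (auto simp: smooth_on_def Cinf_on_def)
next
  assume s: "smooth_on A f"
  show "Cinf_on A f"
    unfolding Cinf_on_def
  proof (intro allI Ck_on_local)
    fix n x assume "x \<in> A"
    then obtain W F where W: "open W" "x \<in> W" "\<forall>n. Ck_on n W F" "\<forall>y\<in>W \<inter> A. F y = f y"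
      using s[unfolded smooth_on_def, rule_format, OF \<open>x \<in> A\<close>] by blast
    then have "Ck_on n (W \<inter> A) f"
      using assms Ck_on_subset[of n W F "W \<inter> A"] Ck_on_cong[of "W \<inter> A" n F f] by auto
    then show "\<exists>V. open V \<and> x \<in> V \<and> Ck_on n V f"
      using W \<open>x \<in> A\<close> assms by (intro exI[of _ "W \<inter> A"]) auto
  qed
qed

lemma Cinf_on_imp_smooth_on:
  assumes "open W" "Cinf_on W f" "A \<subseteq> W" shows "smooth_on A f"
  unfolding smooth_on_def
  by (intro ballI exI[of _ W] exI[of _ f]) (use assms in \<open>auto simp: Cinf_on_def\<close>)

text \<open>The local extensions of a function on the sphere differ, but not along a map into the sphere. This is
  how tensor fields on the sphere become smooth functions in a chart.\<close>

lemma smooth_on_compose: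
  assumes "smooth_on A f" "open W" "Cinf_on W h" "h ` W \<subseteq> A"
  shows "Cinf_on W (\<lambda>x. f (h x))"
  unfolding Cinf_on_def
proof (intro allI Ck_on_local)
  fix n x assume "x \<in> W"
  then have "h x \<in> A" using assms by auto
  then obtain V F where V: "open V" "h x \<in> V" "\<forall>n. Ck_on n V F" "\<forall>y\<in>V \<inter> A. F y = f y"
    using assms(1)[unfolded smooth_on_def, rule_format, OF \<open>h x \<in> A\<close>] by blast
  define U where "U = W \<inter> h -` V"
  have U: "open U" "x \<in> U" using V \<open>x \<in> W\<close> continuous_open_preimage[OF Cinf_on_continuous[OF assms(3)] assms(2) V(1)]
    by (auto simp: U_def)
  have "Cinf_on U (\<lambda>x. F (h x))"
    by (rule Cinf_on_compose[where V = V])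
       (use V U Cinf_on_subset[OF assms(3), of U] in \<open>auto simp: Cinf_on_def U_def\<close>)
  then have "Cinf_on U (\<lambda>x. f (h x))"
    by (rule Cinf_on_cong[OF U(1)]) (use assms V in \<open>auto simp: U_def\<close>)
  then show "\<exists>V. open V \<and> x \<in> V \<and> Ck_on n V (\<lambda>x. f (h x))"
    using U by (auto simp: Cinf_on_def)
qed

lemma smooth_on_imp_continuous_on: assumes "smooth_on A f" shows "continuous_on A f"
  unfolding continuous_on_eq_continuous_within
proof
  fix x assume x: "x \<in> A"
  then obtain V F where V: "open V" "x \<in> V" "\<forall>n. Ck_on n V F" "\<forall>y\<in>V \<inter> A. F y = f y"
    using assms[unfolded smooth_on_def, rule_format, OF x] by blast
  then have "continuous_on V F" by (metis Ck_on.simps(1))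
  then have "continuous (at x within A) F"
    using V by (auto simp: continuous_on_eq_continuous_at intro: continuous_at_imp_continuous_at_within)
  then show "continuous (at x within A) f"
    using V x unfolding continuous_within
    by (auto elim!: Lim_transform_eventually intro!: exI[of _ V] simp: eventually_at_topological)
qed

section \<open>Periodic functions and primitives\<close>

lemma continuous_primitive:
  fixes v :: "real \<Rightarrow> 'a::euclidean_space"
  assumes "continuous_on UNIV v"
  shows "\<exists>P. P 0 = 0 \<and> (\<forall>t. (P has_vector_derivative v t) (at t))"
proof -
  \<comment> \<open>integrals over reversed intervals vanish, so that one of the two terms is always zero\<close>
  define P where "P t = integral {0..t} v - integral {t..0} v" for t
  have der: "(P has_vector_derivative v t) (at t)" for t
  proof -
    define c where "c = \<bar>t\<bar> + 1"
    have int: "v integrable_on {p..q}" for p q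
      by (rule integrable_continuous_real[OF continuous_on_subset[OF assms]]) auto
    have P: "P s = integral {-c..s} v - integral {-c..0} v" if "s \<in> {-c<..<c}" for s
    proof (cases "s \<ge> 0")
      case True
      then have "integral {-c..0} v + integral {0..s} v = integral {-c..s} v"
        using that by (intro Henstock_Kurzweil_Integration.integral_combine int) auto
      moreover have "integral {s..0} v = 0" using True by (cases "s = 0") auto
      ultimately show ?thesis by (simp add: P_def algebra_simps)
    next
      case False
      then have "integral {-c..s} v + integral {s..0} v = integral {-c..0} v"
        using that by (intro Henstock_Kurzweil_Integration.integral_combine int) auto
      moreover have "integral {0..s} v = 0" using False by auto
      ultimately show ?thesis by (simp add: P_def algebra_simps)
    qed
    have "((\<lambda>s. integral {-c..s} v) has_vector_derivative v t) (at t within {-c..c})"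
      by (rule integral_has_vector_derivative[OF continuous_on_subset[OF assms]]) (auto simp: c_def)
    then have "((\<lambda>s. integral {-c..s} v) has_vector_derivative v t) (at t)"
      by (simp add: at_within_Icc_at c_def)
    then have "((\<lambda>s. integral {-c..s} v - integral {-c..0} v) has_vector_derivative v t) (at t)"
      by (auto intro!: derivative_eq_intros)
    then show ?thesis
      by (rule has_vector_derivative_transform_within_open[of _ _ _ "{-c<..<c}"]) (auto simp: P c_def)
  qed
  show ?thesis by (rule exI[of _ P]) (simp add: der, simp add: P_def)
qed

lemma mvt_norm_bound:
  fixes f :: "real \<Rightarrow> 'a::real_normed_vector"
  assumes "\<And>t. (f has_vector_derivative f' t) (at t)" "\<And>t. norm (f' t) \<le> C" "0 \<le> T"
  shows "norm (f T - f 0) \<le> C * T"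
proof -
  have "norm (f T - f 0) \<le> C * norm (T - 0)"
  proof (rule differentiable_bound[of UNIV f "\<lambda>t h. h *\<^sub>R f' t"])
    show "onorm (\<lambda>h. h *\<^sub>R f' t) \<le> C" for t
      using assms(2)[of t] order_trans[OF norm_ge_zero assms(2)[of t]]
      by (intro onorm_bound) (auto simp: mult.commute[of C] mult_left_mono)
  qed (use assms(1) in \<open>auto simp: has_vector_derivative_def\<close>)
  then show ?thesis using assms(3) by simp
qed

lemma mvt_lower_bound:
  fixes f :: "real \<Rightarrow> real"
  assumes "\<And>t. (f has_real_derivative f' t) (at t)" "\<And>t. f' t \<ge> c" "0 \<le> T"
  shows "f T - f 0 \<ge> c * T"
proof -
  have "(\<lambda>t. f t - c * t) 0 \<le> (\<lambda>t. f t - c * t) T"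
  proof (rule DERIV_nonneg_imp_nondecreasing[OF assms(3)])
    fix t show "\<exists>y. ((\<lambda>t. f t - c * t) has_real_derivative y) (at t) \<and> 0 \<le> y"
      using assms(2)[of t] by (intro exI[of _ "f' t - c"]) (auto intro!: derivative_eq_intros assms(1))
  qed
  then show ?thesis by simp
qed

lemma periodic_int:
  fixes f :: "real \<Rightarrow> 'a"
  assumes "\<And>t. f (t + p) = f t"
  shows "f (t + of_int n * p) = f t"
proof (induction n rule: int_induct[where k = 0])
  case (step1 i)
  then show ?case using assms[of "t + of_int i * p"] by (simp add: algebra_simps)
next
  case (step2 i)
  then show ?case using assms[of "t + of_int (i - 1) * p"] by (simp add: algebra_simps)
qed simp

lemma periodic_reduce:
  fixes f :: "real \<Rightarrow> 'a"
  assumes "\<And>t. f (t + p) = f t" "p > 0"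
  shows "\<exists>s\<in>{0..p}. f t = f s"
proof -
  define n where "n = \<lfloor>t / p\<rfloor>"
  have "of_int n \<le> t / p" "t / p < of_int n + 1" by (auto simp: n_def)
  then have "of_int n * p \<le> t" "t < (of_int n + 1) * p"
    using assms(2) by (simp_all add: field_simps)
  then have "t - of_int n * p \<in> {0..p}" by (auto simp: algebra_simps)
  moreover have "f t = f (t - of_int n * p)"
    using periodic_int[of f p "t - of_int n * p" n] assms(1) by simp
  ultimately show ?thesis by blast
qed

text \<open>Periodicity forces \<open>m\<close> to be the mean of \<open>v\<close>. Both the multipliers of the loops constructed below and
  the distances between loops are controlled in this way.\<close>

lemma periodic_bound:
  fixes f :: "real \<Rightarrow> 'a::real_normed_vector"
  assumes per: "\<And>t. f (t + 2 * pi) = f t"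
    and der: "\<And>t. (f has_vector_derivative v t - m) (at t)"
    and bound: "\<And>t. norm (v t) \<le> C"
  shows "norm m \<le> C" "norm (f t - f 0) \<le> 4 * pi * C"
proof -
  have "norm ((\<lambda>t. f t + t *\<^sub>R m) (2 * pi) - (\<lambda>t. f t + t *\<^sub>R m) 0) \<le> C * (2 * pi)"
    by (rule mvt_norm_bound[where f' = v]) (auto intro!: derivative_eq_intros der bound)
  then show m: "norm m \<le> C" using per[of 0] by (simp add: mult.commute)
  obtain s where s: "s \<in> {0..2 * pi}" "f t = f s"
    using periodic_reduce[of f "2 * pi" t] per by auto
  have b: "norm (v t - m) \<le> 2 * C" for t
    using norm_triangle_ineq4[of "v t" m] bound[of t] m by linarith
  have "norm (f s - f 0) \<le> 2 * C * s"
    by (rule mvt_norm_bound[OF der b]) (use s in auto)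
  also have "\<dots> \<le> 2 * C * (2 * pi)"
    using s order_trans[OF norm_ge_zero m] by (intro mult_left_mono) auto
  finally show "norm (f t - f 0) \<le> 4 * pi * C" using s by (simp add: mult.assoc mult.commute[of C])
qed

lemma periodic_primitive:
  fixes v :: "real \<Rightarrow> 'a::euclidean_space"
  assumes "continuous_on UNIV v" "\<And>t. v (t + 2 * pi) = v t"
  shows "\<exists>f m. f 0 = 0 \<and> (\<forall>t. f (t + 2 * pi) = f t) \<and> (\<forall>t. (f has_vector_derivative v t - m) (at t))"
proof -
  obtain P where P: "P 0 = 0" "\<And>t. (P has_vector_derivative v t) (at t)"
    using continuous_primitive[OF assms(1)] by blast
  define m where "m = (1 / (2 * pi)) *\<^sub>R P (2 * pi)"
  have d: "((\<lambda>t. P t - t *\<^sub>R m) has_vector_derivative v t - m) (at t)" for t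
    by (auto intro!: derivative_eq_intros P)
  have s: "((\<lambda>t. P (t + 2 * pi)) has_vector_derivative v t) (at t)" for t
  proof -
    have "((P \<circ> (\<lambda>t. t + 2 * pi)) has_vector_derivative (1 *\<^sub>R v (t + 2 * pi))) (at t)"
      by (rule vector_diff_chain_at) (auto intro!: derivative_eq_intros P)
    then show ?thesis using assms(2) by (simp add: o_def)
  qed
  have P2: "P (t + 2 * pi) = P t + P (2 * pi)" for t
  proof -
    have "((\<lambda>t. P (t + 2 * pi) - P t) has_derivative (\<lambda>h. 0)) (at t)" for t
      using has_vector_derivative_diff[OF s P(2), of t] by (simp add: has_vector_derivative_def)
    then have "(\<lambda>t. P (t + 2 * pi) - P t) t = (\<lambda>t. P (t + 2 * pi) - P t) 0"
      by (intro has_derivative_zero_unique[of UNIV]) auto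
    then show ?thesis using P(1) by (simp add: algebra_simps)
  qed
  have "(2 * pi) *\<^sub>R m = P (2 * pi)" by (simp add: m_def)
  then have "P (t + 2 * pi) - (t + 2 * pi) *\<^sub>R m = P t - t *\<^sub>R m" for t
    unfolding P2 by (simp add: scaleR_add_left)
  then show ?thesis using d P(1) by (intro exI[of _ "\<lambda>t. P t - t *\<^sub>R m"] exI[of _ m]) auto
qed


section \<open>Plane geometry\<close>

text \<open>The rotation by a right angle; \<open>J u \<bullet> v\<close> is the area form of the plane.\<close>

definition J :: "real^2 \<Rightarrow> real^2" where
  "J u = vector [- (u $ 2), u $ 1]"

lemma J_nth [simp]: "J u $ 1 = - (u $ 2)" "J u $ 2 = u $ 1"
  by (simp_all add: J_def)

lemma linear_J: "linear J"
  by (rule linearI) (auto simp: vec_eq_iff forall_2)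

lemma bounded_linear_J: "bounded_linear J"
  using linear_J linear_conv_bounded_linear by blast

lemmas J_add = linear_add[OF linear_J]
  and J_diff = linear_diff[OF linear_J]
  and J_minus = linear_neg[OF linear_J]
  and J_scaleR = linear_scale[OF linear_J]
  and J_0 [simp] = linear_0[OF linear_J]

lemma J_J [simp]: "J (J u) = - u"
  by (auto simp: vec_eq_iff forall_2)

lemma J_inner_J [simp]: "J u \<bullet> J v = u \<bullet> v"
  by (simp add: inner_vec_def sum_2)

lemma J_inner_right: "u \<bullet> J v = - (J u \<bullet> v)"
  by (simp add: inner_vec_def sum_2)

lemma J_inner_same [simp]: "J u \<bullet> u = 0"
  by (simp add: inner_vec_def sum_2)

lemma J_inner_swap: "J v \<bullet> u = - (J u \<bullet> v)"
  by (simp add: inner_vec_def sum_2)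

lemma norm_J [simp]: "norm (J u) = norm u"
  by (simp add: norm_eq_sqrt_inner)


section \<open>Covector fields on a plane domain\<close>

text \<open>\<open>X'\<close> is the derivative of the covector field \<open>X\<close> and \<open>\<kappa>\<close> its curl. The perturbation argument uses a
  field only through these estimates between pairs of points, which pass to subsets \<open>D\<close>, convex or not, of
  the set where they were obtained.\<close>

definition covector_field ::
  "(real^2) set \<Rightarrow> real \<Rightarrow> (real^2 \<Rightarrow> real^2) \<Rightarrow> (real^2 \<Rightarrow> real^2 \<Rightarrow> real^2) \<Rightarrow> (real^2 \<Rightarrow> real) \<Rightarrow> bool" where
  "covector_field D M X X' \<kappa> \<longleftrightarrow>
     (\<forall>x\<in>D. linear (X' x) \<and> (\<forall>u v. X' x u \<bullet> v - X' x v \<bullet> u = \<kappa> x * (J u \<bullet> v)) \<and>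
        (\<forall>u. norm (X' x u) \<le> M * norm u) \<and> norm (X x) \<le> M \<and> \<bar>\<kappa> x\<bar> \<le> M \<and>
        (\<forall>y\<in>D. norm (X y - X x - X' x (y - x)) \<le> M * (norm (y - x))\<^sup>2 \<and>
           norm (X y - X x) \<le> M * norm (y - x) \<and> \<bar>\<kappa> y - \<kappa> x\<bar> \<le> M * norm (y - x)))"

lemma covector_fieldD:
  assumes "covector_field D M X X' \<kappa>" "x \<in> D"
  shows "linear (X' x)" "X' x u \<bullet> v - X' x v \<bullet> u = \<kappa> x * (J u \<bullet> v)"
    "norm (X' x u) \<le> M * norm u" "norm (X x) \<le> M" "\<bar>\<kappa> x\<bar> \<le> M"
    "y \<in> D \<Longrightarrow> norm (X y - X x - X' x (y - x)) \<le> M * (norm (y - x))\<^sup>2"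
    "y \<in> D \<Longrightarrow> norm (X y - X x) \<le> M * norm (y - x)"
    "y \<in> D \<Longrightarrow> \<bar>\<kappa> y - \<kappa> x\<bar> \<le> M * norm (y - x)"
  using assms unfolding covector_field_def by blast+

lemma covector_field_has_derivative:
  assumes "covector_field D M X X' \<kappa>" "x \<in> D"
  shows "(X has_derivative X' x) (at x within D)"
proof (rule has_derivativeI_sandwich[where e = 1 and H = "\<lambda>y. M * norm (y - x)"])
  show "bounded_linear (X' x)"
    using covector_fieldD(1)[OF assms] linear_conv_bounded_linear by blast
  have "((\<lambda>y. M * norm (y - x)) \<longlongrightarrow> M * norm (x - x)) (at x within D)"
    by (intro tendsto_intros)
  then show "((\<lambda>y. M * norm (y - x)) \<longlongrightarrow> 0) (at x within D)" by simp
  fix y assume "y \<in> D" "y \<noteq> x"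
  then show "norm (X y - X x - X' x (y - x)) / norm (y - x) \<le> M * norm (y - x)"
    using covector_fieldD(6)[OF assms, of y] by (simp add: divide_le_eq power2_eq_square mult.assoc)
qed simp

lemma covector_field_continuous_on:
  assumes "covector_field D M X X' \<kappa>" "0 \<le> M"
  shows "continuous_on D X" "continuous_on D \<kappa>"
proof -
  have "M-lipschitz_on D X" "M-lipschitz_on D \<kappa>"
    using covector_fieldD(7,8)[OF assms(1)] assms(2)
    by (auto intro!: lipschitz_onI simp: dist_norm norm_minus_commute abs_minus_commute)
  then show "continuous_on D X" "continuous_on D \<kappa>"
    by (auto intro: lipschitz_on_continuous_on)
qed

lemma covector_field_along_curve:
  assumes "covector_field D M X X' \<kappa>" "\<And>t. x t \<in> D" "(x has_vector_derivative x') (at t)"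
  shows "((\<lambda>t. X (x t)) has_vector_derivative X' (x t) x') (at t)"
proof -
  have "(X \<circ> x has_vector_derivative X' (x t) x') (at t within UNIV)"
    by (rule vector_derivative_diff_chain_within[OF _ has_derivative_subset[OF covector_field_has_derivative[OF assms(1)]]])
       (use assms in auto)
  then show ?thesis by (simp add: o_def)
qed

section \<open>Orbits parametrized by their direction angle\<close>

text \<open>\<open>X1\<close> and \<open>X2\<close> form an orthonormal coframe of a metric with area density \<open>w\<close>, and \<open>a\<close> is a primitive of the
  magnetic form, of density \<open>b\<close>. The points of \<open>K\<close> are the admissible starting points, and the curves stay in
  \<open>D\<close>. For the form \<open>a + \<epsilon> X\<close> in the variables \<open>(x, t)\<close>, a curve \<open>x(t)\<close> is tangent to the kernel of the exterior
  derivative iff \<open>B J x' + \<epsilon> Xt = 0\<close>, that is, \<open>x' = \<epsilon> F\<close>; here \<open>c\<close> is the curl and \<open>Xt\<close> the \<open>t\<close>-derivative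
  of \<open>X\<close>.\<close>

locale planar_magnetic =
  fixes D K :: "(real^2) set" and M r b0 :: real
    and a X1 X2 :: "real^2 \<Rightarrow> real^2" and a' X1' X2' :: "real^2 \<Rightarrow> real^2 \<Rightarrow> real^2"
    and b c1 c2 :: "real^2 \<Rightarrow> real"
  assumes a: "covector_field D M a a' b"
    and X1: "covector_field D M X1 X1' c1"
    and X2: "covector_field D M X2 X2' c2"
    and b_ge: "x \<in> D \<Longrightarrow> b x \<ge> b0"
    and compact_K: "compact K"
    and K_D: "x \<in> K \<Longrightarrow> cball x r \<subseteq> D"
    and r_pos: "r > 0" and M_ge: "M \<ge> 1" and b0_pos: "b0 > 0"
begin

definition X :: "real^2 \<Rightarrow> real \<Rightarrow> real^2" where
  "X x t = cos t *\<^sub>R X1 x + sin t *\<^sub>R X2 x"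

definition Xt :: "real^2 \<Rightarrow> real \<Rightarrow> real^2" where
  "Xt x t = - sin t *\<^sub>R X1 x + cos t *\<^sub>R X2 x"

definition X' :: "real^2 \<Rightarrow> real \<Rightarrow> real^2 \<Rightarrow> real^2" where
  "X' x t u = cos t *\<^sub>R X1' x u + sin t *\<^sub>R X2' x u"

definition c :: "real^2 \<Rightarrow> real \<Rightarrow> real" where
  "c x t = cos t * c1 x + sin t * c2 x"

definition w :: "real^2 \<Rightarrow> real" where
  "w x = J (X1 x) \<bullet> X2 x"

definition B :: "real \<Rightarrow> real^2 \<Rightarrow> real \<Rightarrow> real" where
  "B \<epsilon> x t = b x + \<epsilon> * c x t"

definition F :: "real \<Rightarrow> real^2 \<Rightarrow> real \<Rightarrow> real^2" where
  "F \<epsilon> x t = (1 / B \<epsilon> x t) *\<^sub>R J (Xt x t)"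

text \<open>For \<open>\<epsilon> \<le> \<epsilon>1\<close> the denominator \<open>B\<close> stays above \<open>b0 / 2\<close>, and \<open>N\<close> is a bound and a Lipschitz constant
  of \<open>F\<close>, also with respect to \<open>\<epsilon>\<close>.\<close>

definition \<epsilon>1 :: real where
  "\<epsilon>1 = min 1 (b0 / (4 * M))"

definition N :: real where
  "N = 1 + 4 * M / b0 + 24 * M\<^sup>2 / b0\<^sup>2"

lemma trig_bound: "norm (p *\<^sub>R u + q *\<^sub>R v) \<le> norm u + norm (v :: 'b::real_normed_vector)"
  if "\<bar>p\<bar> \<le> 1" "\<bar>q\<bar> \<le> 1"
proof -
  have "norm (p *\<^sub>R u + q *\<^sub>R v) \<le> \<bar>p\<bar> * norm u + \<bar>q\<bar> * norm v"
    by (metis norm_triangle_ineq norm_scaleR)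
  also have "\<dots> \<le> 1 * norm u + 1 * norm v"
    by (intro add_mono mult_right_mono that) auto
  finally show ?thesis by simp
qed

lemma X_bound: "x \<in> D \<Longrightarrow> norm (X x t) \<le> 2 * M"
  and Xt_bound: "x \<in> D \<Longrightarrow> norm (Xt x t) \<le> 2 * M"
  using trig_bound[of "cos t" "sin t" "X1 x" "X2 x"] trig_bound[of "- sin t" "cos t" "X1 x" "X2 x"]
    covector_fieldD(4)[OF X1, of x] covector_fieldD(4)[OF X2, of x]
  by (auto simp: X_def Xt_def)

lemma X_lip: "x \<in> D \<Longrightarrow> y \<in> D \<Longrightarrow> norm (X y t - X x t) \<le> 2 * M * norm (y - x)"
proof -
  assume "x \<in> D" "y \<in> D"
  moreover have "X y t - X x t = cos t *\<^sub>R (X1 y - X1 x) + sin t *\<^sub>R (X2 y - X2 x)"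
    by (simp add: X_def algebra_simps)
  ultimately show ?thesis
    using trig_bound[of "cos t" "sin t" "X1 y - X1 x" "X2 y - X2 x"]
      covector_fieldD(7)[OF X1, of x y] covector_fieldD(7)[OF X2, of x y] by auto
qed

lemma Xt_lip: "x \<in> D \<Longrightarrow> y \<in> D \<Longrightarrow> norm (Xt y t - Xt x t) \<le> 2 * M * norm (y - x)"
proof -
  assume "x \<in> D" "y \<in> D"
  moreover have "Xt y t - Xt x t = (- sin t) *\<^sub>R (X1 y - X1 x) + cos t *\<^sub>R (X2 y - X2 x)"
    by (simp add: Xt_def algebra_simps)
  ultimately show ?thesis
    using trig_bound[of "- sin t" "cos t" "X1 y - X1 x" "X2 y - X2 x"]
      covector_fieldD(7)[OF X1, of x y] covector_fieldD(7)[OF X2, of x y] by auto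
qed

lemma X_taylor:
  "x \<in> D \<Longrightarrow> y \<in> D \<Longrightarrow> norm (X y t - X x t - X' x t (y - x)) \<le> 2 * M * (norm (y - x))\<^sup>2"
proof -
  assume "x \<in> D" "y \<in> D"
  moreover have "X y t - X x t - X' x t (y - x)
    = cos t *\<^sub>R (X1 y - X1 x - X1' x (y - x)) + sin t *\<^sub>R (X2 y - X2 x - X2' x (y - x))"
    by (simp add: X_def X'_def algebra_simps)
  ultimately show ?thesis
    using trig_bound[of "cos t" "sin t" "X1 y - X1 x - X1' x (y - x)" "X2 y - X2 x - X2' x (y - x)"]
      covector_fieldD(6)[OF X1, of x y] covector_fieldD(6)[OF X2, of x y] by auto
qed

lemma c_bound: "x \<in> D \<Longrightarrow> \<bar>c x t\<bar> \<le> 2 * M"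
  using trig_bound[of "cos t" "sin t" "c1 x" "c2 x"]
    covector_fieldD(5)[OF X1, of x] covector_fieldD(5)[OF X2, of x]
  by (auto simp: c_def)

lemma c_lip: "x \<in> D \<Longrightarrow> y \<in> D \<Longrightarrow> \<bar>c y t - c x t\<bar> \<le> 2 * M * norm (y - x)"
proof -
  assume "x \<in> D" "y \<in> D"
  moreover have "c y t - c x t = cos t * (c1 y - c1 x) + sin t * (c2 y - c2 x)"
    by (simp add: c_def algebra_simps)
  ultimately show ?thesis
    using trig_bound[of "cos t" "sin t" "c1 y - c1 x" "c2 y - c2 x"]
      covector_fieldD(8)[OF X1, of x y] covector_fieldD(8)[OF X2, of x y] by auto
qed

lemma curl_X: "x \<in> D \<Longrightarrow> X' x t u \<bullet> v - X' x t v \<bullet> u = c x t * (J u \<bullet> v)"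
proof -
  assume x: "x \<in> D"
  have "X' x t u \<bullet> v - X' x t v \<bullet> u
    = cos t * (X1' x u \<bullet> v - X1' x v \<bullet> u) + sin t * (X2' x u \<bullet> v - X2' x v \<bullet> u)"
    by (simp add: X'_def algebra_simps)
  then show ?thesis
    by (simp add: covector_fieldD(2)[OF X1 x] covector_fieldD(2)[OF X2 x] c_def algebra_simps)
qed

lemma X_J_Xt: "X x t \<bullet> J (Xt x t) = - w x"
proof -
  have "X x t \<bullet> J (Xt x t) = - (cos t * (cos t * w x) + sin t * (sin t * w x))"
    by (simp add: X_def Xt_def w_def J_add J_scaleR J_diff J_minus J_inner_right J_inner_swap[of "X2 x" "X1 x"]
        algebra_simps)
  also have "\<dots> = - (((cos t)\<^sup>2 + (sin t)\<^sup>2) * w x)"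
    by (simp only: power2_eq_square distrib_right mult.assoc)
  finally show ?thesis by simp
qed

lemma X_has_derivative: "((\<lambda>t. X x t) has_vector_derivative Xt x t) (at t)"
  unfolding X_def Xt_def by (auto intro!: derivative_eq_intros)

lemma X_along:
  assumes "\<And>t. x t \<in> D" "(x has_vector_derivative x') (at t)"
  shows "((\<lambda>t. X (x t) t) has_vector_derivative X' (x t) t x' + Xt (x t) t) (at t)"
  unfolding X_def X'_def Xt_def
  by (auto intro!: derivative_eq_intros covector_field_along_curve[OF X1 assms] covector_field_along_curve[OF X2 assms]
      simp: algebra_simps)

lemma \<epsilon>1: "0 < \<epsilon>1" "\<epsilon>1 \<le> 1" "\<epsilon>1 * (4 * M) \<le> b0"
proof -
  show "0 < \<epsilon>1" "\<epsilon>1 \<le> 1" using M_ge b0_pos by (auto simp: \<epsilon>1_def)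
  have "\<epsilon>1 * (4 * M) \<le> b0 / (4 * M) * (4 * M)"
    using M_ge by (intro mult_right_mono) (auto simp: \<epsilon>1_def)
  then show "\<epsilon>1 * (4 * M) \<le> b0" using M_ge by simp
qed

lemma B_bounds:
  assumes "x \<in> D" "0 \<le> \<epsilon>" "\<epsilon> \<le> \<epsilon>1"
  shows "B \<epsilon> x t \<ge> b0 / 2" "\<bar>B \<epsilon> x t\<bar> \<le> 3 * M"
proof -
  have "\<bar>\<epsilon> * c x t\<bar> \<le> \<epsilon>1 * (2 * M)"
    unfolding abs_mult using assms c_bound[of x t] by (intro mult_mono) auto
  moreover have "\<epsilon>1 * (2 * M) \<le> 1 * (2 * M)"
    using M_ge \<epsilon>1 by (intro mult_right_mono) auto
  ultimately show "B \<epsilon> x t \<ge> b0 / 2" "\<bar>B \<epsilon> x t\<bar> \<le> 3 * M"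
    using b_ge[OF assms(1)] covector_fieldD(5)[OF a assms(1)] \<epsilon>1(3) by (auto simp: B_def)
qed

lemma B_lip:
  assumes "x \<in> D" "y \<in> D" "0 \<le> \<epsilon>" "\<epsilon> \<le> 1"
  shows "\<bar>B \<epsilon> y t - B \<epsilon>' x t\<bar> \<le> 3 * M * (norm (y - x) + \<bar>\<epsilon> - \<epsilon>'\<bar>)"
proof -
  have "B \<epsilon> y t - B \<epsilon>' x t = (b y - b x) + \<epsilon> * (c y t - c x t) + (\<epsilon> - \<epsilon>') * c x t"
    by (simp add: B_def algebra_simps)
  moreover have "\<bar>\<epsilon> * (c y t - c x t)\<bar> \<le> 1 * (2 * M * norm (y - x))"
    unfolding abs_mult using assms c_lip[of x y t] by (intro mult_mono) auto
  moreover have "\<bar>(\<epsilon> - \<epsilon>') * c x t\<bar> \<le> \<bar>\<epsilon> - \<epsilon>'\<bar> * (2 * M)"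
    unfolding abs_mult using assms c_bound[of x t] by (intro mult_mono) auto
  ultimately have "\<bar>B \<epsilon> y t - B \<epsilon>' x t\<bar> \<le> M * norm (y - x) + 2 * M * norm (y - x) + \<bar>\<epsilon> - \<epsilon>'\<bar> * (2 * M)"
    using covector_fieldD(8)[OF a assms(1,2)] by linarith
  also have "\<bar>\<epsilon> - \<epsilon>'\<bar> * (2 * M) \<le> \<bar>\<epsilon> - \<epsilon>'\<bar> * (3 * M)"
    using M_ge by (intro mult_left_mono) auto
  finally show ?thesis by (simp add: algebra_simps)
qed

lemma N_ge: "N \<ge> 1"
  using M_ge b0_pos by (simp add: N_def)

lemma F_bound:
  assumes "x \<in> D" "0 \<le> \<epsilon>" "\<epsilon> \<le> \<epsilon>1"
  shows "norm (F \<epsilon> x t) \<le> N"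
proof -
  have "norm (F \<epsilon> x t) \<le> (1 / (b0 / 2)) * (2 * M)"
    unfolding F_def norm_scaleR norm_J
    using B_bounds[OF assms, of t] Xt_bound[OF assms(1), of t] b0_pos
    by (intro mult_mono) (auto simp: divide_simps)
  also have "\<dots> \<le> N" using M_ge b0_pos by (simp add: N_def)
  finally show ?thesis .
qed

lemma F_lip:
  assumes "x \<in> D" "y \<in> D" "0 \<le> \<epsilon>" "\<epsilon> \<le> \<epsilon>1" "0 \<le> \<epsilon>'" "\<epsilon>' \<le> \<epsilon>1"
  shows "norm (F \<epsilon> y t - F \<epsilon>' x t) \<le> N * (norm (y - x) + \<bar>\<epsilon> - \<epsilon>'\<bar>)"
proof -
  define p q where "p = B \<epsilon> y t" and "q = B \<epsilon>' x t"
  define d where "d = norm (y - x) + \<bar>\<epsilon> - \<epsilon>'\<bar>"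
  have p: "p \<ge> b0 / 2" and q: "q \<ge> b0 / 2"
    using B_bounds assms by (auto simp: p_def q_def)
  have pq: "\<bar>1 / p - 1 / q\<bar> \<le> 3 * M * d * (2 / b0 * (2 / b0))"
  proof -
    have "1 / p - 1 / q = (q - p) * (1 / p * (1 / q))"
      using p q b0_pos by (simp add: divide_simps)
    moreover have "\<bar>q - p\<bar> \<le> 3 * M * d"
      using B_lip[of x y \<epsilon> t \<epsilon>'] assms \<epsilon>1 by (auto simp: p_def q_def d_def abs_minus_commute)
    moreover have "\<bar>1 / p * (1 / q)\<bar> \<le> 2 / b0 * (2 / b0)"
      unfolding abs_mult using p q b0_pos by (intro mult_mono) (auto simp: divide_simps)
    ultimately show ?thesis
      by (metis (no_types) abs_ge_zero abs_mult mult_mono')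
  qed
  have d0: "norm (y - x) \<le> d" "0 \<le> d" by (auto simp: d_def)
  have "F \<epsilon> y t - F \<epsilon>' x t = (1 / p) *\<^sub>R J (Xt y t - Xt x t) + (1 / p - 1 / q) *\<^sub>R J (Xt x t)"
    by (simp add: F_def p_def q_def J_diff algebra_simps)
  also have "norm \<dots> \<le> \<bar>1 / p\<bar> * norm (Xt y t - Xt x t) + \<bar>1 / p - 1 / q\<bar> * norm (Xt x t)"
    by (rule order_trans[OF norm_triangle_ineq]) simp
  also have "\<dots> \<le> 2 / b0 * (2 * M * d) + 3 * M * d * (2 / b0 * (2 / b0)) * (2 * M)"
  proof (intro add_mono mult_mono pq)
    show "\<bar>1 / p\<bar> \<le> 2 / b0" using p b0_pos by (auto simp: divide_simps)
    show "norm (Xt y t - Xt x t) \<le> 2 * M * d"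
      using order_trans[OF Xt_lip[OF assms(1,2), of t] mult_left_mono[OF d0(1), of "2 * M"]] M_ge by simp
    show "norm (Xt x t) \<le> 2 * M" using Xt_bound assms by blast
  qed (use b0_pos M_ge d0 in auto)
  also have "\<dots> = (N - 1) * d" using b0_pos by (simp add: N_def field_simps power2_eq_square)
  also have "\<dots> \<le> N * d" using d0 by (intro mult_right_mono) auto
  finally show ?thesis by (simp add: d_def)
qed

lemma F_continuous:
  assumes "continuous_on UNIV x" "\<And>t. x t \<in> D" "0 \<le> \<epsilon>" "\<epsilon> \<le> \<epsilon>1"
  shows "continuous_on UNIV (\<lambda>t. F \<epsilon> (x t) t)"
proof -
  have 0: "0 \<le> M" using M_ge by simp
  note [continuous_intros] = continuous_on_compose2[OF covector_field_continuous_on(1)[OF X1 0] assms(1)]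
    continuous_on_compose2[OF covector_field_continuous_on(1)[OF X2 0] assms(1)]
    continuous_on_compose2[OF covector_field_continuous_on(2)[OF X1 0] assms(1)]
    continuous_on_compose2[OF covector_field_continuous_on(2)[OF X2 0] assms(1)]
    continuous_on_compose2[OF covector_field_continuous_on(2)[OF a 0] assms(1)]
    bounded_linear.continuous_on[OF bounded_linear_J]
  have "B \<epsilon> (x t) t \<noteq> 0" for t using B_bounds(1)[OF assms(2)[of t] assms(3,4), of t] b0_pos by auto
  then show ?thesis
    unfolding F_def Xt_def B_def c_def using assms(2) by (auto intro!: continuous_intros)
qed

lemma F_periodic: "F \<epsilon> x (t + 2 * pi) = F \<epsilon> x t"
  by (simp add: F_def B_def c_def Xt_def)


text \<open>The constant \<open>\<mu>\<close> is a Lagrange multiplier which absorbs the mean of \<open>\<epsilon> F\<close> along the curve, so that a loop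
  starts at every point of \<open>K\<close>. The loops with \<open>\<mu> = 0\<close> are the closed orbits.\<close>

definition loop :: "real \<Rightarrow> real^2 \<Rightarrow> (real \<Rightarrow> real^2) \<Rightarrow> real^2 \<Rightarrow> bool" where
  "loop \<epsilon> x0 x \<mu> \<longleftrightarrow>
     x 0 = x0 \<and> (\<forall>t. x (t + 2 * pi) = x t) \<and> (\<forall>t. x t \<in> D) \<and>
     (\<forall>t. (x has_vector_derivative \<epsilon> *\<^sub>R F \<epsilon> (x t) t - \<mu>) (at t))"

text \<open>The last two conditions let the fixed point operator for loops preserve the \<open>r\<close>-ball and contract by
  the factor \<open>1 / 2\<close>.\<close>

definition small :: "real \<Rightarrow> bool" where
  "small \<epsilon> \<longleftrightarrow> 0 < \<epsilon> \<and> \<epsilon> \<le> \<epsilon>1 \<and> 4 * pi * N * \<epsilon> \<le> r \<and> 4 * pi * N * \<epsilon> \<le> 1 / 2"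

lemma smallD:
  assumes "small \<epsilon>"
  shows "0 < \<epsilon>" "\<epsilon> \<le> \<epsilon>1" "\<epsilon> \<le> 1" "4 * pi * N * \<epsilon> \<le> r" "4 * pi * N * \<epsilon> \<le> 1 / 2"
  using assms \<epsilon>1 by (auto simp: small_def)

text \<open>Banach's fixed point theorem, applied to the operator that sends a periodic curve \<open>u\<close> to the periodic
  primitive of \<open>\<epsilon> F(u, t)\<close> minus its mean.\<close>

lemma loop_exists:
  assumes x0: "x0 \<in> K" and small: "small \<epsilon>"
  shows "\<exists>x \<mu>. loop \<epsilon> x0 x \<mu>"
proof -
  note \<epsilon> = smallD[OF small]
  define S where "S = {u :: real \<Rightarrow>\<^sub>C (real^2). (\<forall>t. u (t + 2 * pi) = u t) \<and> (\<forall>t. dist (u t) x0 \<le> r)}"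
  have S_D: "u t \<in> D" if "u \<in> S" for u t
    using that K_D[OF x0] by (auto simp: S_def dist_commute)
  have ev: "continuous_on UNIV (\<lambda>u :: real \<Rightarrow>\<^sub>C (real^2). u t)" for t
  proof -
    have "1-lipschitz_on UNIV (\<lambda>u :: real \<Rightarrow>\<^sub>C (real^2). u t)"
      by (auto intro!: lipschitz_onI dist_bounded)
    then show ?thesis by (rule lipschitz_on_continuous_on)
  qed
  have "closed S"
    unfolding S_def by (intro closed_Collect_conj closed_Collect_all closed_Collect_eq closed_Collect_le continuous_intros ev)
  then have "complete S" by (simp add: complete_eq_closed)
  have "const_bcontfun x0 \<in> S" using r_pos by (simp add: S_def const_bcontfun.rep_eq)
  then have "S \<noteq> {}" by blast
  have cont: "continuous_on UNIV (\<lambda>t. F \<epsilon> (u t) t)" if "u \<in> S" for u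
    by (rule F_continuous) (use S_D[OF that] \<epsilon> in auto)
  have "\<forall>u\<in>S. \<exists>f m. f 0 = 0 \<and> (\<forall>t. f (t + 2 * pi) = f t) \<and>
      (\<forall>t. (f has_vector_derivative F \<epsilon> (u t) t - m) (at t))"
    by (intro ballI periodic_primitive cont) (auto simp: S_def F_periodic)
  then obtain f m where f: "\<And>u. u \<in> S \<Longrightarrow> f u 0 = 0" "\<And>u t. u \<in> S \<Longrightarrow> f u (t + 2 * pi) = f u t"
      "\<And>u t. u \<in> S \<Longrightarrow> (f u has_vector_derivative F \<epsilon> (u t) t - m u) (at t)"
    by metis
  define g where "g u t = x0 + \<epsilon> *\<^sub>R f u t" for u t
  have g_dist: "dist (g u t) x0 \<le> r" if "u \<in> S" for u t
  proof -
    have "norm (f u t - f u 0) \<le> 4 * pi * N"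
      by (rule periodic_bound(2)[OF f(2,3)[OF that]]) (use F_bound S_D[OF that] \<epsilon> in auto)
    then have "\<epsilon> * norm (f u t) \<le> \<epsilon> * (4 * pi * N)"
      using \<epsilon> f(1)[OF that] by (intro mult_left_mono) auto
    also have "\<dots> \<le> r" using \<epsilon>(4) by (simp add: ac_simps)
    finally show ?thesis using \<epsilon> by (simp add: g_def dist_norm)
  qed
  have g_cont: "continuous_on UNIV (g u)" if "u \<in> S" for u
    unfolding g_def
    by (intro continuous_intros continuous_at_imp_continuous_on ballI has_vector_derivative_continuous[OF f(3)[OF that]])
  define G where "G u = Bcontfun (g u)" for u
  have G: "apply_bcontfun (G u) = g u" if "u \<in> S" for u
  proof -
    have "range (g u) \<subseteq> cball x0 r" using g_dist[OF that] by (auto simp: dist_commute)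
    then have "g u \<in> bcontfun"
      using g_cont[OF that] bounded_subset[OF bounded_cball] by (auto simp: bcontfun_def)
    then show ?thesis by (simp add: G_def Bcontfun_inverse)
  qed
  have "\<exists>!u. u \<in> S \<and> G u = u"
  proof (rule Banach_fix[OF \<open>complete S\<close> \<open>S \<noteq> {}\<close>, of "1/2"])
    show "G ` S \<subseteq> S" using g_dist f(2) by (auto simp: S_def G g_def)
    fix u v assume u: "u \<in> S" and v: "v \<in> S"
    show "dist (G u) (G v) \<le> 1 / 2 * dist u v"
    proof (rule dist_bound)
      fix t
      have "norm ((\<lambda>t. f u t - f v t) t - (\<lambda>t. f u t - f v t) 0) \<le> 4 * pi * (N * dist u v)"
      proof (rule periodic_bound(2)[where v = "\<lambda>t. F \<epsilon> (u t) t - F \<epsilon> (v t) t" and m = "m u - m v"])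
        show "((\<lambda>t. f u t - f v t) has_vector_derivative F \<epsilon> (u t) t - F \<epsilon> (v t) t - (m u - m v)) (at t)" for t
          using has_vector_derivative_diff[OF f(3)[OF u, of t] f(3)[OF v, of t]] by (simp add: algebra_simps)
        fix t
        have "norm (F \<epsilon> (u t) t - F \<epsilon> (v t) t) \<le> N * dist (u t) (v t)"
          using F_lip[OF S_D[OF v] S_D[OF u], of \<epsilon> \<epsilon> t t t] \<epsilon> by (simp add: dist_norm)
        also have "\<dots> \<le> N * dist u v"
          using N_ge by (intro mult_left_mono dist_bounded) auto
        finally show "norm (F \<epsilon> (u t) t - F \<epsilon> (v t) t) \<le> N * dist u v" .
      qed (use f(2) u v in auto)
      then have "norm (f u t - f v t) \<le> 4 * pi * (N * dist u v)" using f(1) u v by simp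
      then have "\<epsilon> * norm (f u t - f v t) \<le> \<epsilon> * (4 * pi * (N * dist u v))"
        using \<epsilon> by (intro mult_left_mono) auto
      also have "\<dots> = 4 * pi * N * \<epsilon> * dist u v" by simp
      also have "\<dots> \<le> 1 / 2 * dist u v" by (rule mult_right_mono[OF \<epsilon>(5)]) simp
      finally show "dist (G u t) (G v t) \<le> 1 / 2 * dist u v"
        using \<epsilon> by (simp add: G u v g_def dist_norm scaleR_diff_right[symmetric])
    qed
  qed auto
  then obtain u where u: "u \<in> S" "G u = u" by blast
  have ug: "u t = g u t" for t using G[OF u(1)] u(2) by simp
  have "loop \<epsilon> x0 u (\<epsilon> *\<^sub>R m u)"
    unfolding loop_def
  proof (intro conjI allI)
    show "u 0 = x0" using f(1)[OF u(1)] by (simp add: ug g_def)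
    show "u (t + 2 * pi) = u t" for t using u(1) by (simp add: S_def)
    show "u t \<in> D" for t by (rule S_D[OF u(1)])
    have "(g u has_vector_derivative \<epsilon> *\<^sub>R F \<epsilon> (u t) t - \<epsilon> *\<^sub>R m u) (at t)" for t
      unfolding g_def by (auto intro!: derivative_eq_intros f(3)[OF u(1)] simp: algebra_simps)
    moreover have "g u = apply_bcontfun u" using ug by auto
    ultimately show "(apply_bcontfun u has_vector_derivative \<epsilon> *\<^sub>R F \<epsilon> (u t) t - \<epsilon> *\<^sub>R m u) (at t)" for t
      by simp
  qed
  then show ?thesis by blast
qed

lemma loop_bounds:
  assumes "loop \<epsilon> x0 x \<mu>" "small \<epsilon>"
  shows "norm \<mu> \<le> \<epsilon> * N" "norm (x t - x0) \<le> 4 * pi * N * \<epsilon>"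
    "norm (\<epsilon> *\<^sub>R F \<epsilon> (x t) t - \<mu>) \<le> 2 * N * \<epsilon>"
proof -
  note \<epsilon> = smallD[OF assms(2)]
  have F: "norm (\<epsilon> *\<^sub>R F \<epsilon> (x t) t) \<le> \<epsilon> * N" for t
    using assms F_bound[of "x t" \<epsilon> t] \<epsilon> by (auto simp: loop_def)
  show \<mu>: "norm \<mu> \<le> \<epsilon> * N"
    by (rule periodic_bound(1)[where f = x and v = "\<lambda>t. \<epsilon> *\<^sub>R F \<epsilon> (x t) t"]) (use assms F in \<open>auto simp: loop_def\<close>)
  have "norm (x t - x 0) \<le> 4 * pi * (\<epsilon> * N)"
    by (rule periodic_bound(2)[where f = x and v = "\<lambda>t. \<epsilon> *\<^sub>R F \<epsilon> (x t) t"]) (use assms F in \<open>auto simp: loop_def\<close>)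
  then show "norm (x t - x0) \<le> 4 * pi * N * \<epsilon>" using assms by (simp add: loop_def ac_simps)
  show "norm (\<epsilon> *\<^sub>R F \<epsilon> (x t) t - \<mu>) \<le> 2 * N * \<epsilon>"
    using norm_triangle_ineq4[of "\<epsilon> *\<^sub>R F \<epsilon> (x t) t" \<mu>] F[of t] \<mu> by (simp add: algebra_simps)
qed

text \<open>Loops with neighbouring starting points are almost translates of each other, since \<open>F\<close> enters with the
  factor \<open>\<epsilon>\<close>.\<close>

lemma loop_dependence:
  assumes x: "loop \<epsilon> x0 x \<mu>" and y: "loop \<epsilon> y0 y \<nu>" and small: "small \<epsilon>"
  shows "norm (y t - x t) \<le> 2 * norm (y0 - x0)"
    "norm (y t - x t - (y0 - x0)) \<le> 8 * pi * N * \<epsilon> * norm (y0 - x0)"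
    "norm ((\<epsilon> *\<^sub>R F \<epsilon> (y t) t - \<nu>) - (\<epsilon> *\<^sub>R F \<epsilon> (x t) t - \<mu>)) \<le> 4 * N * \<epsilon> * norm (y0 - x0)"
proof -
  note \<epsilon> = smallD[OF small]
  have xD: "x t \<in> D" and yD: "y t \<in> D" for t using x y by (auto simp: loop_def)
  define \<delta> where "\<delta> t = y t - x t" for t
  have per: "\<delta> (t + 2 * pi) = \<delta> t" for t using x y by (simp add: \<delta>_def loop_def)
  have \<delta>0: "\<delta> 0 = y0 - x0" using x y by (simp add: \<delta>_def loop_def)
  have der: "(\<delta> has_vector_derivative \<epsilon> *\<^sub>R (F \<epsilon> (y t) t - F \<epsilon> (x t) t) - (\<nu> - \<mu>)) (at t)" for t
  proof -
    have "(\<delta> has_vector_derivative (\<epsilon> *\<^sub>R F \<epsilon> (y t) t - \<nu>) - (\<epsilon> *\<^sub>R F \<epsilon> (x t) t - \<mu>)) (at t)"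
      unfolding \<delta>_def by (rule has_vector_derivative_diff) (use x y in \<open>auto simp: loop_def\<close>)
    then show ?thesis by (simp add: algebra_simps)
  qed
  have "continuous_on UNIV \<delta>"
    using has_vector_derivative_continuous[OF der] continuous_at_imp_continuous_on by blast
  then have "continuous_on {0..2 * pi} (\<lambda>t. norm (\<delta> t))"
    by (intro continuous_intros) (auto intro: continuous_on_subset)
  then obtain s where s: "s \<in> {0..2*pi}" "\<And>t. t \<in> {0..2*pi} \<Longrightarrow> norm (\<delta> t) \<le> norm (\<delta> s)"
    using continuous_attains_sup[of "{0..2*pi}" "\<lambda>t. norm (\<delta> t)"] by auto
  define m where "m = norm (\<delta> s)"
  have m: "norm (\<delta> t) \<le> m" for t
    using periodic_reduce[of \<delta> "2 * pi" t] per s(2) by (auto simp: m_def)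
  have F: "norm (\<epsilon> *\<^sub>R (F \<epsilon> (y t) t - F \<epsilon> (x t) t)) \<le> \<epsilon> * (N * m)" for t
  proof -
    have "norm (F \<epsilon> (y t) t - F \<epsilon> (x t) t) \<le> N * norm (\<delta> t)"
      using F_lip[OF xD yD, of \<epsilon> \<epsilon> t t t] \<epsilon> by (simp add: \<delta>_def)
    also have "\<dots> \<le> N * m" using N_ge by (intro mult_left_mono m) auto
    finally show ?thesis using \<epsilon> by simp
  qed
  have \<mu>\<nu>: "norm (\<nu> - \<mu>) \<le> \<epsilon> * (N * m)" and b: "norm (\<delta> t - \<delta> 0) \<le> 4 * pi * (\<epsilon> * (N * m))" for t
    using periodic_bound[OF per der F] by auto
  have "4 * pi * (\<epsilon> * (N * m)) \<le> 1 / 2 * m"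
    using mult_right_mono[OF \<epsilon>(5), of m] by (simp add: m_def ac_simps)
  then have "m \<le> norm (\<delta> 0) + 1 / 2 * m"
    using b[of s] norm_triangle_sub[of "\<delta> s" "\<delta> 0"] by (simp add: m_def)
  then have m2: "m \<le> 2 * norm (y0 - x0)" by (simp add: \<delta>0)
  then show "norm (y t - x t) \<le> 2 * norm (y0 - x0)" using m[of t] by (simp add: \<delta>_def)
  have le: "\<epsilon> * (N * m) \<le> \<epsilon> * (N * (2 * norm (y0 - x0)))"
    using \<epsilon> N_ge by (intro mult_left_mono m2) auto
  have "4 * pi * (\<epsilon> * (N * m)) \<le> 4 * pi * (\<epsilon> * (N * (2 * norm (y0 - x0))))"
    by (intro mult_left_mono le) auto
  then show "norm (y t - x t - (y0 - x0)) \<le> 8 * pi * N * \<epsilon> * norm (y0 - x0)"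
    using order_trans[OF b[of t], of "8 * pi * N * \<epsilon> * norm (y0 - x0)"]
    by (simp only: \<delta>_def \<delta>0[unfolded \<delta>_def]) (simp add: ac_simps)
  have "(\<epsilon> *\<^sub>R F \<epsilon> (y t) t - \<nu>) - (\<epsilon> *\<^sub>R F \<epsilon> (x t) t - \<mu>) = \<epsilon> *\<^sub>R (F \<epsilon> (y t) t - F \<epsilon> (x t) t) - (\<nu> - \<mu>)"
    by (simp add: algebra_simps)
  then have "norm ((\<epsilon> *\<^sub>R F \<epsilon> (y t) t - \<nu>) - (\<epsilon> *\<^sub>R F \<epsilon> (x t) t - \<mu>))
      \<le> norm (\<epsilon> *\<^sub>R (F \<epsilon> (y t) t - F \<epsilon> (x t) t)) + norm (\<nu> - \<mu>)"
    by (metis norm_triangle_ineq4)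
  also have "\<dots> \<le> \<epsilon> * (N * (2 * norm (y0 - x0))) + \<epsilon> * (N * (2 * norm (y0 - x0)))"
    by (intro add_mono order_trans[OF F le] order_trans[OF \<mu>\<nu> le])
  also have "\<dots> = 4 * N * \<epsilon> * norm (y0 - x0)" by simp
  finally show "norm ((\<epsilon> *\<^sub>R F \<epsilon> (y t) t - \<nu>) - (\<epsilon> *\<^sub>R F \<epsilon> (x t) t - \<mu>)) \<le> 4 * N * \<epsilon> * norm (y0 - x0)" .
qed

end

section \<open>The reduced action\<close>

context planar_magnetic
begin

text \<open>The momentum of an orbit with direction angle \<open>t\<close>.\<close>

definition mom :: "real \<Rightarrow> real^2 \<Rightarrow> real \<Rightarrow> real^2" where
  "mom \<epsilon> x t = a x + \<epsilon> *\<^sub>R X x t"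

definition mom' :: "real \<Rightarrow> real^2 \<Rightarrow> real \<Rightarrow> real^2 \<Rightarrow> real^2" where
  "mom' \<epsilon> x t u = a' x u + \<epsilon> *\<^sub>R X' x t u"

text \<open>The integral of \<open>mom \<bullet> dx\<close> along a loop, expressed by a primitive \<open>P\<close> of the integrand. Actions can then be
  compared by the mean value theorem, after subtracting periodic functions from the primitives.\<close>

definition action :: "real \<Rightarrow> (real \<Rightarrow> real^2) \<Rightarrow> real^2 \<Rightarrow> real \<Rightarrow> bool" where
  "action \<epsilon> x \<mu> s \<longleftrightarrow> (\<exists>P. P 0 = 0 \<and> P (2 * pi) = s \<and>
     (\<forall>t. (P has_real_derivative mom \<epsilon> (x t) t \<bullet> (\<epsilon> *\<^sub>R F \<epsilon> (x t) t - \<mu>)) (at t)))"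

lemma loop_continuous: "loop \<epsilon> x0 x \<mu> \<Longrightarrow> continuous_on UNIV x"
  unfolding loop_def by (meson continuous_at_imp_continuous_on has_vector_derivative_continuous)

lemma action_exists:
  assumes x: "loop \<epsilon> x0 x \<mu>" and small: "small \<epsilon>"
  shows "\<exists>s. action \<epsilon> x \<mu> s"
proof -
  have 0: "0 \<le> M" using M_ge by simp
  have D: "x t \<in> D" for t using x by (auto simp: loop_def)
  note cont = loop_continuous[OF x]
  note [continuous_intros] = continuous_on_compose2[OF covector_field_continuous_on(1)[OF X1 0] cont]
    continuous_on_compose2[OF covector_field_continuous_on(1)[OF X2 0] cont]
    continuous_on_compose2[OF covector_field_continuous_on(1)[OF a 0] cont]
    F_continuous[OF cont D less_imp_le[OF smallD(1)[OF small]] smallD(2)[OF small]]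
  have "continuous_on UNIV (\<lambda>t. mom \<epsilon> (x t) t \<bullet> (\<epsilon> *\<^sub>R F \<epsilon> (x t) t - \<mu>))"
    unfolding mom_def X_def using D by (auto intro!: continuous_intros)
  then show ?thesis
    using continuous_primitive[of "\<lambda>t. mom \<epsilon> (x t) t \<bullet> (\<epsilon> *\<^sub>R F \<epsilon> (x t) t - \<mu>)"]
    unfolding action_def has_real_derivative_iff_has_vector_derivative by auto
qed

lemma mom_lip:
  assumes "x \<in> D" "y \<in> D" "0 \<le> \<epsilon>" "\<epsilon> \<le> 1"
  shows "norm (mom \<epsilon> y t - mom \<epsilon> x t) \<le> 3 * M * norm (y - x)"
proof -
  have "mom \<epsilon> y t - mom \<epsilon> x t = (a y - a x) + \<epsilon> *\<^sub>R (X y t - X x t)"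
    by (simp add: mom_def algebra_simps)
  moreover have "norm (\<epsilon> *\<^sub>R (X y t - X x t)) \<le> 1 * (2 * M * norm (y - x))"
    unfolding norm_scaleR using X_lip[OF assms(1,2)] assms by (intro mult_mono) auto
  ultimately show ?thesis
    using covector_fieldD(7)[OF a assms(1,2)] norm_triangle_ineq[of "a y - a x" "\<epsilon> *\<^sub>R (X y t - X x t)"] by simp
qed

lemma mom_taylor:
  assumes "x \<in> D" "y \<in> D" "0 \<le> \<epsilon>" "\<epsilon> \<le> 1"
  shows "norm (mom \<epsilon> y t - mom \<epsilon> x t - mom' \<epsilon> x t (y - x)) \<le> 3 * M * (norm (y - x))\<^sup>2"
proof -
  let ?T = "X y t - X x t - X' x t (y - x)"
  have "mom \<epsilon> y t - mom \<epsilon> x t - mom' \<epsilon> x t (y - x) = (a y - a x - a' x (y - x)) + \<epsilon> *\<^sub>R ?T"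
    by (simp add: mom_def mom'_def algebra_simps)
  moreover have "norm (\<epsilon> *\<^sub>R ?T) \<le> 1 * (2 * M * (norm (y - x))\<^sup>2)"
    unfolding norm_scaleR using X_taylor[OF assms(1,2)] assms by (intro mult_mono) auto
  ultimately show ?thesis
    using covector_fieldD(6)[OF a assms(1,2)] norm_triangle_ineq[of "a y - a x - a' x (y - x)" "\<epsilon> *\<^sub>R ?T"] by simp
qed

lemma curl_mom: "x \<in> D \<Longrightarrow> mom' \<epsilon> x t u \<bullet> v - mom' \<epsilon> x t v \<bullet> u = B \<epsilon> x t * (J u \<bullet> v)"
proof -
  assume x: "x \<in> D"
  have "mom' \<epsilon> x t u \<bullet> v - mom' \<epsilon> x t v \<bullet> u
    = (a' x u \<bullet> v - a' x v \<bullet> u) + \<epsilon> * (X' x t u \<bullet> v - X' x t v \<bullet> u)"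
    by (simp add: mom'_def algebra_simps)
  then show ?thesis by (simp add: covector_fieldD(2)[OF a x] curl_X[OF x] B_def algebra_simps)
qed

lemma mom_along:
  assumes "\<And>t. x t \<in> D" "(x has_vector_derivative x') (at t)"
  shows "((\<lambda>t. mom \<epsilon> (x t) t) has_vector_derivative mom' \<epsilon> (x t) t x' + \<epsilon> *\<^sub>R Xt (x t) t) (at t)"
  unfolding mom_def mom'_def
  by (auto intro!: derivative_eq_intros covector_field_along_curve[OF a assms] X_along[OF assms] simp: algebra_simps)

lemma mom_periodic: "mom \<epsilon> x (t + 2 * pi) = mom \<epsilon> x t"
  by (simp add: mom_def X_def)

text \<open>The first variation of the action. Integration by parts gives the integral of \<open>- (B J x' + \<epsilon> Xt) \<bullet> \<delta>\<close>
  for a variation \<open>\<delta>\<close>, and the equation of a loop turns this into the integral of \<open>B (\<delta> \<bullet> J \<mu>)\<close>.\<close>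

lemma action_variation:
  assumes x: "loop \<epsilon> x0 x \<mu>" and y: "loop \<epsilon> y0 y \<nu>" and small: "small \<epsilon>"
    and s: "action \<epsilon> x \<mu> s" and s': "action \<epsilon> y \<nu> s'"
  shows "\<exists>R R'. (\<forall>t. (R has_real_derivative R' t) (at t)) \<and> R (2 * pi) - R 0 = s' - s \<and>
    (\<forall>t. \<bar>R' t - B \<epsilon> (x t) t * ((y t - x t) \<bullet> J \<mu>)\<bar> \<le> 48 * M * N * (norm (y0 - x0))\<^sup>2)"
proof -
  note \<epsilon> = smallD[OF small]
  have D: "x t \<in> D" "y t \<in> D" for t using x y by (auto simp: loop_def)
  define x' y' where "x' t = \<epsilon> *\<^sub>R F \<epsilon> (x t) t - \<mu>" and "y' t = \<epsilon> *\<^sub>R F \<epsilon> (y t) t - \<nu>" for t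
  have x': "(x has_vector_derivative x' t) (at t)" and y': "(y has_vector_derivative y' t) (at t)" for t
    using x y by (auto simp: loop_def x'_def y'_def)
  obtain P where P: "P 0 = 0" "P (2 * pi) = s" "\<And>t. (P has_real_derivative mom \<epsilon> (x t) t \<bullet> x' t) (at t)"
    using s by (auto simp: action_def x'_def)
  obtain P' where P': "P' 0 = 0" "P' (2 * pi) = s'" "\<And>t. (P' has_real_derivative mom \<epsilon> (y t) t \<bullet> y' t) (at t)"
    using s' by (auto simp: action_def y'_def)
  define \<delta> where "\<delta> t = y t - x t" for t
  \<comment> \<open>subtracting the derivative of the periodic function \<open>Q\<close> amounts to integrating by parts\<close>
  define Q where "Q t = mom \<epsilon> (x t) t \<bullet> \<delta> t" for t
  define Q' where "Q' t = mom \<epsilon> (x t) t \<bullet> (y' t - x' t) + (mom' \<epsilon> (x t) t (x' t) + \<epsilon> *\<^sub>R Xt (x t) t) \<bullet> \<delta> t" for t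
  have Q: "(Q has_real_derivative Q' t) (at t)" for t
    unfolding Q_def Q'_def \<delta>_def has_real_derivative_iff_has_vector_derivative
    by (rule bounded_bilinear.has_vector_derivative[OF bounded_bilinear_inner mom_along[OF D(1) x'] has_vector_derivative_diff[OF y' x']])
  have per: "Q (2 * pi) = Q 0"
  proof -
    have "x (2 * pi) = x 0" "y (2 * pi) = y 0"
      using x y unfolding loop_def by (metis add_0)+
    then show ?thesis using mom_periodic[of \<epsilon> "x 0" 0] by (simp add: Q_def \<delta>_def)
  qed
  define R' where "R' t = mom \<epsilon> (y t) t \<bullet> y' t - mom \<epsilon> (x t) t \<bullet> x' t - Q' t" for t
  have R: "((\<lambda>t. P' t - P t - Q t) has_real_derivative R' t) (at t)" for t
    unfolding R'_def by (intro DERIV_diff P(3) P'(3) Q)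
  have "\<bar>R' t - B \<epsilon> (x t) t * (\<delta> t \<bullet> J \<mu>)\<bar> \<le> 48 * M * N * (norm (y0 - x0))\<^sup>2" for t
  proof -
    let ?m = "mom \<epsilon> (y t) t - mom \<epsilon> (x t) t" and ?m' = "mom' \<epsilon> (x t) t" and ?h = "norm (y0 - x0)"
    note dep = loop_dependence[OF x y small, of t]
    have "norm (?m - ?m' (\<delta> t)) \<le> 3 * M * (norm (y t - x t))\<^sup>2"
      unfolding \<delta>_def using \<epsilon> by (intro mom_taylor[OF D(1)[of t] D(2)[of t]]) simp_all
    also have "\<dots> \<le> 3 * M * (2 * ?h)\<^sup>2"
      using M_ge by (intro mult_left_mono power_mono dep) auto
    finally have t1: "norm (?m - ?m' (\<delta> t)) \<le> 3 * M * (2 * ?h)\<^sup>2" .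
    have "norm ?m \<le> 3 * M * norm (y t - x t)"
      using \<epsilon> by (intro mom_lip[OF D(1)[of t] D(2)[of t]]) simp_all
    also have "\<dots> \<le> 3 * M * (2 * ?h)"
      using M_ge by (intro mult_left_mono dep) auto
    finally have t2: "norm ?m \<le> 3 * M * (2 * ?h)" .
    have "norm (x' t) \<le> 2 * N * \<epsilon>" using loop_bounds(3)[OF x small] by (simp add: x'_def)
    also have "\<dots> \<le> 2 * N * 1" using \<epsilon> N_ge by (intro mult_left_mono) auto
    finally have t3: "norm (x' t) \<le> 2 * N * 1" .
    have "norm (y' t - x' t) \<le> 4 * N * \<epsilon> * ?h" using dep(3) by (simp add: x'_def y'_def)
    also have "\<dots> \<le> 4 * N * 1 * ?h" using \<epsilon> N_ge by (intro mult_right_mono mult_left_mono) auto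
    finally have t4: "norm (y' t - x' t) \<le> 4 * N * 1 * ?h" .
    have Bnz: "B \<epsilon> (x t) t \<noteq> 0"
      using B_bounds(1)[OF D(1), of \<epsilon> t t] \<epsilon> b0_pos by auto
    have "B \<epsilon> (x t) t *\<^sub>R x' t = \<epsilon> *\<^sub>R J (Xt (x t) t) - B \<epsilon> (x t) t *\<^sub>R \<mu>"
      using Bnz by (simp add: x'_def F_def algebra_simps)
    then have "B \<epsilon> (x t) t * (J (\<delta> t) \<bullet> x' t) = \<epsilon> * (J (\<delta> t) \<bullet> J (Xt (x t) t)) - B \<epsilon> (x t) t * (J (\<delta> t) \<bullet> \<mu>)"
      by (metis inner_diff_right inner_scaleR_right)
    then have "?m' (\<delta> t) \<bullet> x' t - ?m' (x' t) \<bullet> \<delta> t - \<epsilon> * (Xt (x t) t \<bullet> \<delta> t) = B \<epsilon> (x t) t * (\<delta> t \<bullet> J \<mu>)"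
      unfolding curl_mom[OF D(1)] by (simp add: J_inner_right[of "\<delta> t"] inner_commute[of "Xt (x t) t"])
    then have eq: "R' t - B \<epsilon> (x t) t * (\<delta> t \<bullet> J \<mu>) = (?m - ?m' (\<delta> t)) \<bullet> x' t + ?m \<bullet> (y' t - x' t)"
      by (simp add: R'_def Q'_def algebra_simps)
    have "\<bar>R' t - B \<epsilon> (x t) t * (\<delta> t \<bullet> J \<mu>)\<bar>
        \<le> norm (?m - ?m' (\<delta> t)) * norm (x' t) + norm ?m * norm (y' t - x' t)"
      unfolding eq by (rule order_trans[OF abs_triangle_ineq]) (intro add_mono Cauchy_Schwarz_ineq2)
    also have "\<dots> \<le> (3 * M * (2 * ?h)\<^sup>2) * (2 * N * 1) + (3 * M * (2 * ?h)) * (4 * N * 1 * ?h)"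
    proof -
      have "0 \<le> 3 * M * (2 * ?h)\<^sup>2" "0 \<le> 3 * M * (2 * ?h)" using M_ge by simp_all
      then show ?thesis by (intro add_mono mult_mono[OF t1 t3] mult_mono[OF t2 t4] norm_ge_zero)
    qed
    also have "\<dots> = 48 * M * N * ?h\<^sup>2" by (simp add: power2_eq_square)
    finally show ?thesis .
  qed
  then show ?thesis
    using R P P' per by (intro exI[of _ "\<lambda>t. P' t - P t - Q t"] exI[of _ R']) (auto simp: \<delta>_def)
qed

lemma action_lipschitz:
  assumes x: "loop \<epsilon> x0 x \<mu>" and y: "loop \<epsilon> y0 y \<nu>" and small: "small \<epsilon>"
    and s: "action \<epsilon> x \<mu> s" and s': "action \<epsilon> y \<nu> s'"
  shows "\<bar>s' - s\<bar> \<le> (6 * M * norm \<mu> * norm (y0 - x0) + 48 * M * N * (norm (y0 - x0))\<^sup>2) * (2 * pi)"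
proof -
  obtain R R' where R: "\<And>t. (R has_real_derivative R' t) (at t)" "R (2 * pi) - R 0 = s' - s"
    "\<And>t. \<bar>R' t - B \<epsilon> (x t) t * ((y t - x t) \<bullet> J \<mu>)\<bar> \<le> 48 * M * N * (norm (y0 - x0))\<^sup>2"
    using action_variation[OF x y small s s'] by blast
  have "norm (R (2 * pi) - R 0) \<le> (6 * M * norm \<mu> * norm (y0 - x0) + 48 * M * N * (norm (y0 - x0))\<^sup>2) * (2 * pi)"
  proof (rule mvt_norm_bound)
    fix t
    show "(R has_vector_derivative R' t) (at t)"
      using R(1)[of t] by (simp add: has_real_derivative_iff_has_vector_derivative)
    have "\<bar>B \<epsilon> (x t) t * ((y t - x t) \<bullet> J \<mu>)\<bar> \<le> \<bar>B \<epsilon> (x t) t\<bar> * (norm (y t - x t) * norm (J \<mu>))"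
      unfolding abs_mult by (intro mult_left_mono Cauchy_Schwarz_ineq2) auto
    also have "\<dots> \<le> (3 * M) * ((2 * norm (y0 - x0)) * norm \<mu>)"
      using loop_dependence(1)[OF x y small, of t] B_bounds(2)[of "x t" \<epsilon> t] smallD[OF small] x M_ge
      by (intro mult_mono) (auto simp: loop_def)
    finally show "norm (R' t) \<le> 6 * M * norm \<mu> * norm (y0 - x0) + 48 * M * N * (norm (y0 - x0))\<^sup>2"
      using R(3)[of t] by (simp add: algebra_simps)
  qed auto
  then show ?thesis using R(2) by simp
qed

text \<open>If the starting point moves by \<open>\<tau> J \<mu>\<close>, the whole loop does so up to an error with the factor \<open>\<epsilon>\<close>, and the
  first variation is at least a multiple of \<open>\<tau> \<bar>\<mu>\<bar>\<^sup>2\<close>, while the remainder has the factor \<open>\<tau>\<^sup>2\<close>.\<close>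

lemma action_increase:
  assumes x: "loop \<epsilon> x0 x \<mu>" and y: "loop \<epsilon> (x0 + \<tau> *\<^sub>R J \<mu>) y \<nu>" and small: "small \<epsilon>"
    and s: "action \<epsilon> x \<mu> s" and s': "action \<epsilon> y \<nu> s'"
    and \<tau>: "\<tau> > 0" and \<epsilon>': "96 * pi * M * N * \<epsilon> \<le> b0" and \<tau>': "192 * M * N * \<tau> < b0"
    and \<mu>: "\<mu> \<noteq> 0"
  shows "s' > s"
proof -
  note \<epsilon> = smallD[OF small]
  obtain R R' where R: "\<And>t. (R has_real_derivative R' t) (at t)" "R (2 * pi) - R 0 = s' - s"
    "\<And>t. \<bar>R' t - B \<epsilon> (x t) t * ((y t - x t) \<bullet> J \<mu>)\<bar> \<le> 48 * M * N * (norm (\<tau> *\<^sub>R J \<mu>))\<^sup>2"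
    using action_variation[OF x y small s s'] unfolding add_diff_cancel_left' by blast
  define m where "m = \<tau> * (norm \<mu>)\<^sup>2"
  have m: "m > 0" using \<tau> \<mu> by (simp add: m_def)
  have low: "R' t \<ge> (b0 / 4 - 48 * M * N * \<tau>) * m" for t
  proof -
    let ?B = "B \<epsilon> (x t) t"
    have B: "b0 / 2 \<le> ?B" "\<bar>?B\<bar> \<le> 3 * M"
      using B_bounds[of "x t" \<epsilon> t] \<epsilon> x by (auto simp: loop_def)
    define e where "e = y t - x t - \<tau> *\<^sub>R J \<mu>"
    have e: "norm e \<le> 8 * pi * N * \<epsilon> * (\<tau> * norm \<mu>)"
      using loop_dependence(2)[OF x y small, of t] \<tau> by (simp add: e_def)
    have "(y t - x t) \<bullet> J \<mu> = m + e \<bullet> J \<mu>"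
      by (simp add: e_def m_def inner_diff_left power2_norm_eq_inner)
    moreover have "\<bar>?B * (e \<bullet> J \<mu>)\<bar> \<le> (3 * M) * ((8 * pi * N * \<epsilon> * (\<tau> * norm \<mu>)) * norm \<mu>)"
    proof -
      have "\<bar>e \<bullet> J \<mu>\<bar> \<le> norm e * norm \<mu>"
        using Cauchy_Schwarz_ineq2[of e "J \<mu>"] by simp
      also have "\<dots> \<le> 8 * pi * N * \<epsilon> * (\<tau> * norm \<mu>) * norm \<mu>"
        using e by (rule mult_right_mono) simp
      finally show ?thesis
        unfolding abs_mult using B(2) M_ge by (intro mult_mono) auto
    qed
    moreover have "(3 * M) * ((8 * pi * N * \<epsilon> * (\<tau> * norm \<mu>)) * norm \<mu>) = 96 * pi * M * N * \<epsilon> / 4 * m"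
      by (simp add: m_def power2_eq_square)
    moreover have "96 * pi * M * N * \<epsilon> / 4 * m \<le> b0 / 4 * m"
      using \<epsilon>' m by (intro mult_right_mono divide_right_mono) simp_all
    moreover have "?B * m \<ge> b0 / 2 * m"
      using B m by (intro mult_right_mono) auto
    ultimately have "?B * ((y t - x t) \<bullet> J \<mu>) \<ge> b0 / 4 * m"
      by (simp add: distrib_left)
    moreover have "48 * M * N * (norm (\<tau> *\<^sub>R J \<mu>))\<^sup>2 = 48 * M * N * \<tau> * m"
      by (simp add: m_def power2_eq_square)
    ultimately show ?thesis
      using R(3)[of t] unfolding left_diff_distrib abs_le_iff by linarith
  qed
  have "(b0 / 4 - 48 * M * N * \<tau>) * m > 0"
  proof (rule mult_pos_pos[OF _ m])
    have "192 * M * N * \<tau> = 4 * (48 * M * N * \<tau>)" by simp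
    then show "0 < b0 / 4 - 48 * M * N * \<tau>" using \<tau>' by linarith
  qed
  moreover have "R (2 * pi) - R 0 \<ge> (b0 / 4 - 48 * M * N * \<tau>) * m * (2 * pi)"
    by (rule mvt_lower_bound[OF R(1) low]) auto
  ultimately show ?thesis using R(2) by (smt (verit) mult_pos_pos pi_gt_zero)
qed


text \<open>With coefficients frozen at \<open>x0\<close> the equation has the solution \<open>x0 + \<zeta>\<close>, an ellipse which is a circle of
  radius \<open>\<epsilon> w / b\<close> for the metric, and the loop differs from it by \<open>d\<close>, of order \<open>\<epsilon>\<^sup>2\<close>. The potential \<open>a\<close>
  contributes the flux \<open>\<pi> \<epsilon>\<^sup>2 w / b\<close> through the ellipse, and the covectors \<open>\<epsilon> X\<close> contribute \<open>\<epsilon>\<close> times its length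
  with a negative sign, that is, \<open>- 2 \<pi> \<epsilon>\<^sup>2 w / b\<close>.\<close>

lemma action_value:
  shows "\<exists>C>0. \<forall>\<epsilon> x0 x \<mu> s. small \<epsilon> \<longrightarrow> x0 \<in> D \<longrightarrow> loop \<epsilon> x0 x \<mu> \<longrightarrow> action \<epsilon> x \<mu> s \<longrightarrow>
     \<bar>s + pi * \<epsilon>\<^sup>2 * (w x0 / b x0)\<bar> \<le> C * \<epsilon>^3"
proof -
  define N1 where "N1 = N * (4 * pi * N + 1)"
  define C1 where "C1 = M * (4 * pi * N)\<^sup>2 * (2 * N)"
  define C2 where "C2 = M * (4 * pi * N1) * (2 * N)"
  define C3 where "C3 = M * (4 * pi * N + 4 * pi * N1) * (2 * N1)"
  define C4 where "C4 = (2 * M * (4 * pi * N)) * (2 * N)"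
  define C5 where "C5 = 2 * M * (2 * N1)"
  define C where "C = (C1 + C2 + C3 + C4 + C5) * (2 * pi)"
  have N1: "N1 > 0" using N_ge by (simp add: N1_def add_nonneg_pos)
  have C0: "C1 > 0" "C2 > 0" "C3 > 0" "C4 > 0" "C5 > 0"
    using N1 N_ge M_ge by (simp_all add: C1_def C2_def C3_def C4_def C5_def add_pos_pos)
  have "\<bar>s + pi * \<epsilon>\<^sup>2 * (w x0 / b x0)\<bar> \<le> C * \<epsilon>^3"
    if small: "small \<epsilon>" and x0: "x0 \<in> D" and x: "loop \<epsilon> x0 x \<mu>" and s: "action \<epsilon> x \<mu> s" for \<epsilon> x0 x \<mu> s
  proof -
    note \<epsilon> = smallD[OF small]
    have D: "x t \<in> D" for t using x by (auto simp: loop_def)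
    have b: "b x0 > 0" using b_ge[OF x0] b0_pos by simp
    define q where "q = \<epsilon>\<^sup>2 / b x0"
    define x' where "x' t = \<epsilon> *\<^sub>R F \<epsilon> (x t) t - \<mu>" for t
    have x': "(x has_vector_derivative x' t) (at t)" for t
      using x by (auto simp: loop_def x'_def)
    define \<zeta> where "\<zeta> t = (\<epsilon> / b x0) *\<^sub>R J (X x0 t - X x0 0)" for t
    define z' where "z' t = (\<epsilon> / b x0) *\<^sub>R J (Xt x0 t)" for t
    have \<zeta>: "(\<zeta> has_vector_derivative z' t) (at t)" for t
      unfolding \<zeta>_def z'_def J_diff
      by (auto intro!: derivative_eq_intros bounded_linear.has_vector_derivative[OF bounded_linear_J X_has_derivative])
    have z'F: "z' t = \<epsilon> *\<^sub>R F 0 x0 t" for t by (simp add: z'_def F_def B_def)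
    define d where "d t = x t - x0 - \<zeta> t" for t
    define v where "v t = \<epsilon> *\<^sub>R (F \<epsilon> (x t) t - F 0 x0 t)" for t
    have d0: "d 0 = 0" using x by (simp add: d_def \<zeta>_def loop_def)
    have dper: "d (t + 2 * pi) = d t" for t
      using x by (simp add: d_def \<zeta>_def loop_def X_def)
    have dder: "(d has_vector_derivative v t - \<mu>) (at t)" for t
    proof -
      have "(d has_vector_derivative x' t - z' t) (at t)"
        unfolding d_def by (auto intro!: derivative_eq_intros x' \<zeta>)
      then show ?thesis by (simp add: x'_def z'F v_def algebra_simps)
    qed
    note xb = loop_bounds[OF x small]
    have v: "norm (v t) \<le> \<epsilon>\<^sup>2 * N1" for t
    proof -
      have "norm (F \<epsilon> (x t) t - F 0 x0 t) \<le> N * (norm (x t - x0) + \<epsilon>)"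
        using F_lip[OF x0 D, of \<epsilon> 0 t t] \<epsilon> by simp
      also have "\<dots> \<le> N * (4 * pi * N * \<epsilon> + \<epsilon>)"
        using N_ge xb(2) by (intro mult_left_mono add_mono) auto
      also have "\<dots> = \<epsilon> * N1" by (simp add: N1_def algebra_simps)
      finally have "\<epsilon> * norm (F \<epsilon> (x t) t - F 0 x0 t) \<le> \<epsilon> * (\<epsilon> * N1)"
        using \<epsilon> by (intro mult_left_mono) auto
      then show ?thesis using \<epsilon> by (simp add: v_def power2_eq_square)
    qed
    have \<mu>: "norm \<mu> \<le> \<epsilon>\<^sup>2 * N1" and d: "norm (d t) \<le> 4 * pi * N1 * \<epsilon>\<^sup>2" for t
      using periodic_bound(1)[OF dper dder v] periodic_bound(2)[OF dper dder v, of t] by (auto simp: d0 ac_simps)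
    have d\<epsilon>: "norm (d t) \<le> 4 * pi * N1 * \<epsilon>" for t
    proof -
      have "\<epsilon>\<^sup>2 \<le> \<epsilon>" using \<epsilon> by (simp add: power2_eq_square mult_left_le)
      then have "4 * pi * N1 * \<epsilon>\<^sup>2 \<le> 4 * pi * N1 * \<epsilon>" using N1 by (intro mult_left_mono) auto
      then show ?thesis using d[of t] by linarith
    qed
    have xz': "norm (x' t - z' t) \<le> 2 * N1 * \<epsilon>\<^sup>2" for t
    proof -
      have "x' t - z' t = v t - \<mu>" by (simp add: x'_def z'F v_def algebra_simps)
      then have "norm (x' t - z' t) = norm (v t - \<mu>)" by simp
      moreover have "2 * N1 * \<epsilon>\<^sup>2 = \<epsilon>\<^sup>2 * N1 + \<epsilon>\<^sup>2 * N1" by simp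
      ultimately show ?thesis using norm_triangle_ineq4[of "v t" \<mu>] v[of t] \<mu> by linarith
    qed
    have xx: "norm (x t - x0) \<le> 4 * pi * N * \<epsilon>" for t by (rule xb(2))
    have x'b: "norm (x' t) \<le> 2 * N * \<epsilon>" for t using xb(3) by (simp add: x'_def)
    have \<zeta>b: "norm (\<zeta> t) \<le> (4 * pi * N + 4 * pi * N1) * \<epsilon>" for t
    proof -
      have "\<zeta> t = (x t - x0) - d t" by (simp add: d_def)
      then have "norm (\<zeta> t) \<le> norm (x t - x0) + norm (d t)" using norm_triangle_ineq4 by metis
      then show ?thesis using xx[of t] d\<epsilon>[of t] unfolding distrib_right by linarith
    qed
    obtain P where P: "P 0 = 0" "P (2 * pi) = s" "\<And>t. (P has_real_derivative mom \<epsilon> (x t) t \<bullet> x' t) (at t)"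
      using s by (auto simp: action_def x'_def)
    note lin = covector_fieldD(1)[OF a x0]
    have a'd: "((\<lambda>t. a' x0 (\<zeta> t)) has_vector_derivative a' x0 (z' t)) (at t)" for t
      using lin linear_conv_bounded_linear bounded_linear.has_vector_derivative \<zeta> by blast
    \<comment> \<open>the constant and the symmetric part of \<open>a\<close> at \<open>x0\<close> integrate to zero; the last term comes from the base point of \<open>\<zeta>\<close>\<close>
    define Q where "Q t = a x0 \<bullet> x t + (a' x0 (\<zeta> t) \<bullet> \<zeta> t) / 2 + q / 2 * (X x0 0 \<bullet> J (X x0 t))" for t
    define Q' where "Q' t = a x0 \<bullet> x' t + (a' x0 (\<zeta> t) \<bullet> z' t + a' x0 (z' t) \<bullet> \<zeta> t) / 2
        + q / 2 * (X x0 0 \<bullet> J (Xt x0 t))" for t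
    have Q: "(Q has_real_derivative Q' t) (at t)" for t
    proof -
      have 1: "((\<lambda>t. a x0 \<bullet> x t) has_real_derivative a x0 \<bullet> x' t) (at t)"
        unfolding has_real_derivative_iff_has_vector_derivative
        by (rule bounded_linear.has_vector_derivative[OF bounded_linear_inner_right x'])
      have 2: "((\<lambda>t. a' x0 (\<zeta> t) \<bullet> \<zeta> t) has_real_derivative a' x0 (\<zeta> t) \<bullet> z' t + a' x0 (z' t) \<bullet> \<zeta> t) (at t)"
        unfolding has_real_derivative_iff_has_vector_derivative
        by (rule bounded_bilinear.has_vector_derivative[OF bounded_bilinear_inner a'd \<zeta>])
      have 3: "((\<lambda>t. X x0 0 \<bullet> J (X x0 t)) has_real_derivative X x0 0 \<bullet> J (Xt x0 t)) (at t)"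
        unfolding has_real_derivative_iff_has_vector_derivative
        by (intro bounded_linear.has_vector_derivative[OF bounded_linear_inner_right]
            bounded_linear.has_vector_derivative[OF bounded_linear_J] X_has_derivative)
      show ?thesis unfolding Q_def Q'_def by (intro DERIV_add DERIV_cdivide DERIV_cmult 1 2 3)
    qed
    have Qper: "Q (2 * pi) = Q 0"
    proof -
      have "x (2 * pi) = x 0" using x unfolding loop_def by (metis add_0)
      moreover have "X x0 (2 * pi) = X x0 0" by (simp add: X_def)
      ultimately show ?thesis by (simp add: Q_def \<zeta>_def)
    qed
    have "((\<lambda>t. P t - Q t + q / 2 * w x0 * t) has_vector_derivative
        mom \<epsilon> (x t) t \<bullet> x' t - Q' t + q / 2 * w x0) (at t)" for t
      unfolding has_real_derivative_iff_has_vector_derivative[symmetric]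
      by (auto intro!: derivative_eq_intros P(3) Q)
    moreover have "norm (mom \<epsilon> (x t) t \<bullet> x' t - Q' t + q / 2 * w x0) \<le> (C1 + C2 + C3 + C4 + C5) * \<epsilon>^3" for t
    proof -
      have XJ: "X x0 t \<bullet> J (Xt x0 t) = - w x0" by (rule X_J_Xt)
      have Jz: "b x0 * (J (\<zeta> t) \<bullet> z' t) = q * (w x0 + X x0 0 \<bullet> J (Xt x0 t))"
      proof -
        have "J (\<zeta> t) \<bullet> z' t = (\<epsilon> / b x0) * (\<epsilon> / b x0) * - ((X x0 t - X x0 0) \<bullet> J (Xt x0 t))"
          by (simp add: \<zeta>_def z'_def J_scaleR inner_diff_left diff_divide_distrib right_diff_distrib)
        also have "\<dots> = (\<epsilon> / b x0) * (\<epsilon> / b x0) * (w x0 + X x0 0 \<bullet> J (Xt x0 t))"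
          by (simp add: inner_diff_left XJ)
        finally show ?thesis using b by (simp add: q_def power2_eq_square)
      qed
      have Xz: "\<epsilon> * (X x0 t \<bullet> z' t) = - q * w x0"
        by (simp add: z'_def XJ q_def power2_eq_square)
      have curl: "a' x0 (\<zeta> t) \<bullet> z' t - a' x0 (z' t) \<bullet> \<zeta> t = b x0 * (J (\<zeta> t) \<bullet> z' t)"
        by (rule covector_fieldD(2)[OF a x0])
      have xe: "x t - x0 = d t + \<zeta> t" by (simp add: d_def)
      have ad: "a' x0 (x t - x0) = a' x0 (d t) + a' x0 (\<zeta> t)"
        unfolding xe by (rule linear_add[OF lin])
      \<comment> \<open>the five errors of replacing first \<open>a\<close> and \<open>X\<close> by their values at \<open>x0\<close> and then the loop by the ellipse\<close>
      define T1 where "T1 = (a (x t) - a x0 - a' x0 (x t - x0)) \<bullet> x' t"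
      define T2 where "T2 = a' x0 (d t) \<bullet> x' t"
      define T3 where "T3 = a' x0 (\<zeta> t) \<bullet> (x' t - z' t)"
      define T4 where "T4 = \<epsilon> * ((X (x t) t - X x0 t) \<bullet> x' t)"
      define T5 where "T5 = \<epsilon> * (X x0 t \<bullet> (x' t - z' t))"
      have "T1 + T2 + T3 = a (x t) \<bullet> x' t - a x0 \<bullet> x' t - a' x0 (\<zeta> t) \<bullet> z' t"
        unfolding T1_def T2_def T3_def ad by (simp add: algebra_simps)
      moreover have "T4 + T5 = \<epsilon> * (X (x t) t \<bullet> x' t) - \<epsilon> * (X x0 t \<bullet> z' t)"
        unfolding T4_def T5_def by (simp add: algebra_simps)
      moreover have "mom \<epsilon> (x t) t \<bullet> x' t = a (x t) \<bullet> x' t + \<epsilon> * (X (x t) t \<bullet> x' t)"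
        by (simp add: mom_def algebra_simps)
      moreover have "q / 2 * (X x0 0 \<bullet> J (Xt x0 t)) = (b x0 * (J (\<zeta> t) \<bullet> z' t)) / 2 - q / 2 * w x0"
        unfolding Jz by (simp add: algebra_simps)
      ultimately have "mom \<epsilon> (x t) t \<bullet> x' t - Q' t + q / 2 * w x0 = T1 + T2 + T3 + T4 + T5"
        unfolding Q'_def using curl Xz by (simp add: field_simps)
      moreover have "\<bar>T1\<bar> \<le> C1 * \<epsilon>^3"
      proof -
        have "\<bar>T1\<bar> \<le> norm (a (x t) - a x0 - a' x0 (x t - x0)) * norm (x' t)"
          unfolding T1_def by (rule Cauchy_Schwarz_ineq2)
        also have "\<dots> \<le> (M * (4 * pi * N * \<epsilon>)\<^sup>2) * (2 * N * \<epsilon>)"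
        proof (rule mult_mono)
          have "norm (a (x t) - a x0 - a' x0 (x t - x0)) \<le> M * (norm (x t - x0))\<^sup>2"
            by (rule covector_fieldD(6)[OF a x0 D])
          also have "\<dots> \<le> M * (4 * pi * N * \<epsilon>)\<^sup>2"
            using M_ge xx[of t] by (intro mult_left_mono power_mono) auto
          finally show "norm (a (x t) - a x0 - a' x0 (x t - x0)) \<le> M * (4 * pi * N * \<epsilon>)\<^sup>2" .
        qed (use x'b M_ge in auto)
        also have "\<dots> = C1 * \<epsilon>^3" by (simp add: C1_def power2_eq_square power3_eq_cube)
        finally show ?thesis .
      qed
      moreover have "\<bar>T2\<bar> \<le> C2 * \<epsilon>^3"
      proof -
        have "\<bar>T2\<bar> \<le> norm (a' x0 (d t)) * norm (x' t)"
          unfolding T2_def by (rule Cauchy_Schwarz_ineq2)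
        also have "\<dots> \<le> (M * (4 * pi * N1 * \<epsilon>\<^sup>2)) * (2 * N * \<epsilon>)"
        proof (rule mult_mono)
          show "norm (a' x0 (d t)) \<le> M * (4 * pi * N1 * \<epsilon>\<^sup>2)"
            using M_ge by (intro order_trans[OF covector_fieldD(3)[OF a x0]] mult_left_mono d) simp
        qed (use x'b M_ge N1 in auto)
        also have "\<dots> = C2 * \<epsilon>^3" by (simp add: C2_def power2_eq_square power3_eq_cube)
        finally show ?thesis .
      qed
      moreover have "\<bar>T3\<bar> \<le> C3 * \<epsilon>^3"
      proof -
        have "\<bar>T3\<bar> \<le> norm (a' x0 (\<zeta> t)) * norm (x' t - z' t)"
          unfolding T3_def by (rule Cauchy_Schwarz_ineq2)
        also have "\<dots> \<le> (M * ((4 * pi * N + 4 * pi * N1) * \<epsilon>)) * (2 * N1 * \<epsilon>\<^sup>2)"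
        proof (rule mult_mono)
          show "norm (a' x0 (\<zeta> t)) \<le> M * ((4 * pi * N + 4 * pi * N1) * \<epsilon>)"
            using M_ge by (intro order_trans[OF covector_fieldD(3)[OF a x0]] mult_left_mono \<zeta>b) simp
        qed (use xz' M_ge N1 N_ge \<epsilon> in auto)
        also have "\<dots> = C3 * \<epsilon>^3" by (simp add: C3_def power2_eq_square power3_eq_cube)
        finally show ?thesis .
      qed
      moreover have "\<bar>T4\<bar> \<le> C4 * \<epsilon>^3"
      proof -
        have "\<bar>(X (x t) t - X x0 t) \<bullet> x' t\<bar> \<le> norm (X (x t) t - X x0 t) * norm (x' t)"
          by (rule Cauchy_Schwarz_ineq2)
        also have "\<dots> \<le> (2 * M * (4 * pi * N * \<epsilon>)) * (2 * N * \<epsilon>)"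
        proof (rule mult_mono)
          show "norm (X (x t) t - X x0 t) \<le> 2 * M * (4 * pi * N * \<epsilon>)"
            using M_ge by (intro order_trans[OF X_lip[OF x0 D]] mult_left_mono xx) simp
        qed (use x'b M_ge N_ge \<epsilon> in auto)
        finally have "\<bar>T4\<bar> \<le> \<epsilon> * ((2 * M * (4 * pi * N * \<epsilon>)) * (2 * N * \<epsilon>))"
          unfolding T4_def abs_mult using \<epsilon> by (simp add: mult_left_mono)
        also have "\<dots> = C4 * \<epsilon>^3" by (simp add: C4_def power2_eq_square power3_eq_cube)
        finally show ?thesis .
      qed
      moreover have "\<bar>T5\<bar> \<le> C5 * \<epsilon>^3"
      proof -
        have "\<bar>X x0 t \<bullet> (x' t - z' t)\<bar> \<le> norm (X x0 t) * norm (x' t - z' t)"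
          by (rule Cauchy_Schwarz_ineq2)
        also have "\<dots> \<le> (2 * M) * (2 * N1 * \<epsilon>\<^sup>2)"
          using X_bound[OF x0] xz' M_ge by (intro mult_mono) auto
        finally have "\<bar>T5\<bar> \<le> \<epsilon> * ((2 * M) * (2 * N1 * \<epsilon>\<^sup>2))"
          unfolding T5_def abs_mult using \<epsilon> by (simp add: mult_left_mono)
        also have "\<dots> = C5 * \<epsilon>^3" by (simp add: C5_def power2_eq_square power3_eq_cube)
        finally show ?thesis .
      qed
      ultimately show ?thesis unfolding distrib_right real_norm_def by linarith
    qed
    ultimately have "norm ((P (2 * pi) - Q (2 * pi) + q / 2 * w x0 * (2 * pi)) - (P 0 - Q 0 + q / 2 * w x0 * 0))
        \<le> ((C1 + C2 + C3 + C4 + C5) * \<epsilon>^3) * (2 * pi)"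
      by (rule mvt_norm_bound[where f = "\<lambda>t. P t - Q t + q / 2 * w x0 * t"]) auto
    moreover have "P (2 * pi) - Q (2 * pi) + q / 2 * w x0 * (2 * pi) - (P 0 - Q 0 + q / 2 * w x0 * 0)
        = s + pi * \<epsilon>\<^sup>2 * (w x0 / b x0)"
      by (simp add: P Qper q_def)
    moreover have "((C1 + C2 + C3 + C4 + C5) * \<epsilon>^3) * (2 * pi) = C * \<epsilon>^3"
      by (simp add: C_def)
    ultimately show ?thesis by simp
  qed
  moreover have "C > 0" using C0 by (simp add: C_def add_pos_pos)
  ultimately show ?thesis by blast
qed


text \<open>The hypothesis on the points of \<open>K\<close> outside the interior keeps the maximum of the action away from them: the
  gap \<open>\<pi> \<epsilon>\<^sup>2 \<nu>\<close> of the leading terms exceeds twice the error \<open>C \<epsilon>\<^sup>3\<close>. At an interior maximum the starting point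
  may move in the direction \<open>J \<mu>\<close>, which would increase the action unless \<open>\<mu> = 0\<close>.\<close>

theorem planar_orbit:
  assumes x1: "x1 \<in> K" and \<nu>: "\<nu> > 0"
    and bdry: "\<And>x. x \<in> K \<Longrightarrow> x \<notin> interior K \<Longrightarrow> w x / b x \<ge> w x1 / b x1 + \<nu>"
  shows "\<exists>\<epsilon>0>0. \<forall>\<epsilon>. 0 < \<epsilon> \<and> \<epsilon> < \<epsilon>0 \<longrightarrow>
    (\<exists>x. (\<forall>t. x (t + 2 * pi) = x t) \<and> (\<forall>t. x t \<in> D \<and> B \<epsilon> (x t) t > 0 \<and>
       (x has_vector_derivative \<epsilon> *\<^sub>R F \<epsilon> (x t) t) (at t)))"
proof -
  obtain C where C: "C > 0" "\<And>\<epsilon> x0 x \<mu> s. small \<epsilon> \<Longrightarrow> x0 \<in> D \<Longrightarrow> loop \<epsilon> x0 x \<mu> \<Longrightarrow> action \<epsilon> x \<mu> s \<Longrightarrow>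
     \<bar>s + pi * \<epsilon>\<^sup>2 * (w x0 / b x0)\<bar> \<le> C * \<epsilon>^3"
    using action_value by blast
  have K_sub: "x \<in> D" if "x \<in> K" for x using K_D[OF that] r_pos by (metis centre_in_cball less_imp_le subsetD)
  have pos: "0 < 4 * pi * N" "0 < 96 * pi * M * N" "0 < M * N" using N_ge M_ge by auto
  define \<epsilon>0 where "\<epsilon>0 = Min {\<epsilon>1, r / (4 * pi * N), 1 / 2 / (4 * pi * N), b0 / (96 * pi * M * N), pi * \<nu> / (2 * C)}"
  have "\<epsilon>0 > 0"
    using \<epsilon>1 r_pos b0_pos \<nu> C(1) pos by (auto simp: \<epsilon>0_def)
  moreover have "\<exists>x. (\<forall>t. x (t + 2 * pi) = x t) \<and> (\<forall>t. x t \<in> D \<and> B \<epsilon> (x t) t > 0 \<and>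
       (x has_vector_derivative \<epsilon> *\<^sub>R F \<epsilon> (x t) t) (at t))" if "0 < \<epsilon>" "\<epsilon> < \<epsilon>0" for \<epsilon>
  proof -
    have le: "\<epsilon> < \<epsilon>1" "\<epsilon> < r / (4 * pi * N)" "\<epsilon> < 1 / 2 / (4 * pi * N)" "\<epsilon> < b0 / (96 * pi * M * N)"
        "\<epsilon> < pi * \<nu> / (2 * C)"
      using that by (auto simp: \<epsilon>0_def)
    have small: "small \<epsilon>"
      using le(1-3) that(1) pos unfolding small_def by (auto simp: pos_less_divide_eq mult.commute[of \<epsilon>])
    have \<epsilon>': "96 * pi * M * N * \<epsilon> \<le> b0"
      using le(4) pos(2) by (simp add: pos_less_divide_eq mult.commute[of \<epsilon>] less_imp_le)
    have "\<epsilon> * (2 * C) < pi * \<nu>" using le(5) C(1) by (simp add: pos_less_divide_eq)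
    then have "\<epsilon>\<^sup>2 * (\<epsilon> * (2 * C)) < \<epsilon>\<^sup>2 * (pi * \<nu>)" using that(1) by simp
    then have C\<nu>: "2 * (C * \<epsilon>^3) < pi * \<epsilon>\<^sup>2 * \<nu>" by (simp add: power2_eq_square power3_eq_cube ac_simps)
    have "\<forall>x0\<in>K. \<exists>x \<mu> s. loop \<epsilon> x0 x \<mu> \<and> action \<epsilon> x \<mu> s"
      using loop_exists[OF _ small] action_exists[OF _ small] by blast
    then obtain x \<mu> s where loop: "\<And>x0. x0 \<in> K \<Longrightarrow> loop \<epsilon> x0 (x x0) (\<mu> x0)"
      and action: "\<And>x0. x0 \<in> K \<Longrightarrow> action \<epsilon> (x x0) (\<mu> x0) (s x0)"
      by metis
    have val: "\<bar>s x0 + pi * \<epsilon>\<^sup>2 * (w x0 / b x0)\<bar> \<le> C * \<epsilon>^3" if "x0 \<in> K" for x0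
      by (rule C(2)[OF small K_sub[OF that] loop[OF that] action[OF that]])
    have "continuous_on K s"
      unfolding continuous_on
    proof
      fix x0 assume x0: "x0 \<in> K"
      let ?g = "\<lambda>y. (6 * M * norm (\<mu> x0) * norm (y - x0) + 48 * M * N * (norm (y - x0))\<^sup>2) * (2 * pi)"
      have "(?g \<longlongrightarrow> ?g x0) (at x0 within K)" by (intro tendsto_intros)
      then have g: "(?g \<longlongrightarrow> 0) (at x0 within K)" by simp
      have "((\<lambda>y. s y - s x0) \<longlongrightarrow> 0) (at x0 within K)"
      proof (rule Lim_null_comparison[OF _ g])
        have "norm (s y - s x0) \<le> ?g y" if "y \<in> K" for y
          using action_lipschitz[OF loop[OF x0] loop[OF that] small action[OF x0] action[OF that]] by simp
        then show "\<forall>\<^sub>F y in at x0 within K. norm (s y - s x0) \<le> ?g y"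
          by (auto simp: eventually_at_filter)
      qed
      then show "(s \<longlongrightarrow> s x0) (at x0 within K)" by (rule LIM_zero_cancel)
    qed
    then obtain xm where xm: "xm \<in> K" "\<And>y. y \<in> K \<Longrightarrow> s y \<le> s xm"
      using continuous_attains_sup[OF compact_K, of s] x1 by blast
    have "xm \<in> interior K"
    proof (rule ccontr)
      assume "xm \<notin> interior K"
      then have "pi * \<epsilon>\<^sup>2 * (w xm / b xm) \<ge> pi * \<epsilon>\<^sup>2 * (w x1 / b x1 + \<nu>)"
        using bdry[OF xm(1)] that(1) by (intro mult_left_mono) auto
      then show False
        using val[OF xm(1)] val[OF x1] xm(2)[OF x1] C\<nu> unfolding distrib_left abs_le_iff by linarith
    qed
    then obtain e where e: "e > 0" "ball xm e \<subseteq> K" by (auto simp: mem_interior)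
    have "\<mu> xm = 0"
    proof (rule ccontr)
      assume nz: "\<mu> xm \<noteq> 0"
      define \<tau> where "\<tau> = min (e / (2 * norm (\<mu> xm))) (b0 / (384 * M * N))"
      have \<tau>: "\<tau> > 0" using nz e b0_pos pos by (auto simp: \<tau>_def)
      have "\<tau> * (2 * norm (\<mu> xm)) \<le> e"
        using nz by (simp add: \<tau>_def pos_le_divide_eq[symmetric])
      then have y: "xm + \<tau> *\<^sub>R J (\<mu> xm) \<in> K"
        using e \<tau> nz by (intro subsetD[OF e(2)]) (auto simp: dist_norm)
      have "\<tau> * (384 * M * N) \<le> b0"
        using pos(3) by (simp add: \<tau>_def pos_le_divide_eq[symmetric] mult.assoc)
      moreover have "\<tau> * (384 * M * N) = 2 * (192 * M * N * \<tau>)" by simp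
      moreover have "192 * M * N * \<tau> > 0" using mult_pos_pos[OF pos(3) \<tau>] by (simp add: ac_simps)
      ultimately have "192 * M * N * \<tau> < b0" by linarith
      from action_increase[OF loop[OF xm(1)] loop[OF y] small action[OF xm(1)] action[OF y] \<tau> \<epsilon>' this nz]
      show False using xm(2)[OF y] by simp
    qed
    then have l: "loop \<epsilon> xm (x xm) 0" using loop[OF xm(1)] by simp
    have "B \<epsilon> (x xm t) t > 0" for t
      using B_bounds(1)[of "x xm t" \<epsilon> t] l smallD[OF small] b0_pos by (auto simp: loop_def)
    then show ?thesis using l by (intro exI[of _ "x xm"]) (auto simp: loop_def)
  qed
  ultimately show ?thesis by blast
qed

end

section \<open>Smooth data in the plane\<close>

lemma Cinf_on_estimates:
  fixes f :: "'a::euclidean_space \<Rightarrow> 'b::euclidean_space"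
  assumes f: "Cinf_on UNIV f" and D: "compact D" "convex D"
  shows "\<exists>M\<ge>0. \<forall>x\<in>D. norm (f x) \<le> M \<and> (\<forall>u. norm (frechet_derivative f (at x) u) \<le> M * norm u) \<and>
     (\<forall>y\<in>D. norm (f y - f x) \<le> M * norm (y - x) \<and>
        norm (f y - f x - frechet_derivative f (at x) (y - x)) \<le> M * (norm (y - x))\<^sup>2)"
proof -
  have bnd: "\<exists>C\<ge>0. \<forall>x\<in>D. norm (h x) \<le> C" if "continuous_on UNIV h" for h :: "'a \<Rightarrow> 'b"
  proof -
    have "compact (h ` D)" using that D by (meson compact_continuous_image continuous_on_subset subset_UNIV)
    then obtain C where "\<forall>y\<in>h ` D. norm y \<le> C" using compact_imp_bounded bounded_iff by metis
    then show ?thesis by (intro exI[of _ "max C 0"]) auto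
  qed
  have lin: "linear (frechet_derivative h (at x))" if "Cinf_on UNIV h" for h :: "'a \<Rightarrow> 'b" and x
    using Cinf_on_has_derivative[OF that, of x] has_derivative_linear by blast
  have expand: "\<exists>C\<ge>0. \<forall>x\<in>S. \<forall>u. norm (T x u) \<le> C * g x * norm u"
    if T: "\<And>x. x \<in> S \<Longrightarrow> linear (T x)" and b: "\<And>i. i \<in> Basis \<Longrightarrow> \<exists>C\<ge>0. \<forall>x\<in>S. norm (T x i) \<le> C * g x"
      and g: "\<And>x. x \<in> S \<Longrightarrow> g x \<ge> 0"
    for T :: "'c \<Rightarrow> 'a \<Rightarrow> 'b" and S :: "'c set" and g :: "'c \<Rightarrow> real"
  proof -
    obtain C where C: "\<And>i. i \<in> Basis \<Longrightarrow> C i \<ge> 0" "\<And>i x. i \<in> Basis \<Longrightarrow> x \<in> S \<Longrightarrow> norm (T x i) \<le> C i * g x"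
      using b by metis
    have "norm (T x u) \<le> (\<Sum>i\<in>Basis. C i) * g x * norm u" if x: "x \<in> S" for x u
    proof -
      have "T x u = (\<Sum>i\<in>Basis. (u \<bullet> i) *\<^sub>R T x i)"
        by (subst euclidean_representation[of u, symmetric]) (simp add: linear_sum[OF T[OF x]] linear_scale[OF T[OF x]])
      also have "norm \<dots> \<le> (\<Sum>i\<in>Basis. norm u * (C i * g x))"
        by (rule order_trans[OF norm_sum], rule sum_mono)
           (use C x g Basis_le_norm in \<open>auto intro!: mult_mono\<close>)
      also have "\<dots> = (\<Sum>i\<in>Basis. C i) * g x * norm u" by (simp add: sum_distrib_left sum_distrib_right ac_simps)
      finally show ?thesis .
    qed
    then show ?thesis using C(1) by (intro exI[of _ "\<Sum>i\<in>Basis. C i"]) (auto intro: sum_nonneg)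
  qed
  have deriv: "\<exists>C\<ge>0. \<forall>x\<in>D. \<forall>u. norm (frechet_derivative h (at x) u) \<le> C * norm u"
    if h: "Cinf_on UNIV h" for h :: "'a \<Rightarrow> 'b"
    using expand[of D "\<lambda>x. frechet_derivative h (at x)" "\<lambda>x. 1"] lin[OF h] bnd Cinf_on_continuous[OF Cinf_on_frechet[OF h]]
    by auto
  have lip: "\<exists>C\<ge>0. \<forall>x\<in>D. \<forall>y\<in>D. norm (h y - h x) \<le> C * norm (y - x)"
    if h: "Cinf_on UNIV h" for h :: "'a \<Rightarrow> 'b"
  proof -
    obtain C where C: "C \<ge> 0" "\<And>x u. x \<in> D \<Longrightarrow> norm (frechet_derivative h (at x) u) \<le> C * norm u"
      using deriv[OF h] by auto
    have "norm (h y - h x) \<le> C * norm (y - x)" if "x \<in> D" "y \<in> D" for x y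
    proof (rule differentiable_bound[OF D(2) _ _ that(2,1)])
      show "(h has_derivative frechet_derivative h (at x)) (at x within D)" for x
        using Cinf_on_has_derivative[OF h] has_derivative_at_withinI by blast
      show "onorm (frechet_derivative h (at x)) \<le> C" if "x \<in> D" for x
        using C that by (intro onorm_bound) auto
    qed
    then show ?thesis using C(1) by blast
  qed
  obtain M1 where M1: "M1 \<ge> 0" "\<And>x. x \<in> D \<Longrightarrow> norm (f x) \<le> M1"
    using bnd[OF Cinf_on_continuous[OF f]] by auto
  obtain M2 where M2: "M2 \<ge> 0" "\<And>x u. x \<in> D \<Longrightarrow> norm (frechet_derivative f (at x) u) \<le> M2 * norm u"
    using deriv[OF f] by auto
  obtain M3 where M3: "M3 \<ge> 0" "\<And>x y. x \<in> D \<Longrightarrow> y \<in> D \<Longrightarrow> norm (f y - f x) \<le> M3 * norm (y - x)"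
    using lip[OF f] by auto
  have "\<exists>C\<ge>0. \<forall>z\<in>D \<times> D. \<forall>u. norm (frechet_derivative f (at (snd z)) u - frechet_derivative f (at (fst z)) u)
      \<le> C * norm (snd z - fst z) * norm u"
  proof (rule expand)
    show "linear (\<lambda>u. frechet_derivative f (at (snd z)) u - frechet_derivative f (at (fst z)) u)" for z
      by (intro linear_compose_sub lin f)
    show "\<exists>C\<ge>0. \<forall>z\<in>D \<times> D. norm (frechet_derivative f (at (snd z)) i - frechet_derivative f (at (fst z)) i)
        \<le> C * norm (snd z - fst z)" for i
      using lip[OF Cinf_on_frechet[OF f], of i] by auto
  qed simp
  then obtain M4 where M4: "M4 \<ge> 0" "\<And>x y u. x \<in> D \<Longrightarrow> y \<in> D \<Longrightarrow>
      norm (frechet_derivative f (at y) u - frechet_derivative f (at x) u) \<le> M4 * norm (y - x) * norm u"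
    by fastforce
  have taylor: "norm (f y - f x - frechet_derivative f (at x) (y - x)) \<le> M4 * (norm (y - x))\<^sup>2" if "x \<in> D" "y \<in> D" for x y
  proof -
    have seg: "closed_segment x y \<subseteq> D" using that D(2) by (simp add: closed_segment_subset)
    have "norm (f y - f x - frechet_derivative f (at x) (y - x)) \<le> norm (y - x) * (M4 * norm (y - x))"
    proof (rule differentiable_bound_linearization[where S = "closed_segment x y"])
      show "x + t *\<^sub>R (y - x) \<in> closed_segment x y" if "t \<in> {0..1}" for t
        using that by (auto simp: in_segment algebra_simps intro!: exI[of _ t])
      show "(f has_derivative frechet_derivative f (at z)) (at z within closed_segment x y)" for z
        using Cinf_on_has_derivative[OF f] has_derivative_at_withinI by blast
      show "onorm (frechet_derivative f (at z) - frechet_derivative f (at x)) \<le> M4 * norm (y - x)"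
        if z: "z \<in> closed_segment x y" for z
      proof (rule onorm_bound)
        fix u :: 'a
        have "norm (z - x) \<le> norm (y - x)"
          using segment_bound1[OF z] by simp
        then have "M4 * norm (z - x) * norm u \<le> M4 * norm (y - x) * norm u"
          using M4(1) by (intro mult_right_mono mult_left_mono) auto
        then show "norm ((frechet_derivative f (at z) - frechet_derivative f (at x)) u) \<le> M4 * norm (y - x) * norm u"
          using M4(2)[OF \<open>x \<in> D\<close>, of z u] seg z by auto
      qed (use M4 in auto)
    qed auto
    then show ?thesis by (simp add: power2_eq_square ac_simps)
  qed
  define M where "M = M1 + M2 + M3 + M4"
  have le: "M1 \<le> M" "M2 \<le> M" "M3 \<le> M" "M4 \<le> M" "0 \<le> M" using M1 M2 M3 M4 by (auto simp: M_def)
  show ?thesis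
  proof (intro exI[of _ M] conjI ballI allI)
    fix x assume x: "x \<in> D"
    show "norm (f x) \<le> M" using M1(2)[OF x] le by simp
    show "norm (frechet_derivative f (at x) u) \<le> M * norm u" for u
      using M2(2)[OF x, of u] mult_right_mono[OF le(2), of "norm u"] by simp
    fix y assume y: "y \<in> D"
    show "norm (f y - f x) \<le> M * norm (y - x)"
      using M3(2)[OF x y] mult_right_mono[OF le(3), of "norm (y - x)"] by simp
    show "norm (f y - f x - frechet_derivative f (at x) (y - x)) \<le> M * (norm (y - x))\<^sup>2"
      using taylor[OF x y] mult_right_mono[OF le(4), of "(norm (y - x))\<^sup>2"] by simp
  qed (use le in auto)
qed

abbreviation "e1 \<equiv> axis 1 1 :: real^2"
abbreviation "e2 \<equiv> axis 2 1 :: real^2"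

lemma plane_expand: "u = (u $ 1) *\<^sub>R e1 + (u $ 2) *\<^sub>R e2"
  by (simp add: vec_eq_iff forall_2 axis_def)

definition curl :: "(real^2 \<Rightarrow> real^2) \<Rightarrow> real^2 \<Rightarrow> real" where
  "curl X x = frechet_derivative X (at x) e1 $ 2 - frechet_derivative X (at x) e2 $ 1"

lemma curl_identity:
  assumes "Cinf_on UNIV X"
  shows "frechet_derivative X (at x) u \<bullet> v - frechet_derivative X (at x) v \<bullet> u = curl X x * (J u \<bullet> v)"
proof -
  have l: "linear (frechet_derivative X (at x))"
    using Cinf_on_has_derivative[OF assms, of x] has_derivative_linear by blast
  have e: "frechet_derivative X (at x) u
      = (u $ 1) *\<^sub>R frechet_derivative X (at x) e1 + (u $ 2) *\<^sub>R frechet_derivative X (at x) e2" for u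
    by (subst plane_expand[of u]) (simp only: linear_add[OF l] linear_scale[OF l])
  show ?thesis
    unfolding e[of u] e[of v] curl_def by (simp add: inner_vec_def sum_2 algebra_simps)
qed

lemma Cinf_on_curl: "Cinf_on UNIV X \<Longrightarrow> Cinf_on UNIV (curl X)"
  unfolding curl_def by (intro Cinf_intros Cinf_on_frechet open_UNIV)

lemma covector_field_mono:
  assumes "covector_field D M X X' \<kappa>" "M \<le> M'" "D' \<subseteq> D"
  shows "covector_field D' M' X X' \<kappa>"
proof -
  have m: "t \<le> M' * c" if "t \<le> M * c" "c \<ge> 0" for t c
    using that(1) mult_right_mono[OF assms(2) that(2)] by linarith
  show ?thesis
    unfolding covector_field_def
  proof (intro ballI conjI allI)
    fix x assume "x \<in> D'"
    then have x: "x \<in> D" using assms(3) by blast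
    note cf = covector_fieldD[OF assms(1) x]
    show "linear (X' x)" "X' x u \<bullet> v - X' x v \<bullet> u = \<kappa> x * (J u \<bullet> v)" for u v by (rule cf)+
    show "norm (X' x u) \<le> M' * norm u" for u by (rule m[OF cf(3)]) simp
    show "norm (X x) \<le> M'" "\<bar>\<kappa> x\<bar> \<le> M'" using cf(4,5) assms(2) by linarith+
    fix y assume "y \<in> D'"
    then have y: "y \<in> D" using assms(3) by blast
    show "norm (X y - X x - X' x (y - x)) \<le> M' * (norm (y - x))\<^sup>2" by (rule m[OF cf(6)[OF y]]) simp
    show "norm (X y - X x) \<le> M' * norm (y - x)" by (rule m[OF cf(7)[OF y]]) simp
    show "\<bar>\<kappa> y - \<kappa> x\<bar> \<le> M' * norm (y - x)" by (rule m[OF cf(8)[OF y]]) simp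
  qed
qed

lemma Cinf_on_covector_field:
  assumes X: "Cinf_on UNIV X" and D: "compact D" "convex D"
  shows "\<exists>M. covector_field D M X (\<lambda>x. frechet_derivative X (at x)) (curl X)"
proof -
  obtain M1 where M1: "M1 \<ge> 0" "\<And>x. x \<in> D \<Longrightarrow> norm (X x) \<le> M1"
      "\<And>x u. x \<in> D \<Longrightarrow> norm (frechet_derivative X (at x) u) \<le> M1 * norm u"
      "\<And>x y. x \<in> D \<Longrightarrow> y \<in> D \<Longrightarrow> norm (X y - X x) \<le> M1 * norm (y - x)"
      "\<And>x y. x \<in> D \<Longrightarrow> y \<in> D \<Longrightarrow> norm (X y - X x - frechet_derivative X (at x) (y - x)) \<le> M1 * (norm (y - x))\<^sup>2"
    using Cinf_on_estimates[OF X D] by metis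
  obtain M2 where M2: "M2 \<ge> 0" "\<And>x. x \<in> D \<Longrightarrow> \<bar>curl X x\<bar> \<le> M2"
      "\<And>x y. x \<in> D \<Longrightarrow> y \<in> D \<Longrightarrow> \<bar>curl X y - curl X x\<bar> \<le> M2 * norm (y - x)"
    using Cinf_on_estimates[OF Cinf_on_curl[OF X] D] by (metis real_norm_def)
  define M where "M = max M1 M2"
  have m: "M1 * c \<le> M * c" "M2 * c \<le> M * c" if "c \<ge> 0" for c
    using that by (auto simp: M_def mult_right_mono)
  have l: "linear (frechet_derivative X (at x))" for x
    using Cinf_on_has_derivative[OF X, of x] has_derivative_linear by blast
  have "covector_field D M X (\<lambda>x. frechet_derivative X (at x)) (curl X)"
    unfolding covector_field_def
  proof (intro ballI conjI allI)
    fix x assume x: "x \<in> D"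
    show "linear (frechet_derivative X (at x))" by (rule l)
    show "frechet_derivative X (at x) u \<bullet> v - frechet_derivative X (at x) v \<bullet> u = curl X x * (J u \<bullet> v)" for u v
      by (rule curl_identity[OF X])
    show "norm (frechet_derivative X (at x) u) \<le> M * norm u" for u
      by (rule order_trans[OF M1(3)[OF x] m(1)]) simp
    show "norm (X x) \<le> M" "\<bar>curl X x\<bar> \<le> M" using M1(2)[OF x] M2(2)[OF x] by (auto simp: M_def)
    fix y assume y: "y \<in> D"
    show "norm (X y - X x - frechet_derivative X (at x) (y - x)) \<le> M * (norm (y - x))\<^sup>2"
      by (rule order_trans[OF M1(5)[OF x y] m(1)]) simp
    show "norm (X y - X x) \<le> M * norm (y - x)"
      by (rule order_trans[OF M1(4)[OF x y] m(1)]) simp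
    show "\<bar>curl X y - curl X x\<bar> \<le> M * norm (y - x)"
      by (rule order_trans[OF M2(3)[OF x y] m(2)]) simp
  qed
  then show ?thesis by blast
qed

text \<open>The potential is \<open>A dx2\<close>, where \<open>A\<close> integrates \<open>\<beta>\<close> along horizontal segments from the vertical axis.
  Rescaling these to the unit interval makes the integrand smooth in all variables, so that its estimates,
  uniform in the parameter, can be integrated.\<close>

lemma covector_potential:
  fixes \<beta> :: "real^2 \<Rightarrow> real"
  assumes \<beta>: "Cinf_on UNIV \<beta>" and D: "compact D" "convex D"
  shows "\<exists>a a' M. covector_field D M a a' \<beta>"
proof -
  define L :: "real \<times> (real^2) \<Rightarrow> real^2" where
    "L p = (fst p * snd p $ 1) *\<^sub>R e1 + (snd p $ 2) *\<^sub>R e2" for p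
  define n where "n p = snd p $ 1 * \<beta> (L p)" for p :: "real \<times> (real^2)"
  have L: "Cinf_on UNIV L" unfolding L_def by (intro Cinf_intros open_UNIV)
  have n: "Cinf_on UNIV n"
    unfolding n_def by (intro Cinf_intros open_UNIV Cinf_on_compose[OF \<beta> L]) auto
  define n' where "n' p = frechet_derivative n (at p)" for p
  have lin: "linear (n' p)" for p
    using Cinf_on_has_derivative[OF n, of p] has_derivative_linear unfolding n'_def by blast
  have cD: "compact ({0..1::real} \<times> D)" "convex ({0..1::real} \<times> D)"
    using D by (auto intro: compact_Times convex_Times)
  obtain M1 where M1: "M1 \<ge> 0" "\<And>p. p \<in> {0..1} \<times> D \<Longrightarrow> norm (n p) \<le> M1"
      "\<And>p u. p \<in> {0..1} \<times> D \<Longrightarrow> norm (n' p u) \<le> M1 * norm u"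
      "\<And>p q. p \<in> {0..1} \<times> D \<Longrightarrow> q \<in> {0..1} \<times> D \<Longrightarrow> norm (n q - n p) \<le> M1 * norm (q - p)"
      "\<And>p q. p \<in> {0..1} \<times> D \<Longrightarrow> q \<in> {0..1} \<times> D \<Longrightarrow> norm (n q - n p - n' p (q - p)) \<le> M1 * (norm (q - p))\<^sup>2"
    using Cinf_on_estimates[OF n cD] unfolding n'_def by metis
  obtain M2 where M2: "M2 \<ge> 0" "\<And>x. x \<in> D \<Longrightarrow> \<bar>\<beta> x\<bar> \<le> M2"
      "\<And>x y. x \<in> D \<Longrightarrow> y \<in> D \<Longrightarrow> \<bar>\<beta> y - \<beta> x\<bar> \<le> M2 * norm (y - x)"
    using Cinf_on_estimates[OF \<beta> D] by (metis real_norm_def)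
  define M where "M = max M1 M2"
  have m: "t \<le> M1 * c \<Longrightarrow> t \<le> M * c" "t \<le> M2 * c \<Longrightarrow> t \<le> M * c" if "c \<ge> 0" for t c
    using mult_right_mono[OF _ that, of M1 M] mult_right_mono[OF _ that, of M2 M] by (auto simp: M_def)
  have slice: "continuous_on {0..1} (\<lambda>t. f (t, x))" if "continuous_on UNIV f"
    for f :: "real \<times> (real^2) \<Rightarrow> real" and x
    by (rule continuous_on_compose2[OF that]) (auto intro!: continuous_intros)
  have nc: "continuous_on {0..1} (\<lambda>t. n (t, x))" for x
    by (rule slice[OF Cinf_on_continuous[OF n]])
  have n'c: "continuous_on {0..1} (\<lambda>t. n' (t, x) u)" for x u
    using slice[OF Cinf_on_continuous[OF Cinf_on_frechet[OF n]]] by (simp add: n'_def)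
  have ni: "(\<lambda>t. n (t, x)) integrable_on {0..1}" and n'i: "(\<lambda>t. n' (t, x) u) integrable_on {0..1}" for x u
    by (intro integrable_continuous_real nc n'c)+
  define A where "A x = integral {0..1} (\<lambda>t. n (t, x))" for x
  define A' where "A' x u = integral {0..1} (\<lambda>t. n' (t, x) (0, u))" for x u
  have int_le: "\<bar>integral {0..1} f\<bar> \<le> C" if "continuous_on {0..1} f" "\<And>t. t \<in> {0..1} \<Longrightarrow> \<bar>f t\<bar> \<le> C"
    for f :: "real \<Rightarrow> real" and C
    using integral_bound[OF _ that(1), of C] that(2) by auto
  have A'lin: "linear (A' x)" for x
  proof (rule linearI)
    show "A' x (u + v) = A' x u + A' x v" for u v
    proof -
      have "n' (t, x) (0, u + v) = n' (t, x) (0, u) + n' (t, x) (0, v)" for t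
        by (metis add_Pair add_0 linear_add[OF lin])
      then show ?thesis by (simp add: A'_def Henstock_Kurzweil_Integration.integral_add n'i)
    qed
    show "A' x (r *\<^sub>R u) = r *\<^sub>R A' x u" for r u
    proof -
      have "n' (t, x) (0, r *\<^sub>R u) = r * n' (t, x) (0, u)" for t
        by (metis scaleR_Pair scaleR_zero_right linear_scale[OF lin] real_scaleR_def)
      then show ?thesis by (simp add: A'_def)
    qed
  qed
  have A'1: "A' x e1 = \<beta> x" for x
  proof -
    define \<beta>' where "\<beta>' y = frechet_derivative \<beta> (at y)" for y
    have \<beta>': "(\<beta> has_derivative \<beta>' y) (at y)" for y
      unfolding \<beta>'_def by (rule Cinf_on_has_derivative[OF \<beta>]) simp
    have l': "linear (\<beta>' y)" for y using \<beta>' has_derivative_linear by blast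
    have n'_eq: "n' (t, x) (0, e1) = \<beta> (L (t, x)) + t * (x $ 1) * \<beta>' (L (t, x)) e1" for t
    proof -
      have c: "((\<lambda>p :: real \<times> (real^2). snd p $ i) has_derivative (\<lambda>h. snd h $ i)) (at p)" for i p
        by (rule bounded_linear_imp_has_derivative[OF bounded_linear_compose[OF bounded_linear_vec_nth bounded_linear_snd]])
      have "((\<lambda>p :: real \<times> (real^2). fst p * snd p $ 1) has_derivative (\<lambda>h. t * snd h $ 1 + fst h * x $ 1)) (at (t, x))"
        using has_derivative_mult[OF has_derivative_fst[OF has_derivative_ident] c[of 1 "(t, x)"]] by simp
      then have dL: "(L has_derivative (\<lambda>h. (t * snd h $ 1 + fst h * x $ 1) *\<^sub>R e1 + (snd h $ 2) *\<^sub>R e2)) (at (t, x))"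
        unfolding L_def by (intro has_derivative_add has_derivative_scaleR_left c)
      have "(n has_derivative (\<lambda>h. x $ 1 * \<beta>' (L (t, x)) ((t * snd h $ 1 + fst h * x $ 1) *\<^sub>R e1 + (snd h $ 2) *\<^sub>R e2)
          + snd h $ 1 * \<beta> (L (t, x)))) (at (t, x))"
        unfolding n_def using has_derivative_mult[OF c[of 1 "(t, x)"] has_derivative_compose[OF dL \<beta>']] by simp
      from frechet_derivative_at[OF this]
      have "n' (t, x) = (\<lambda>h. x $ 1 * \<beta>' (L (t, x)) ((t * snd h $ 1 + fst h * x $ 1) *\<^sub>R e1 + (snd h $ 2) *\<^sub>R e2)
          + snd h $ 1 * \<beta> (L (t, x)))"
        unfolding n'_def by simp
      then show ?thesis by (simp add: linear_scale[OF l'] axis_def)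
    qed
    have "((\<lambda>t. t * \<beta> (L (t, x))) has_vector_derivative n' (t, x) (0, e1)) (at t within {0..1})" for t
    proof -
      have "((\<lambda>t. L (t, x)) has_derivative (\<lambda>h. (h * x $ 1) *\<^sub>R e1)) (at t)"
        unfolding L_def by (auto intro!: derivative_eq_intros)
      from has_derivative_mult[OF has_derivative_ident has_derivative_compose[OF this \<beta>']]
      have "((\<lambda>t. t * \<beta> (L (t, x))) has_derivative (\<lambda>h. h * n' (t, x) (0, e1))) (at t)"
        by (rule has_derivative_eq_rhs) (auto simp: n'_eq linear_scale[OF l'] algebra_simps)
      then show ?thesis
        by (auto simp: has_vector_derivative_def intro: has_derivative_at_withinI)
    qed
    from fundamental_theorem_of_calculus[OF _ this]
    have "A' x e1 = \<beta> (L (1, x))" unfolding A'_def by (auto intro!: integral_unique)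
    also have "L (1, x) = x" using plane_expand[of x] by (simp add: L_def)
    finally show ?thesis .
  qed
  have A'e: "A' x u = u $ 1 * \<beta> x + u $ 2 * A' x e2" for x u
    by (subst plane_expand[of u]) (simp only: linear_add[OF A'lin] linear_scale[OF A'lin] A'1 real_scaleR_def)
  have normp: "norm ((0::real), u) = norm u" for u :: "real^2" by (simp add: norm_Pair)
  have "covector_field D M (\<lambda>x. A x *\<^sub>R e2) (\<lambda>x u. A' x u *\<^sub>R e2) \<beta>"
    unfolding covector_field_def
  proof (intro ballI conjI allI)
    fix x assume x: "x \<in> D"
    show "linear (\<lambda>u. A' x u *\<^sub>R e2)" by (rule linearI) (auto simp: linear_add[OF A'lin] linear_scale[OF A'lin] algebra_simps)
    show "A' x u *\<^sub>R e2 \<bullet> v - A' x v *\<^sub>R e2 \<bullet> u = \<beta> x * (J u \<bullet> v)" for u v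
      unfolding A'e[of x u] A'e[of x v] by (simp add: inner_vec_def sum_2 axis_def algebra_simps)
    show "norm (A' x u *\<^sub>R e2) \<le> M * norm u" for u
    proof -
      have "\<bar>A' x u\<bar> \<le> M1 * norm u" unfolding A'_def
        by (rule int_le[OF n'c]) (use M1(3)[of "(t, x)" "(0, u)" for t] x in \<open>auto simp: normp\<close>)
      then show ?thesis by (simp add: m)
    qed
    have "\<bar>A x\<bar> \<le> M1" unfolding A_def by (rule int_le[OF nc]) (use M1(2)[of "(t, x)" for t] x in auto)
    then show "norm (A x *\<^sub>R e2) \<le> M" "\<bar>\<beta> x\<bar> \<le> M" using M2(2)[OF x] by (auto simp: M_def)
    fix y assume y: "y \<in> D"
    show "\<bar>\<beta> y - \<beta> x\<bar> \<le> M * norm (y - x)" by (rule m(2)[OF _ M2(3)[OF x y]]) simp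
    have diff: "A y - A x = integral {0..1} (\<lambda>t. n (t, y) - n (t, x))"
      unfolding A_def by (rule Henstock_Kurzweil_Integration.integral_diff[symmetric]) (rule ni)+
    have "\<bar>A y - A x\<bar> \<le> M1 * norm (y - x)"
      unfolding diff
      by (rule int_le) (use M1(4)[of "(t, x)" "(t, y)" for t] x y in \<open>auto simp: normp intro!: continuous_intros nc\<close>)
    then show "norm (A y *\<^sub>R e2 - A x *\<^sub>R e2) \<le> M * norm (y - x)"
      by (simp add: m scaleR_diff_left[symmetric])
    have diff2: "A y - A x - A' x (y - x) = integral {0..1} (\<lambda>t. n (t, y) - n (t, x) - n' (t, x) (0, y - x))"
      unfolding diff A'_def
      by (rule Henstock_Kurzweil_Integration.integral_diff[symmetric])
         (intro Henstock_Kurzweil_Integration.integrable_diff ni n'i)+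
    have "\<bar>A y - A x - A' x (y - x)\<bar> \<le> M1 * (norm (y - x))\<^sup>2"
      unfolding diff2
      by (rule int_le) (use M1(5)[of "(t, x)" "(t, y)" for t] x y in \<open>auto simp: normp intro!: continuous_intros nc n'c\<close>)
    then show "norm (A y *\<^sub>R e2 - A x *\<^sub>R e2 - A' x (y - x) *\<^sub>R e2) \<le> M * (norm (y - x))\<^sup>2"
      by (simp add: m scaleR_diff_left[symmetric])
  qed
  then show ?thesis by blast
qed

text \<open>The quotient \<open>(J \<xi>1 \<bullet> \<xi>2) / \<beta>\<close> is the reciprocal of the density of \<open>\<beta>\<close> with respect to the area of the
  metric. The set \<open>D\<close> on which the estimates are made is a neighbourhood of \<open>K\<close> in which \<open>\<beta>\<close> is at least half
  its minimum over \<open>K\<close>.\<close>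

theorem smooth_planar_orbit:
  fixes \<beta> :: "real^2 \<Rightarrow> real" and \<xi>1 \<xi>2 :: "real^2 \<Rightarrow> real^2"
  assumes \<beta>: "Cinf_on UNIV \<beta>" and \<xi>1: "Cinf_on UNIV \<xi>1" and \<xi>2: "Cinf_on UNIV \<xi>2"
    and K: "compact K" "x1 \<in> K" and pos: "\<And>x. x \<in> K \<Longrightarrow> \<beta> x > 0" and \<nu>: "\<nu> > 0"
    and bdry: "\<And>x. x \<in> K \<Longrightarrow> x \<notin> interior K \<Longrightarrow>
      (J (\<xi>1 x) \<bullet> \<xi>2 x) / \<beta> x \<ge> (J (\<xi>1 x1) \<bullet> \<xi>2 x1) / \<beta> x1 + \<nu>"
  shows "\<exists>\<epsilon>0>0. \<forall>\<epsilon>. 0 < \<epsilon> \<and> \<epsilon> < \<epsilon>0 \<longrightarrow>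
    (\<exists>x. (\<forall>t. x (t + 2 * pi) = x t) \<and>
      (\<forall>t. \<beta> (x t) > 0 \<and> \<beta> (x t) + \<epsilon> * (cos t * curl \<xi>1 (x t) + sin t * curl \<xi>2 (x t)) > 0 \<and>
       (x has_vector_derivative
         (\<epsilon> / (\<beta> (x t) + \<epsilon> * (cos t * curl \<xi>1 (x t) + sin t * curl \<xi>2 (x t)))) *\<^sub>R
           J (- sin t *\<^sub>R \<xi>1 (x t) + cos t *\<^sub>R \<xi>2 (x t))) (at t)))"
proof -
  obtain R where R: "R > 0" "\<And>x. x \<in> K \<Longrightarrow> norm x \<le> R"
    using compact_imp_bounded[OF K(1)] bounded_pos by blast
  define E where "E = cball (0::real^2) (R + 1)"
  have E: "compact E" "convex E" by (auto simp: E_def)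
  obtain a a' M1 where M1: "covector_field E M1 a a' \<beta>" using covector_potential[OF \<beta> E] by blast
  obtain M2 where M2: "covector_field E M2 \<xi>1 (\<lambda>x. frechet_derivative \<xi>1 (at x)) (curl \<xi>1)"
    using Cinf_on_covector_field[OF \<xi>1 E] by blast
  obtain M3 where M3: "covector_field E M3 \<xi>2 (\<lambda>x. frechet_derivative \<xi>2 (at x)) (curl \<xi>2)"
    using Cinf_on_covector_field[OF \<xi>2 E] by blast
  define M where "M = Max {1, M1, M2, M3}"
  obtain xm where xm: "xm \<in> K" "\<And>x. x \<in> K \<Longrightarrow> \<beta> xm \<le> \<beta> x"
    using continuous_attains_inf[of K \<beta>] K Cinf_on_continuous[OF \<beta>] continuous_on_subset by blast
  define b0 where "b0 = \<beta> xm / 2"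
  have b0: "b0 > 0" using pos[OF xm(1)] by (simp add: b0_def)
  define D where "D = {x \<in> E. \<beta> x \<ge> b0}"
  define r where "r = min 1 (b0 / M)"
  have M: "1 \<le> M" "M1 \<le> M" "M2 \<le> M" "M3 \<le> M" by (auto simp: M_def)
  have DE: "D \<subseteq> E" by (auto simp: D_def)
  have loc: "planar_magnetic D K M r b0 a \<xi>1 \<xi>2 a' (\<lambda>x. frechet_derivative \<xi>1 (at x))
      (\<lambda>x. frechet_derivative \<xi>2 (at x)) \<beta> (curl \<xi>1) (curl \<xi>2)"
  proof
    show "covector_field D M a a' \<beta>" by (rule covector_field_mono[OF M1 M(2) DE])
    show "covector_field D M \<xi>1 (\<lambda>x. frechet_derivative \<xi>1 (at x)) (curl \<xi>1)"
      by (rule covector_field_mono[OF M2 M(3) DE])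
    show "covector_field D M \<xi>2 (\<lambda>x. frechet_derivative \<xi>2 (at x)) (curl \<xi>2)"
      by (rule covector_field_mono[OF M3 M(4) DE])
    show "cball x r \<subseteq> D" if x: "x \<in> K" for x
    proof
      fix y assume "y \<in> cball x r"
      then have y: "norm (y - x) \<le> 1" "norm (y - x) \<le> b0 / M" by (auto simp: r_def dist_norm norm_minus_commute)
      have xE: "x \<in> E" using R(2)[OF x] by (simp add: E_def)
      have yE: "y \<in> E" using R(2)[OF x] y(1) norm_triangle_sub[of y x] by (simp add: E_def)
      have "\<bar>\<beta> y - \<beta> x\<bar> \<le> M1 * norm (y - x)" by (rule covector_fieldD(8)[OF M1 xE yE])
      also have "\<dots> \<le> M * (b0 / M)" using M y(2) by (intro mult_mono) auto
      also have "\<dots> = b0" using M by simp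
      finally have "\<beta> y \<ge> b0" using xm(2)[OF x] unfolding b0_def abs_le_iff by linarith
      then show "y \<in> D" using yE by (simp add: D_def)
    qed
  qed (use K M b0 in \<open>auto simp: D_def r_def\<close>)
  let ?B = "\<lambda>\<epsilon> x t. \<beta> x + \<epsilon> * (cos t * curl \<xi>1 x + sin t * curl \<xi>2 x)"
  have B: "planar_magnetic.B \<beta> (curl \<xi>1) (curl \<xi>2) \<epsilon> x t = ?B \<epsilon> x t" for \<epsilon> x t
    by (simp add: planar_magnetic.B_def[OF loc] planar_magnetic.c_def[OF loc])
  have F: "planar_magnetic.F \<xi>1 \<xi>2 \<beta> (curl \<xi>1) (curl \<xi>2) \<epsilon> x t
      = (1 / ?B \<epsilon> x t) *\<^sub>R J (- sin t *\<^sub>R \<xi>1 x + cos t *\<^sub>R \<xi>2 x)" for \<epsilon> x t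
    by (simp add: planar_magnetic.F_def[OF loc] B planar_magnetic.Xt_def[OF loc])
  obtain \<epsilon>0 where \<epsilon>0: "\<epsilon>0 > 0" "\<And>\<epsilon>. 0 < \<epsilon> \<Longrightarrow> \<epsilon> < \<epsilon>0 \<Longrightarrow> \<exists>x. (\<forall>t. x (t + 2 * pi) = x t) \<and>
      (\<forall>t. x t \<in> D \<and> ?B \<epsilon> (x t) t > 0 \<and> (x has_vector_derivative
         \<epsilon> *\<^sub>R ((1 / ?B \<epsilon> (x t) t) *\<^sub>R J (- sin t *\<^sub>R \<xi>1 (x t) + cos t *\<^sub>R \<xi>2 (x t)))) (at t))"
    using planar_magnetic.planar_orbit[OF loc K(2) \<nu>, unfolded planar_magnetic.w_def[OF loc], OF bdry]
    unfolding B F by blast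
  show ?thesis
  proof (intro exI[of _ \<epsilon>0] conjI allI impI \<epsilon>0(1))
    fix \<epsilon> assume \<epsilon>: "0 < \<epsilon> \<and> \<epsilon> < \<epsilon>0"
    obtain x where x: "\<And>t. x (t + 2 * pi) = x t" "\<And>t. x t \<in> D" "\<And>t. ?B \<epsilon> (x t) t > 0"
      "\<And>t. (x has_vector_derivative
         \<epsilon> *\<^sub>R ((1 / ?B \<epsilon> (x t) t) *\<^sub>R J (- sin t *\<^sub>R \<xi>1 (x t) + cos t *\<^sub>R \<xi>2 (x t)))) (at t)"
      using \<epsilon>0(2)[OF conjunct1[OF \<epsilon>] conjunct2[OF \<epsilon>]] by blast
    have "\<beta> (x t) > 0" for t using x(2)[of t] b0 by (simp add: D_def)
    then show "\<exists>x. (\<forall>t. x (t + 2 * pi) = x t) \<and> (\<forall>t. \<beta> (x t) > 0 \<and> ?B \<epsilon> (x t) t > 0 \<and>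
       (x has_vector_derivative (\<epsilon> / ?B \<epsilon> (x t) t) *\<^sub>R J (- sin t *\<^sub>R \<xi>1 (x t) + cos t *\<^sub>R \<xi>2 (x t))) (at t))"
      using x by (intro exI[of _ x]) simp
  qed
qed

section \<open>Exterior derivatives and the Euler-Lagrange equation in coordinates\<close>

text \<open>The second difference over a parallelogram is symmetric in its two sides, whereas its evaluation by two
  mean value steps singles out the order of differentiation.\<close>

lemma parallelogram_mvt:
  fixes f :: "'a::euclidean_space \<Rightarrow> real"
  assumes f: "Cinf_on (ball x e) f" and t: "t > 0" "t * norm u + t * norm v < e"
  shows "\<exists>z. dist x z < t * (norm u + norm v) + t \<and> z \<in> ball x e \<and>
    f (x + t *\<^sub>R u + t *\<^sub>R v) - f (x + t *\<^sub>R u) - f (x + t *\<^sub>R v) + f x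
      = t * t * frechet_derivative (\<lambda>y. frechet_derivative f (at y) u) (at z) v"
proof -
  define fu where "fu y = frechet_derivative f (at y) u" for y
  have fu: "Cinf_on (ball x e) fu" unfolding fu_def by (rule Cinf_on_frechet[OF f])
  have B: "norm (s *\<^sub>R u + r *\<^sub>R v) \<le> t * norm u + t * norm v" if "0 \<le> s" "s \<le> t" "0 \<le> r" "r \<le> t" for s r
    by (rule order_trans[OF norm_triangle_ineq]) (use that in \<open>auto intro!: add_mono mult_right_mono\<close>)
  have inb: "x + s *\<^sub>R u + r *\<^sub>R v \<in> ball x e" if "0 \<le> s" "s \<le> t" "0 \<le> r" "r \<le> t" for s r
  proof -
    have "dist x (x + s *\<^sub>R u + r *\<^sub>R v) = norm (s *\<^sub>R u + r *\<^sub>R v)"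
      by (metis add.assoc add_diff_cancel_left' dist_commute dist_norm)
    then show ?thesis using B[OF that] t(2) by simp
  qed
  have dir: "((\<lambda>s. k (p + s *\<^sub>R d)) has_real_derivative frechet_derivative k (at (p + s *\<^sub>R d)) d) (at s)"
    if "Cinf_on (ball x e) k" "p + s *\<^sub>R d \<in> ball x e" for k :: "'a \<Rightarrow> real" and p d s
  proof -
    note k = Cinf_on_has_derivative[OF that]
    have "((\<lambda>s. p + s *\<^sub>R d) has_derivative (\<lambda>h. h *\<^sub>R d)) (at s)" by (auto intro!: derivative_eq_intros)
    from has_derivative_compose[OF this k] show ?thesis
      unfolding has_field_derivative_def
      by (rule has_derivative_eq_rhs) (auto simp: linear_scale[OF has_derivative_linear[OF k]])
  qed
  define G where "G s = f (x + t *\<^sub>R v + s *\<^sub>R u) - f (x + s *\<^sub>R u)" for s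
  have "(G has_real_derivative fu (x + t *\<^sub>R v + s *\<^sub>R u) - fu (x + s *\<^sub>R u)) (at s)" if "0 \<le> s" "s \<le> t" for s
    unfolding G_def fu_def
    using inb[of s t] inb[of s 0] that t(1) by (intro DERIV_diff dir[OF f]) (auto simp: algebra_simps)
  then obtain s where s: "0 < s" "s < t" "G t - G 0 = (t - 0) * (fu (x + t *\<^sub>R v + s *\<^sub>R u) - fu (x + s *\<^sub>R u))"
    using MVT2[OF t(1), of G "\<lambda>s. fu (x + t *\<^sub>R v + s *\<^sub>R u) - fu (x + s *\<^sub>R u)"] by auto
  have "((\<lambda>r. fu ((x + s *\<^sub>R u) + r *\<^sub>R v)) has_real_derivative frechet_derivative fu (at ((x + s *\<^sub>R u) + r *\<^sub>R v)) v) (at r)"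
    if "0 \<le> r" "r \<le> t" for r
    using inb[of s r] that s by (intro dir[OF fu]) auto
  then obtain r where r: "0 < r" "r < t"
    "fu ((x + s *\<^sub>R u) + t *\<^sub>R v) - fu ((x + s *\<^sub>R u) + 0 *\<^sub>R v) = (t - 0) * frechet_derivative fu (at ((x + s *\<^sub>R u) + r *\<^sub>R v)) v"
    using MVT2[OF t(1), of "\<lambda>r. fu ((x + s *\<^sub>R u) + r *\<^sub>R v)"
        "\<lambda>r. frechet_derivative fu (at ((x + s *\<^sub>R u) + r *\<^sub>R v)) v"] by auto
  define z where "z = x + s *\<^sub>R u + r *\<^sub>R v"
  have "f (x + t *\<^sub>R u + t *\<^sub>R v) - f (x + t *\<^sub>R u) - f (x + t *\<^sub>R v) + f x = G t - G 0"
    by (simp add: G_def algebra_simps)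
  also have "\<dots> = t * (fu ((x + s *\<^sub>R u) + t *\<^sub>R v) - fu ((x + s *\<^sub>R u) + 0 *\<^sub>R v))"
    using s(3) by (simp add: algebra_simps)
  also have "\<dots> = t * t * frechet_derivative fu (at z) v" using r(3) by (simp add: z_def)
  finally have eq: "f (x + t *\<^sub>R u + t *\<^sub>R v) - f (x + t *\<^sub>R u) - f (x + t *\<^sub>R v) + f x = t * t * frechet_derivative fu (at z) v" .
  have "dist x z \<le> t * (norm u + norm v)"
  proof -
    have "dist x z = norm (s *\<^sub>R u + r *\<^sub>R v)"
      unfolding z_def by (metis add.assoc add_diff_cancel_left' dist_commute dist_norm)
    then show ?thesis using B[of s r] s r by (simp add: distrib_left)
  qed
  then have "dist x z < t * (norm u + norm v) + t" using t(1) by linarith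
  moreover have "z \<in> ball x e" using inb[of s r] s r by (simp add: z_def)
  ultimately show ?thesis using eq unfolding fu_def[abs_def] by blast
qed

lemma second_derivative_symmetric_real:
  fixes f :: "'a::euclidean_space \<Rightarrow> real"
  assumes f: "Cinf_on W f" and W: "open W" "x \<in> W"
  shows "frechet_derivative (\<lambda>y. frechet_derivative f (at y) u) (at x) v
       = frechet_derivative (\<lambda>y. frechet_derivative f (at y) v) (at x) u"
proof (rule ccontr)
  define p q where "p y = frechet_derivative (\<lambda>y. frechet_derivative f (at y) u) (at y) v"
    and "q y = frechet_derivative (\<lambda>y. frechet_derivative f (at y) v) (at y) u" for y
  assume "\<not> ?thesis"
  then have ne: "p x \<noteq> q x" by (simp add: p_def q_def)
  define \<eta> where "\<eta> = \<bar>p x - q x\<bar> / 2"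
  have \<eta>: "\<eta> > 0" using ne by (simp add: \<eta>_def)
  have "isCont p x" "isCont q x"
    unfolding p_def q_def using Cinf_on_continuous[OF Cinf_on_frechet[OF Cinf_on_frechet[OF f]]] W
    by (auto simp: continuous_on_eq_continuous_at)
  then obtain d1 d2 where d: "d1 > 0" "\<And>y. dist x y < d1 \<Longrightarrow> dist (p x) (p y) < \<eta>"
      "d2 > 0" "\<And>y. dist x y < d2 \<Longrightarrow> dist (q x) (q y) < \<eta>"
    using \<eta> unfolding continuous_at_eps_delta by (metis dist_commute)
  obtain e where e: "e > 0" "ball x e \<subseteq> W" using W by (meson open_contains_ball)
  define t where "t = min e (min d1 d2) / 2 / (norm u + norm v + 1)"
  have t0: "t > 0" using e d by (simp add: t_def add_nonneg_pos)
  have "norm u + norm v + 1 \<noteq> 0" by (smt (verit) norm_ge_zero)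
  then have "t * (norm u + norm v + 1) = min e (min d1 d2) / 2"
    unfolding t_def by (rule nonzero_eq_divide_eq[THEN iffD1, OF _ refl])
  then have tt: "t * (norm u + norm v) + t = min e (min d1 d2) / 2"
    by (simp add: distrib_left)
  have m: "min e (min d1 d2) > 0" using e d by simp
  have 1: "t * norm u + t * norm v < e" "t * norm v + t * norm u < e"
    using tt t0 m unfolding distrib_left by linarith+
  note fb = Cinf_on_subset[OF f e(2)]
  obtain z where z: "dist x z < t * (norm u + norm v) + t"
    "f (x + t *\<^sub>R u + t *\<^sub>R v) - f (x + t *\<^sub>R u) - f (x + t *\<^sub>R v) + f x = t * t * p z"
    using parallelogram_mvt[OF fb t0 1(1)] unfolding p_def by blast
  obtain z' where z': "dist x z' < t * (norm v + norm u) + t"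
    "f (x + t *\<^sub>R v + t *\<^sub>R u) - f (x + t *\<^sub>R v) - f (x + t *\<^sub>R u) + f x = t * t * q z'"
    using parallelogram_mvt[OF fb t0 1(2)] unfolding q_def by blast
  have "t * t * p z = t * t * q z'" using z(2) z'(2) by (simp add: algebra_simps)
  then have pq: "p z = q z'" using t0 by simp
  have "dist x z < d1" "dist x z' < d2" using z(1) z'(1) tt m unfolding add.commute[of "norm v"] by linarith+
  then have "dist (p x) (p z) < \<eta>" "dist (q x) (q z') < \<eta>" using d by auto
  then show False unfolding \<eta>_def pq dist_real_def abs_real_def by (auto split: if_splits)
qed

lemma second_derivative_symmetric:
  fixes f :: "'a::euclidean_space \<Rightarrow> 'b::euclidean_space"
  assumes f: "Cinf_on W f" and W: "open W" "x \<in> W"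
  shows "frechet_derivative (\<lambda>y. frechet_derivative f (at y) u) (at x) v
       = frechet_derivative (\<lambda>y. frechet_derivative f (at y) v) (at x) u"
proof (rule euclidean_eqI)
  fix i :: 'b assume "i \<in> Basis"
  have fi: "Cinf_on W (\<lambda>y. f y \<bullet> i)" by (intro Cinf_intros f W)
  have comp: "frechet_derivative (\<lambda>y. k y \<bullet> i) (at y) = (\<lambda>u. frechet_derivative k (at y) u \<bullet> i)"
    if "Cinf_on W k" "y \<in> W" for k y
    using frechet_derivative_at[OF has_derivative_inner_left[OF Cinf_on_has_derivative[OF that]]] by simp
  have dd: "frechet_derivative (\<lambda>y. frechet_derivative (\<lambda>y. f y \<bullet> i) (at y) u) (at x) v
      = frechet_derivative (\<lambda>y. frechet_derivative f (at y) u) (at x) v \<bullet> i" for u v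
  proof -
    have "((\<lambda>y. frechet_derivative f (at y) u \<bullet> i) has_derivative
        (\<lambda>v. frechet_derivative (\<lambda>y. frechet_derivative f (at y) u) (at x) v \<bullet> i)) (at x)"
      by (intro has_derivative_inner_left Cinf_on_has_derivative[OF Cinf_on_frechet[OF f] W(2)])
    then have "((\<lambda>y. frechet_derivative (\<lambda>y. f y \<bullet> i) (at y) u) has_derivative
        (\<lambda>v. frechet_derivative (\<lambda>y. frechet_derivative f (at y) u) (at x) v \<bullet> i)) (at x)"
      by (rule has_derivative_transform_within_open[OF _ W]) (simp add: comp[OF f])
    from frechet_derivative_at[OF this] show ?thesis by metis
  qed
  show "frechet_derivative (\<lambda>y. frechet_derivative f (at y) u) (at x) v \<bullet> i
       = frechet_derivative (\<lambda>y. frechet_derivative f (at y) v) (at x) u \<bullet> i"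
    using second_derivative_symmetric_real[OF fi W, of u v] unfolding dd .
qed

text \<open>The second derivatives of \<open>h\<close> enter symmetrically and cancel, so that only the curl of \<open>\<xi>\<close> is left.\<close>

lemma ext_deriv_pullback:
  fixes h :: "real^2 \<Rightarrow> real^2" and \<xi> :: "real^2 \<Rightarrow> real^2"
  assumes h: "Cinf_on W h" and W: "open W" "x \<in> W" and \<xi>: "Cinf_on UNIV \<xi>"
  defines "\<zeta> \<equiv> (\<lambda>x u. \<xi> (h x) \<bullet> frechet_derivative h (at x) u)"
  shows "(\<lambda>y. \<zeta> y u) differentiable (at x)"
    and "ext_deriv_plane \<zeta> x u v
      = curl \<xi> (h x) * (J (frechet_derivative h (at x) u) \<bullet> frechet_derivative h (at x) v)"
proof -
  let ?h' = "frechet_derivative h (at x)" and ?\<xi>' = "frechet_derivative \<xi> (at (h x))"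
  let ?h'' = "\<lambda>u v. frechet_derivative (\<lambda>y. frechet_derivative h (at y) u) (at x) v"
  have d: "((\<lambda>y. \<zeta> y u) has_derivative (\<lambda>v. \<xi> (h x) \<bullet> ?h'' u v + ?\<xi>' (?h' v) \<bullet> ?h' u)) (at x)" for u
    unfolding \<zeta>_def
    by (intro has_derivative_inner Cinf_on_has_derivative[OF Cinf_on_frechet[OF h] W(2)]
        has_derivative_compose[OF Cinf_on_has_derivative[OF h W(2)] Cinf_on_has_derivative[OF \<xi>]]) simp
  then show "(\<lambda>y. \<zeta> y u) differentiable (at x)" by (auto simp: differentiable_def)
  have e: "frechet_derivative (\<lambda>y. \<zeta> y u) (at x) = (\<lambda>v. \<xi> (h x) \<bullet> ?h'' u v + ?\<xi>' (?h' v) \<bullet> ?h' u)" for u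
    using frechet_derivative_at[OF d] by simp
  show "ext_deriv_plane \<zeta> x u v = curl \<xi> (h x) * (J (?h' u) \<bullet> ?h' v)"
    unfolding ext_deriv_plane_def e curl_identity[OF \<xi>, symmetric]
    by (simp add: second_derivative_symmetric[OF h W, of u v])
qed

text \<open>\<open>\<zeta>1\<close> and \<open>\<zeta>2\<close> form an orthonormal coframe, in which the velocity has the norm \<open>\<epsilon>\<close> and the direction angle \<open>\<theta>\<close>.
  The momentum of the curve is therefore \<open>\<epsilon> (cos \<theta> \<zeta>1 + sin \<theta> \<zeta>2) + \<alpha>\<close>, and the last hypothesis says that the
  exterior derivative of this form, with \<open>\<theta>\<close> as an additional variable, vanishes on the velocity and \<open>e\<close>. Unlike
  the Euler-Lagrange equation it does not contain second derivatives of the curve.\<close>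

lemma euler_lagrange_in_coordinates:
  fixes \<zeta>1 \<zeta>2 \<alpha> :: "real^2 \<Rightarrow> real^2 \<Rightarrow> real" and c c' :: "real \<Rightarrow> real^2"
  assumes V: "open V" and T: "open T" "t \<in> T"
    and lin: "\<And>x. x \<in> V \<Longrightarrow> linear (\<zeta>1 x)" "\<And>x. x \<in> V \<Longrightarrow> linear (\<zeta>2 x)" "\<And>x. x \<in> V \<Longrightarrow> linear (\<alpha> x)"
    and diff: "\<And>u. (\<lambda>x. \<zeta>1 x u) differentiable (at (c t))" "\<And>u. (\<lambda>x. \<zeta>2 x u) differentiable (at (c t))"
      "\<And>u. (\<lambda>x. \<alpha> x u) differentiable (at (c t))"
    and l: "\<And>x w. x \<in> V \<Longrightarrow> l x w = ((\<zeta>1 x w)\<^sup>2 + (\<zeta>2 x w)\<^sup>2) / 2 + \<alpha> x w"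
    and c: "\<And>s. s \<in> T \<Longrightarrow> c s \<in> V" "(c has_vector_derivative c' t) (at t)"
    and speed: "\<And>s. s \<in> T \<Longrightarrow> \<zeta>1 (c s) (c' s) = \<epsilon> * cos (\<theta> s)" "\<And>s. s \<in> T \<Longrightarrow> \<zeta>2 (c s) (c' s) = \<epsilon> * sin (\<theta> s)"
    and \<theta>: "(\<theta> has_real_derivative \<theta>') (at t)"
    and key: "\<epsilon> * (cos (\<theta> t) * ext_deriv_plane \<zeta>1 (c t) (c' t) e + sin (\<theta> t) * ext_deriv_plane \<zeta>2 (c t) (c' t) e)
       + ext_deriv_plane \<alpha> (c t) (c' t) e
       + \<epsilon> * \<theta>' * (- sin (\<theta> t) * \<zeta>1 (c t) e + cos (\<theta> t) * \<zeta>2 (c t) e) = 0"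
  shows "((\<lambda>s. frechet_derivative (\<lambda>w. l (c s) w) (at (c' s)) e) has_real_derivative
           frechet_derivative (\<lambda>x. l x (c' t)) (at (c t)) e) (at t)"
proof -
  have bl: "(f has_derivative f) (at w)" if "linear f" for f :: "real^2 \<Rightarrow> real" and w
    using that by (simp add: linear_conv_bounded_linear bounded_linear_imp_has_derivative)
  have momentum: "frechet_derivative (\<lambda>w. l (c s) w) (at (c' s)) e
      = \<epsilon> * cos (\<theta> s) * \<zeta>1 (c s) e + \<epsilon> * sin (\<theta> s) * \<zeta>2 (c s) e + \<alpha> (c s) e" if s: "s \<in> T" for s
  proof -
    have "((\<lambda>w. ((\<zeta>1 (c s) w)\<^sup>2 + (\<zeta>2 (c s) w)\<^sup>2) / 2 + \<alpha> (c s) w) has_derivative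
       (\<lambda>e. \<zeta>1 (c s) (c' s) * \<zeta>1 (c s) e + \<zeta>2 (c s) (c' s) * \<zeta>2 (c s) e + \<alpha> (c s) e)) (at (c' s))"
      by (auto intro!: derivative_eq_intros bl[OF lin(1)[OF c(1)[OF s]]] bl[OF lin(2)[OF c(1)[OF s]]]
          bl[OF lin(3)[OF c(1)[OF s]]] simp: algebra_simps)
    then have "((\<lambda>w. l (c s) w) has_derivative
       (\<lambda>e. \<zeta>1 (c s) (c' s) * \<zeta>1 (c s) e + \<zeta>2 (c s) (c' s) * \<zeta>2 (c s) e + \<alpha> (c s) e)) (at (c' s))"
      using l[OF c(1)[OF s]] by simp
    from frechet_derivative_at[OF this, symmetric] show ?thesis by (simp add: speed[OF s])
  qed
  have fr: "((\<lambda>x. f x) has_derivative frechet_derivative f (at x)) (at x)" if "f differentiable (at x)" for f :: "real^2 \<Rightarrow> real" and x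
    using that frechet_derivative_works by blast
  have along: "((\<lambda>s. f (c s)) has_real_derivative frechet_derivative f (at (c t)) (c' t)) (at t)"
    if "f differentiable (at (c t))" for f :: "real^2 \<Rightarrow> real"
  proof -
    from has_derivative_compose[OF c(2)[unfolded has_vector_derivative_def] fr[OF that]]
    show ?thesis unfolding has_field_derivative_def
      by (rule has_derivative_eq_rhs) (auto simp: linear_scale[OF has_derivative_linear[OF fr[OF that]]])
  qed
  let ?D = "\<lambda>\<zeta> u v. frechet_derivative (\<lambda>x. \<zeta> x v) (at (c t)) u"
  have "((\<lambda>s. \<epsilon> * cos (\<theta> s) * \<zeta>1 (c s) e + \<epsilon> * sin (\<theta> s) * \<zeta>2 (c s) e + \<alpha> (c s) e) has_real_derivative
      \<epsilon> * (- sin (\<theta> t) * \<theta>') * \<zeta>1 (c t) e + \<epsilon> * cos (\<theta> t) * ?D \<zeta>1 (c' t) e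
      + (\<epsilon> * (cos (\<theta> t) * \<theta>') * \<zeta>2 (c t) e + \<epsilon> * sin (\<theta> t) * ?D \<zeta>2 (c' t) e) + ?D \<alpha> (c' t) e) (at t)"
    by (auto intro!: derivative_eq_intros \<theta> along diff)
  then have lhs: "((\<lambda>s. frechet_derivative (\<lambda>w. l (c s) w) (at (c' s)) e) has_real_derivative
      \<epsilon> * (- sin (\<theta> t) * \<theta>') * \<zeta>1 (c t) e + \<epsilon> * cos (\<theta> t) * ?D \<zeta>1 (c' t) e
      + (\<epsilon> * (cos (\<theta> t) * \<theta>') * \<zeta>2 (c t) e + \<epsilon> * sin (\<theta> t) * ?D \<zeta>2 (c' t) e) + ?D \<alpha> (c' t) e) (at t)"
    by (rule has_field_derivative_transform_within_open[OF _ T]) (simp add: momentum)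
  have "((\<lambda>x. ((\<zeta>1 x (c' t))\<^sup>2 + (\<zeta>2 x (c' t))\<^sup>2) / 2 + \<alpha> x (c' t)) has_derivative
      (\<lambda>e. \<zeta>1 (c t) (c' t) * ?D \<zeta>1 e (c' t) + \<zeta>2 (c t) (c' t) * ?D \<zeta>2 e (c' t) + ?D \<alpha> e (c' t))) (at (c t))"
    by (auto intro!: derivative_eq_intros fr diff simp: algebra_simps)
  then have "((\<lambda>x. l x (c' t)) has_derivative
      (\<lambda>e. \<zeta>1 (c t) (c' t) * ?D \<zeta>1 e (c' t) + \<zeta>2 (c t) (c' t) * ?D \<zeta>2 e (c' t) + ?D \<alpha> e (c' t))) (at (c t))"
    by (rule has_derivative_transform_within_open[OF _ V c(1)[OF T(2)]]) (simp add: l)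
  from frechet_derivative_at[OF this, symmetric]
  have rhs: "frechet_derivative (\<lambda>x. l x (c' t)) (at (c t)) e
      = \<epsilon> * cos (\<theta> t) * ?D \<zeta>1 e (c' t) + \<epsilon> * sin (\<theta> t) * ?D \<zeta>2 e (c' t) + ?D \<alpha> e (c' t)"
    by (simp add: speed[OF T(2)])
  show ?thesis
    by (rule DERIV_cong[OF lhs]) (use key in \<open>simp add: rhs ext_deriv_plane_def algebra_simps\<close>)
qed

section \<open>Tensor fields on the sphere\<close>

lemma S2_iff: "q \<in> S2 \<longleftrightarrow> q \<bullet> q = 1"
  by (simp add: S2_def norm_eq_sqrt_inner)

abbreviation rot :: "3 \<Rightarrow> real^3 \<Rightarrow> real^3" where
  "rot i q \<equiv> cross3 (axis i 1) q"

lemma rot_tangent: "rot i q \<in> tangent_space q"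
  by (simp add: tangent_space_def dot_cross_self)

lemma bounded_bilinear_cross3: "bounded_bilinear cross3"
  using bilinear_cross bilinear_conv_bounded_bilinear by blast

lemmas Cinf_on_cross3 = Cinf_on_bilinear[OF _ bounded_bilinear_cross3]

lemma vector_field_rot: "vector_field_on U (rot i)"
  unfolding vector_field_on_def
  by (intro conjI Cinf_on_imp_smooth_on[OF open_UNIV] Cinf_on_cross3 Cinf_intros ballI rot_tangent) auto

text \<open>The rotation fields span the tangent planes, so that a tensor field is determined by its values
  on them.\<close>

lemma tangent_expand:
  assumes "q \<in> S2" "v \<in> tangent_space q"
  shows "v = (cross3 q v $ 1) *\<^sub>R rot 1 q + (cross3 q v $ 2) *\<^sub>R rot 2 q + (cross3 q v $ 3) *\<^sub>R rot 3 q"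
proof -
  have "v = cross3 (cross3 q v) q"
    using assms by (simp add: cross_skew[of "cross3 q v"] Lagrange S2_iff tangent_space_def inner_commute)
  also have "cross3 q v = (cross3 q v $ 1) *\<^sub>R axis 1 1 + (cross3 q v $ 2) *\<^sub>R axis 2 1 + (cross3 q v $ 3) *\<^sub>R axis 3 1"
    by (simp add: vec_eq_iff forall_3 axis_def)
  finally show ?thesis by (simp only: cross_add_left cross_mult_left)
qed

lemma tangent_combination:
  "u \<in> tangent_space q \<Longrightarrow> v \<in> tangent_space q \<Longrightarrow> a *\<^sub>R u + b *\<^sub>R v \<in> tangent_space q"
  by (simp add: tangent_space_def inner_add_left)

lemma tangent_functional_expand:
  assumes lin: "\<And>u v a b. u \<in> tangent_space q \<Longrightarrow> v \<in> tangent_space q \<Longrightarrow> \<theta> (a *\<^sub>R u + b *\<^sub>R v) = a * \<theta> u + b * (\<theta> v :: real)"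
    and "q \<in> S2" "v \<in> tangent_space q"
  shows "\<theta> v = (\<Sum>i\<in>UNIV. cross3 q v $ i * \<theta> (rot i q))"
proof -
  let ?n = "cross3 q v"
  have "\<theta> v = \<theta> (1 *\<^sub>R ((?n $ 1) *\<^sub>R rot 1 q + (?n $ 2) *\<^sub>R rot 2 q) + (?n $ 3) *\<^sub>R rot 3 q)"
    using arg_cong[OF tangent_expand[OF assms(2,3)], of \<theta>] by simp
  also have "\<dots> = \<theta> ((?n $ 1) *\<^sub>R rot 1 q + (?n $ 2) *\<^sub>R rot 2 q) + ?n $ 3 * \<theta> (rot 3 q)"
    by (subst lin[OF tangent_combination[OF rot_tangent rot_tangent] rot_tangent]) simp
  also have "\<theta> ((?n $ 1) *\<^sub>R rot 1 q + (?n $ 2) *\<^sub>R rot 2 q) = ?n $ 1 * \<theta> (rot 1 q) + ?n $ 2 * \<theta> (rot 2 q)"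
    by (rule lin[OF rot_tangent rot_tangent])
  finally show ?thesis by (simp add: sum_3)
qed

lemma frechet_tangent:
  fixes \<psi> :: "real^2 \<Rightarrow> real^3"
  assumes "Cinf_on V \<psi>" "open V" "\<psi> ` V \<subseteq> S2" "x \<in> V"
  shows "tangent_map \<psi> x u \<in> tangent_space (\<psi> x)"
proof -
  note d = Cinf_on_has_derivative[OF assms(1,4)]
  have "((\<lambda>x. \<psi> x \<bullet> \<psi> x) has_derivative (\<lambda>u. \<psi> x \<bullet> tangent_map \<psi> x u + tangent_map \<psi> x u \<bullet> \<psi> x)) (at x)"
    unfolding tangent_map_def by (rule has_derivative_inner[OF d d])
  moreover have "((\<lambda>x. \<psi> x \<bullet> \<psi> x) has_derivative (\<lambda>u. 0)) (at x)"
    by (rule has_derivative_transform_within_open[OF has_derivative_const[of 1] assms(2,4)])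
       (use assms(3) in \<open>auto simp: S2_iff\<close>)
  ultimately have "(\<lambda>u. \<psi> x \<bullet> tangent_map \<psi> x u + tangent_map \<psi> x u \<bullet> \<psi> x) = (\<lambda>u. 0)"
    by (rule has_derivative_unique)
  then show ?thesis by (auto simp: tangent_space_def inner_commute dest: fun_cong[of _ _ u])
qed

lemma linear_tangent_map:
  assumes "Cinf_on V \<psi>" "x \<in> V" shows "linear (tangent_map \<psi> x)"
  using Cinf_on_has_derivative[OF assms] has_derivative_linear
  unfolding tangent_map_def[abs_def] by blast

lemma
  assumes \<theta>: "one_form_on U \<theta>" and \<psi>: "Cinf_on V \<psi>" "open V" "\<psi> ` V \<subseteq> U" and U: "U \<subseteq> S2"
  shows linear_pullback1: "x \<in> V \<Longrightarrow> linear (pullback1 \<psi> \<theta> x)"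
    and Cinf_on_pullback1: "Cinf_on V (\<lambda>x. pullback1 \<psi> \<theta> x u)"
proof -
  have t: "tangent_map \<psi> x u \<in> tangent_space (\<psi> x)" if "x \<in> V" for x u
    using frechet_tangent[OF \<psi>(1,2) _ that] \<psi>(3) U by blast
  have lin: "\<theta> q (a *\<^sub>R u + b *\<^sub>R v) = a * \<theta> q u + b * \<theta> q v"
    if "q \<in> U" "u \<in> tangent_space q" "v \<in> tangent_space q" for q u v a b
    using \<theta> that unfolding one_form_on_def by blast
  show "linear (pullback1 \<psi> \<theta> x)" if x: "x \<in> V"
  proof -
    note l = linear_tangent_map[OF \<psi>(1) x]
    have 2: "\<psi> x \<in> U" using \<psi>(3) x by blast
    show ?thesis
    proof (rule linearI)
      show "pullback1 \<psi> \<theta> x (u + v) = pullback1 \<psi> \<theta> x u + pullback1 \<psi> \<theta> x v" for u v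
        using lin[OF 2 t[OF x, of u] t[OF x, of v], of 1 1] by (simp add: pullback1_def linear_add[OF l])
      show "pullback1 \<psi> \<theta> x (r *\<^sub>R u) = r *\<^sub>R pullback1 \<psi> \<theta> x u" for r u
        using lin[OF 2 t[OF x, of u] t[OF x, of u], of r 0] by (simp add: pullback1_def linear_scale[OF l])
    qed
  qed
  have "smooth_on U (\<lambda>q. \<theta> q (rot i q))" for i
    using \<theta> vector_field_rot unfolding one_form_on_def by blast
  then have c: "Cinf_on V (\<lambda>x. \<theta> (\<psi> x) (rot i (\<psi> x)))" for i
    by (rule smooth_on_compose[OF _ \<psi>(2,1,3)])
  have "Cinf_on V (\<lambda>x. \<Sum>i\<in>UNIV. cross3 (\<psi> x) (tangent_map \<psi> x u) $ i * \<theta> (\<psi> x) (rot i (\<psi> x)))"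
    unfolding tangent_map_def by (intro Cinf_intros Cinf_on_cross3 c \<psi> Cinf_on_frechet)
  then show "Cinf_on V (\<lambda>x. pullback1 \<psi> \<theta> x u)"
  proof (rule Cinf_on_cong[OF \<psi>(2)])
    fix x assume x: "x \<in> V"
    then have 2: "\<psi> x \<in> U" using \<psi>(3) by blast
    show "(\<Sum>i\<in>UNIV. cross3 (\<psi> x) (tangent_map \<psi> x u) $ i * \<theta> (\<psi> x) (rot i (\<psi> x))) = pullback1 \<psi> \<theta> x u"
      unfolding pullback1_def
      by (rule tangent_functional_expand[symmetric, OF lin[OF 2] _ t[OF x]]) (use 2 U in auto)
  qed
qed

lemma bilinear_fieldD:
  assumes "bilinear_field_on S2 B" "q \<in> S2" "u \<in> tangent_space q" "v \<in> tangent_space q" "w \<in> tangent_space q"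
  shows "B q (a *\<^sub>R u + b *\<^sub>R v) w = a * B q u w + b * B q v w"
    "B q w (a *\<^sub>R u + b *\<^sub>R v) = a * B q w u + b * B q w v"
  using assms unfolding bilinear_field_on_def by blast+

lemma bilinear_rot_smooth:
  "bilinear_field_on S2 B \<Longrightarrow> smooth_on S2 (\<lambda>q. B q (rot i q) (rot j q))"
  unfolding bilinear_field_on_def using vector_field_rot by blast

lemma
  assumes B: "bilinear_field_on S2 B" and \<psi>: "Cinf_on V \<psi>" "open V" "\<psi> ` V \<subseteq> S2"
  shows linear_pullback2_left: "x \<in> V \<Longrightarrow> linear (\<lambda>u. pullback2 \<psi> B x u v)"
    and linear_pullback2_right: "x \<in> V \<Longrightarrow> linear (\<lambda>v. pullback2 \<psi> B x u v)"
    and Cinf_on_pullback2: "Cinf_on V (\<lambda>x. pullback2 \<psi> B x u v)"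
proof -
  have t: "tangent_map \<psi> x u \<in> tangent_space (\<psi> x)" if "x \<in> V" for x u
    by (rule frechet_tangent[OF \<psi> that])
  have S: "\<psi> x \<in> S2" if "x \<in> V" for x using \<psi>(3) that by blast
  show "linear (\<lambda>u. pullback2 \<psi> B x u v)" if x: "x \<in> V"
  proof -
    note l = linear_tangent_map[OF \<psi>(1) x]
    show ?thesis
    proof (rule linearI)
      show "pullback2 \<psi> B x (u + u') v = pullback2 \<psi> B x u v + pullback2 \<psi> B x u' v" for u u'
        using bilinear_fieldD(1)[OF B S[OF x] t[OF x, of u] t[OF x, of u'] t[OF x, of v], of 1 1]
        by (simp add: pullback2_def linear_add[OF l])
      show "pullback2 \<psi> B x (r *\<^sub>R u) v = r *\<^sub>R pullback2 \<psi> B x u v" for r u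
        using bilinear_fieldD(1)[OF B S[OF x] t[OF x, of u] t[OF x, of u] t[OF x, of v], of r 0]
        by (simp add: pullback2_def linear_scale[OF l])
    qed
  qed
  show "linear (\<lambda>v. pullback2 \<psi> B x u v)" if x: "x \<in> V"
  proof -
    note l = linear_tangent_map[OF \<psi>(1) x]
    show ?thesis
    proof (rule linearI)
      show "pullback2 \<psi> B x u (v + v') = pullback2 \<psi> B x u v + pullback2 \<psi> B x u v'" for v v'
        using bilinear_fieldD(2)[OF B S[OF x] t[OF x, of v] t[OF x, of v'] t[OF x, of u], of 1 1]
        by (simp add: pullback2_def linear_add[OF l])
      show "pullback2 \<psi> B x u (r *\<^sub>R v) = r *\<^sub>R pullback2 \<psi> B x u v" for r v
        using bilinear_fieldD(2)[OF B S[OF x] t[OF x, of v] t[OF x, of v] t[OF x, of u], of r 0]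
        by (simp add: pullback2_def linear_scale[OF l])
    qed
  qed
  let ?n = "\<lambda>x u i. cross3 (\<psi> x) (tangent_map \<psi> x u) $ i"
  have c: "Cinf_on V (\<lambda>x. B (\<psi> x) (rot i (\<psi> x)) (rot j (\<psi> x)))" for i j
    by (rule smooth_on_compose[OF bilinear_rot_smooth[OF B] \<psi>(2,1,3)])
  have "Cinf_on V (\<lambda>x. \<Sum>i\<in>UNIV. ?n x u i * (\<Sum>j\<in>UNIV. ?n x v j * B (\<psi> x) (rot i (\<psi> x)) (rot j (\<psi> x))))"
    unfolding tangent_map_def by (intro Cinf_intros Cinf_on_cross3 c \<psi> Cinf_on_frechet)
  then show "Cinf_on V (\<lambda>x. pullback2 \<psi> B x u v)"
  proof (rule Cinf_on_cong[OF \<psi>(2)])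
    fix x assume x: "x \<in> V"
    have "B (\<psi> x) (tangent_map \<psi> x u) (tangent_map \<psi> x v)
      = (\<Sum>i\<in>UNIV. ?n x u i * B (\<psi> x) (rot i (\<psi> x)) (tangent_map \<psi> x v))"
      by (rule tangent_functional_expand[OF bilinear_fieldD(1)[OF B S[OF x] _ _ t[OF x]] S[OF x] t[OF x]])
    also have "\<dots> = (\<Sum>i\<in>UNIV. ?n x u i * (\<Sum>j\<in>UNIV. ?n x v j * B (\<psi> x) (rot i (\<psi> x)) (rot j (\<psi> x))))"
      by (intro sum.cong refl arg_cong2[where f = "(*)"]
          tangent_functional_expand[OF bilinear_fieldD(2)[OF B S[OF x] _ _ rot_tangent] S[OF x] t[OF x]])
    finally show "(\<Sum>i\<in>UNIV. ?n x u i * (\<Sum>j\<in>UNIV. ?n x v j * B (\<psi> x) (rot i (\<psi> x)) (rot j (\<psi> x))))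
        = pullback2 \<psi> B x u v"
      by (simp add: pullback2_def)
  qed
qed

lemma gram_pos:
  assumes g: "riemannian_metric g" and q: "q \<in> S2" and uv: "u \<in> tangent_space q" "v \<in> tangent_space q"
    and ind: "cross3 u v \<noteq> 0"
  shows "g q u u > 0" "g q u u * g q v v - (g q u v)\<^sup>2 > 0"
proof -
  have B: "bilinear_field_on S2 g" using g by (simp add: riemannian_metric_def)
  have sym: "g q v u = g q u v" using g q uv unfolding riemannian_metric_def by blast
  have pos: "g q z z > 0" if "z \<in> tangent_space q" "z \<noteq> 0" for z
    using g q that unfolding riemannian_metric_def by blast
  have "u \<noteq> 0" using ind by auto
  then show E: "g q u u > 0" using pos uv by blast
  \<comment> \<open>a multiple of the component of \<open>v\<close> orthogonal to \<open>u\<close>\<close>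
  define z where "z = (- g q u v) *\<^sub>R u + g q u u *\<^sub>R v"
  have zt: "z \<in> tangent_space q" unfolding z_def by (rule tangent_combination[OF uv])
  have "cross3 u z = g q u u *\<^sub>R cross3 u v"
    unfolding z_def cross_add_right cross_mult_right by simp
  then have "z \<noteq> 0" using ind E by auto
  then have "g q z z > 0" using pos zt by blast
  also have "g q z z = g q u u * (g q u u * g q v v - (g q u v)\<^sup>2)"
  proof -
    have "g q z z = - g q u v * g q u z + g q u u * g q v z"
      using bilinear_fieldD(1)[OF B q uv zt, of "- g q u v" "g q u u"] unfolding z_def[symmetric] .
    moreover have "g q u z = - g q u v * g q u u + g q u u * g q u v"
      using bilinear_fieldD(2)[OF B q uv uv(1), of "- g q u v" "g q u u"] unfolding z_def[symmetric] .
    moreover have "g q v z = - g q u v * g q u v + g q u u * g q v v"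
      using bilinear_fieldD(2)[OF B q uv uv(2), of "- g q u v" "g q u u"] unfolding z_def[symmetric] sym .
    ultimately show ?thesis by (simp add: algebra_simps power2_eq_square)
  qed
  finally show "g q u u * g q v v - (g q u v)\<^sup>2 > 0" using E by (simp add: zero_less_mult_iff)
qed

lemma triple_rot:
  assumes "q \<in> S2"
  shows "q \<bullet> cross3 (rot 1 q) (rot 2 q) = q $ 3" "q \<bullet> cross3 (rot 2 q) (rot 3 q) = q $ 1"
    "q \<bullet> cross3 (rot 3 q) (rot 1 q) = q $ 2"
proof -
  have "q \<bullet> q = 1" using assms by (simp add: S2_iff)
  then have "q $ i * (q \<bullet> q) = q $ i" for i by simp
  note * = this[unfolded inner_vec_def sum_3 inner_real_def]
  show "q \<bullet> cross3 (rot 1 q) (rot 2 q) = q $ 3" "q \<bullet> cross3 (rot 2 q) (rot 3 q) = q $ 1"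
    "q \<bullet> cross3 (rot 3 q) (rot 1 q) = q $ 2"
    using *[of 1] *[of 2] *[of 3]
    by (simp_all add: inner_vec_def sum_3 cross_components axis_def algebra_simps)
qed

text \<open>Two rotation fields span the tangent plane where the remaining coordinate of \<open>q\<close> is not zero, and there \<open>f\<close> is
  the quotient of \<open>\<sigma>\<close> and the area form on them. Numerators and denominators of the three quotients are added
  with the coordinates as weights, which gives a formula on the whole sphere.\<close>

lemma density_continuous:
  assumes g: "riemannian_metric g" and \<sigma>: "two_form \<sigma>" and f: "density_of g \<sigma> f"
  shows "continuous_on S2 f"
proof -
  define G where "G i j q = g q (rot i q) (rot i q) * g q (rot j q) (rot j q) - (g q (rot i q) (rot j q))\<^sup>2" for i j :: 3 and q
  define S where "S i j q = \<sigma> q (rot i q) (rot j q)" for i j :: 3 and q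
  define d where "d q = \<bar>q $ 3\<bar> * sqrt (G 1 2 q) + \<bar>q $ 1\<bar> * sqrt (G 2 3 q) + \<bar>q $ 2\<bar> * sqrt (G 3 1 q)" for q
  define n where "n q = q $ 3 * S 1 2 q + q $ 1 * S 2 3 q + q $ 2 * S 3 1 q" for q
  have Bg: "bilinear_field_on S2 g" using g by (simp add: riemannian_metric_def)
  have Bs: "bilinear_field_on S2 \<sigma>" using \<sigma> by (simp add: two_form_def)
  note [continuous_intros] = smooth_on_imp_continuous_on[OF bilinear_rot_smooth[OF Bg]]
    smooth_on_imp_continuous_on[OF bilinear_rot_smooth[OF Bs]]
  have cd: "continuous_on S2 d" "continuous_on S2 n"
    unfolding d_def n_def G_def S_def by (intro continuous_intros)+
  have tm: "q $ k * S i j q = f q * (\<bar>q $ k\<bar> * sqrt (G i j q))" "q $ k \<noteq> 0 \<Longrightarrow> G i j q > 0"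
    if q: "q \<in> S2" and tr: "q \<bullet> cross3 (rot i q) (rot j q) = q $ k" for q i j k
  proof -
    have "S i j q = f q * (sgn (q $ k) * sqrt (G i j q))"
      using f[unfolded density_of_def, rule_format, OF q rot_tangent rot_tangent, of i j] tr
      by (simp add: S_def area_form_def G_def)
    then show "q $ k * S i j q = f q * (\<bar>q $ k\<bar> * sqrt (G i j q))"
      by (simp add: abs_sgn[of "q $ k"])
    assume "q $ k \<noteq> 0"
    then have "cross3 (rot i q) (rot j q) \<noteq> 0" using tr by auto
    then show "G i j q > 0" unfolding G_def by (rule gram_pos(2)[OF g q rot_tangent rot_tangent])
  qed
  have fd: "n q = f q * d q" and d0: "d q > 0" if q: "q \<in> S2" for q
  proof -
    note t = tm[OF q triple_rot(1)[OF q]] tm[OF q triple_rot(2)[OF q]] tm[OF q triple_rot(3)[OF q]]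
    show "n q = f q * d q" unfolding n_def d_def t(1) t(3) t(5) by (simp add: algebra_simps)
    have nn: "\<bar>q $ 3\<bar> * sqrt (G 1 2 q) \<ge> 0" "\<bar>q $ 1\<bar> * sqrt (G 2 3 q) \<ge> 0" "\<bar>q $ 2\<bar> * sqrt (G 3 1 q) \<ge> 0"
      using t(2,4,6) by (auto simp: zero_le_mult_iff intro: less_imp_le)
    have "q \<noteq> 0" using q by (auto simp: S2_iff)
    then have "q $ 1 \<noteq> 0 \<or> q $ 2 \<noteq> 0 \<or> q $ 3 \<noteq> 0" by (auto simp: vec_eq_iff forall_3)
    then have "\<bar>q $ 3\<bar> * sqrt (G 1 2 q) > 0 \<or> \<bar>q $ 1\<bar> * sqrt (G 2 3 q) > 0 \<or> \<bar>q $ 2\<bar> * sqrt (G 3 1 q) > 0"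
      using t(2,4,6) by auto
    then show "d q > 0" unfolding d_def using nn by linarith
  qed
  have "continuous_on S2 (\<lambda>q. n q / d q)"
    by (intro continuous_intros cd) (use d0 in force)
  then show ?thesis
    by (rule continuous_on_eq) (use fd d0 in \<open>force simp: field_simps\<close>)
qed

section \<open>Stereographic charts\<close>

text \<open>The inverse \<open>\<pi>\<close> is smooth on an open set \<open>W\<close> of the ambient space, so that it can be differentiated
  without reference to the sphere.\<close>

definition sphere_chart :: "real^3 \<Rightarrow> (real^2 \<Rightarrow> real^3) \<Rightarrow> (real^3 \<Rightarrow> real^2) \<Rightarrow> (real^3) set \<Rightarrow> bool" where
  "sphere_chart p \<phi> \<pi> W \<longleftrightarrow>
     Cinf_on UNIV \<phi> \<and> open W \<and> Cinf_on W \<pi> \<and>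
     (\<forall>x. \<phi> x \<in> S2 \<and> \<phi> x \<in> W \<and> \<phi> x \<noteq> p \<and> \<pi> (\<phi> x) = x) \<and>
     (\<forall>q\<in>S2. q \<noteq> p \<longrightarrow> q \<in> W \<and> \<phi> (\<pi> q) = q)"

lemma sphere_chartD:
  assumes "sphere_chart p \<phi> \<pi> W"
  shows "Cinf_on UNIV \<phi>" "open W" "Cinf_on W \<pi>" "\<phi> x \<in> S2" "\<phi> x \<in> W" "\<phi> x \<noteq> p" "\<pi> (\<phi> x) = x"
    "q \<in> S2 \<Longrightarrow> q \<noteq> p \<Longrightarrow> q \<in> W" "q \<in> S2 \<Longrightarrow> q \<noteq> p \<Longrightarrow> \<phi> (\<pi> q) = q"
  using assms unfolding sphere_chart_def by blast+

lemma north_chart: "\<exists>\<phi> \<pi> W. sphere_chart (axis 3 1) \<phi> \<pi> W"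
proof -
  define k :: "real^2 \<Rightarrow> real" where "k x = inverse (1 + x \<bullet> x)" for x
  define \<phi> :: "real^2 \<Rightarrow> real^3" where
    "\<phi> x = (2 * x $ 1 * k x) *\<^sub>R axis 1 1 + (2 * x $ 2 * k x) *\<^sub>R axis 2 1 + ((x \<bullet> x - 1) * k x) *\<^sub>R axis 3 1" for x
  define \<pi> :: "real^3 \<Rightarrow> real^2" where
    "\<pi> q = (q $ 1 / (1 - q $ 3)) *\<^sub>R e1 + (q $ 2 / (1 - q $ 3)) *\<^sub>R e2" for q
  define W :: "(real^3) set" where "W = {q. q $ 3 \<noteq> 1}"
  have pos: "1 + x \<bullet> x > 0" for x :: "real^2" by (simp add: add_pos_nonneg)
  have xx: "x \<bullet> x = (x $ 1)\<^sup>2 + (x $ 2)\<^sup>2" for x :: "real^2" by (simp add: inner_vec_def sum_2 power2_eq_square)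
  have \<phi>n: "\<phi> x $ 1 = 2 * x $ 1 * k x" "\<phi> x $ 2 = 2 * x $ 2 * k x" "\<phi> x $ 3 = (x \<bullet> x - 1) * k x" for x
    by (simp_all add: \<phi>_def axis_def)
  have \<pi>n: "\<pi> q $ 1 = q $ 1 / (1 - q $ 3)" "\<pi> q $ 2 = q $ 2 / (1 - q $ 3)" for q
    by (simp_all add: \<pi>_def axis_def)
  have k: "k x * (1 + x \<bullet> x) = 1" "k x > 0" for x using pos[of x] by (auto simp: k_def)
  have \<phi>3: "1 - \<phi> x $ 3 = 2 * k x" for x
    using k(1)[of x] by (simp add: \<phi>n algebra_simps)
  have smooth: "Cinf_on UNIV \<phi>"
    unfolding \<phi>_def k_def by (intro Cinf_intros open_UNIV; rule less_imp_neq[OF pos, symmetric])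
  have "W = (\<lambda>q. q $ 3) -` (- {1})" by (auto simp: W_def)
  then have "open W" by (simp add: continuous_open_vimage open_Compl continuous_intros)
  then have "Cinf_on W \<pi>"
    unfolding \<pi>_def by (intro Cinf_intros) (auto simp: W_def)
  moreover have "\<phi> x \<in> S2 \<and> \<phi> x \<in> W \<and> \<phi> x \<noteq> axis 3 1 \<and> \<pi> (\<phi> x) = x" for x
  proof (intro conjI)
    have "\<phi> x \<bullet> \<phi> x = (k x * (1 + x \<bullet> x))\<^sup>2"
      unfolding inner_vec_def[of "\<phi> x"] sum_3 \<phi>n xx by (simp add: algebra_simps power2_eq_square)
    then show "\<phi> x \<in> S2" using k by (simp add: S2_iff)
    have "\<phi> x $ 3 \<noteq> 1" using \<phi>3[of x] k(2)[of x] by auto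
    then show "\<phi> x \<in> W" "\<phi> x \<noteq> axis 3 1" by (auto simp: W_def axis_def)
    show "\<pi> (\<phi> x) = x" using k(2)[of x] by (simp add: vec_eq_iff forall_2 \<pi>n \<phi>3) (simp add: \<phi>n)
  qed
  moreover have "q \<in> W \<and> \<phi> (\<pi> q) = q" if q: "q \<in> S2" "q \<noteq> axis 3 1" for q
  proof -
    have n: "(q $ 1)\<^sup>2 + (q $ 2)\<^sup>2 + (q $ 3)\<^sup>2 = 1"
      using q(1) by (simp add: S2_iff inner_vec_def sum_3 power2_eq_square)
    have "q $ 3 \<noteq> 1"
    proof
      assume 1: "q $ 3 = 1"
      then have "(q $ 1)\<^sup>2 + (q $ 2)\<^sup>2 = 0" using n by simp
      then have "q $ 1 = 0" "q $ 2 = 0" by (simp_all add: sum_power2_eq_zero_iff)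
      then show False using q(2) 1 by (simp add: vec_eq_iff forall_3 axis_def)
    qed
    then have W: "q \<in> W" by (simp add: W_def)
    define m where "m = 1 - q $ 3"
    have m: "m \<noteq> 0" using \<open>q $ 3 \<noteq> 1\<close> by (simp add: m_def)
    have q3: "q $ 3 = 1 - m" by (simp add: m_def)
    have s: "(q $ 1)\<^sup>2 + (q $ 2)\<^sup>2 = m * (2 - m)" using n unfolding q3 by (simp add: algebra_simps power2_eq_square)
    have "\<pi> q \<bullet> \<pi> q = ((q $ 1)\<^sup>2 + (q $ 2)\<^sup>2) / m\<^sup>2"
      unfolding xx \<pi>n m_def[symmetric] by (simp add: power_divide add_divide_distrib)
    then have pp: "\<pi> q \<bullet> \<pi> q = (2 - m) / m" unfolding s using m by (simp add: power2_eq_square)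
    have "1 + \<pi> q \<bullet> \<pi> q = 2 / m" unfolding pp using m by (simp add: field_simps)
    then have kk: "k (\<pi> q) = m / 2" by (simp add: k_def)
    have "\<phi> (\<pi> q) $ 1 = q $ 1" "\<phi> (\<pi> q) $ 2 = q $ 2"
      unfolding \<phi>n kk \<pi>n m_def[symmetric] using m by simp_all
    moreover have "\<phi> (\<pi> q) $ 3 = q $ 3"
      unfolding \<phi>n kk pp q3 using m by (simp add: field_simps)
    ultimately have "\<phi> (\<pi> q) = q" by (simp add: vec_eq_iff forall_3)
    then show ?thesis using W by blast
  qed
  ultimately have "sphere_chart (axis 3 1) \<phi> \<pi> W"
    unfolding sphere_chart_def using smooth \<open>open W\<close> by blast
  then show ?thesis by blast
qed

lemma chart_at:
  assumes p: "p \<in> S2"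
  shows "\<exists>\<phi> \<pi> W. sphere_chart p \<phi> \<pi> W"
proof -
  obtain \<phi> \<pi> W where c: "sphere_chart (axis 3 1) \<phi> \<pi> W" using north_chart by blast
  note c = sphere_chartD[OF c]
  have n: "norm (axis 3 1 :: real^3) = norm p" using p by (simp add: S2_def norm_axis_1)
  obtain F :: "real^3 \<Rightarrow> real^3" where F: "orthogonal_transformation F" "F (axis 3 1) = p"
    by (rule orthogonal_transformation_exists[OF n])
  define G where "G = inv F"
  have G: "orthogonal_transformation G" unfolding G_def by (rule orthogonal_transformation_inv[OF F(1)])
  have "bij F" by (rule orthogonal_transformation_bij[OF F(1)])
  then have FG: "F (G q) = q" "G (F q) = q" for q by (auto simp: G_def bij_def surj_f_inv_f)
  have bl: "bounded_linear F" "bounded_linear G"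
    using F(1) G by (simp_all add: orthogonal_transformation_linear linear_conv_bounded_linear[symmetric])
  have S: "F q \<in> S2 \<longleftrightarrow> q \<in> S2" "G q \<in> S2 \<longleftrightarrow> q \<in> S2" for q
    using F(1) G by (auto simp: S2_iff orthogonal_transformation_def)
  have oW: "open (G -` W)"
    using c(2) bl(2) by (simp add: continuous_open_vimage linear_continuous_at bounded_linear.linear)
  have "sphere_chart p (\<lambda>x. F (\<phi> x)) (\<lambda>q. \<pi> (G q)) (G -` W)"
    unfolding sphere_chart_def
  proof (intro conjI allI ballI impI)
    show "Cinf_on UNIV (\<lambda>x. F (\<phi> x))" by (rule Cinf_on_bounded_linear[OF open_UNIV bl(1) c(1)])
    show "Cinf_on (G -` W) (\<lambda>q. \<pi> (G q))"
      by (rule Cinf_on_compose[OF c(3) Cinf_on_linear[OF oW bl(2)] oW c(2)]) auto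
    show "F (\<phi> x) \<noteq> p" for x using c(6)[of x] FG F(2) by metis
    fix q assume q: "q \<in> S2" "q \<noteq> p"
    then have "G q \<in> S2" "G q \<noteq> axis 3 1" using S FG F(2) by metis+
    then show "q \<in> G -` W" "F (\<phi> (\<pi> (G q))) = q" using c(8,9) FG by auto
  qed (use S c FG oW in auto)
  then show ?thesis by blast
qed

definition orient :: "(real^2 \<Rightarrow> real^3) \<Rightarrow> real^2 \<Rightarrow> real" where
  "orient \<phi> x = \<phi> x \<bullet> cross3 (tangent_map \<phi> x e1) (tangent_map \<phi> x e2)"

lemma chart_immersion:
  assumes c: "sphere_chart p \<phi> \<pi> W" and u: "tangent_map \<phi> x u = 0"
  shows "u = 0"
proof -
  note c = sphere_chartD[OF c]
  have "((\<lambda>x. \<pi> (\<phi> x)) has_derivative (\<lambda>u. frechet_derivative \<pi> (at (\<phi> x)) (tangent_map \<phi> x u))) (at x)"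
    unfolding tangent_map_def
    by (rule has_derivative_compose[OF Cinf_on_has_derivative[OF c(1)] Cinf_on_has_derivative[OF c(3,5)]]) simp
  moreover have "((\<lambda>x. \<pi> (\<phi> x)) has_derivative (\<lambda>u. u)) (at x)" unfolding c(7) by (rule has_derivative_ident)
  ultimately have "(\<lambda>u. frechet_derivative \<pi> (at (\<phi> x)) (tangent_map \<phi> x u)) = (\<lambda>u. u)" by (rule has_derivative_unique)
  then have "u = frechet_derivative \<pi> (at (\<phi> x)) 0" using u by (metis)
  also have "\<dots> = 0"
    using has_derivative_linear[OF Cinf_on_has_derivative[OF c(3,5)]] linear_0 by blast
  finally show ?thesis .
qed

lemma chart_cross_nonzero:
  assumes c: "sphere_chart p \<phi> \<pi> W"
  shows "cross3 (tangent_map \<phi> x e1) (tangent_map \<phi> x e2) \<noteq> 0"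
proof
  note l = linear_tangent_map[OF sphere_chartD(1)[OF c] UNIV_I, of x]
  have e: "e1 \<noteq> 0" "e2 \<noteq> 0" by (auto simp: axis_eq_0_iff)
  assume "cross3 (tangent_map \<phi> x e1) (tangent_map \<phi> x e2) = 0"
  then consider "tangent_map \<phi> x e1 = 0" | "tangent_map \<phi> x e2 = 0"
    | k where "tangent_map \<phi> x e2 = k *\<^sub>R tangent_map \<phi> x e1"
    unfolding cross_eq_0 collinear_lemma by blast
  then show False
  proof cases
    case 3
    then have "tangent_map \<phi> x (e2 - k *\<^sub>R e1) = 0" by (simp add: linear_diff[OF l] linear_scale[OF l])
    then have "e2 - k *\<^sub>R e1 = 0" by (rule chart_immersion[OF c])
    then have "(e2 - k *\<^sub>R e1) $ 2 = 0" by simp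
    then show False by (simp add: axis_def)
  qed (use chart_immersion[OF c] e in blast)+
qed

lemma orient_nonzero:
  assumes c: "sphere_chart p \<phi> \<pi> W" shows "orient \<phi> x \<noteq> 0"
proof
  let ?n = "cross3 (tangent_map \<phi> x e1) (tangent_map \<phi> x e2)"
  have "\<phi> x \<in> S2" by (rule sphere_chartD(4)[OF c])
  then have nz: "\<phi> x \<noteq> 0" by (auto simp: S2_iff)
  have t: "tangent_map \<phi> x u \<bullet> \<phi> x = 0" for u
    using frechet_tangent[OF sphere_chartD(1)[OF c] open_UNIV, of x u] sphere_chartD(4)[OF c]
    by (auto simp: tangent_space_def)
  assume "orient \<phi> x = 0"
  then have "\<phi> x \<bullet> ?n = \<phi> x \<bullet> 0" by (simp add: orient_def)
  moreover have "cross3 (\<phi> x) ?n = cross3 (\<phi> x) 0"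
    by (simp add: Lagrange t inner_commute[of "\<phi> x"])
  ultimately have "?n = 0" using cross_dot_cancel nz by blast
  then show False using chart_cross_nonzero[OF c] by blast
qed

text \<open>The function \<open>orient \<phi>\<close> has no zeros and hence a constant sign on the plane, which is reversed by exchanging
  the coordinates.\<close>

lemma chart_oriented:
  assumes p: "p \<in> S2" and s: "s = 1 \<or> s = (-1 :: real)"
  shows "\<exists>\<phi> \<pi> W. sphere_chart p \<phi> \<pi> W \<and> (\<forall>x. s * orient \<phi> x > 0)"
proof -
  obtain \<phi> \<pi> W where c: "sphere_chart p \<phi> \<pi> W" using chart_at[OF p] by blast
  note cD = sphere_chartD[OF c]
  have "Cinf_on UNIV (orient \<phi>)"
    unfolding orient_def tangent_map_def by (intro Cinf_intros Cinf_on_cross3 Cinf_on_frechet cD open_UNIV)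
  then have "connected (range (orient \<phi>))"
    by (intro connected_continuous_image Cinf_on_continuous) (auto simp: connected_UNIV)
  then have iv: "is_interval (range (orient \<phi>))" by (simp add: is_interval_connected_1)
  have "(\<forall>x. orient \<phi> x > 0) \<or> (\<forall>x. orient \<phi> x < 0)"
  proof (rule ccontr)
    assume "\<not> ?thesis"
    then obtain x y where "orient \<phi> x \<le> 0" "orient \<phi> y \<ge> 0" by (meson not_le)
    then have "0 \<in> range (orient \<phi>)" using mem_is_interval_1_I[OF iv, of "orient \<phi> x" "orient \<phi> y" 0] by auto
    then show False using orient_nonzero[OF c] by (metis imageE)
  qed
  then consider "\<forall>x. s * orient \<phi> x > 0" | "\<forall>x. s * orient \<phi> x < 0" using s by auto
  then show ?thesis
  proof cases
    case 1 then show ?thesis using c by blast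
  next
    case 2
    define S :: "real^2 \<Rightarrow> real^2" where "S x = (x $ 2) *\<^sub>R e1 + (x $ 1) *\<^sub>R e2" for x
    have S: "S (S x) = x" for x by (simp add: S_def vec_eq_iff forall_2 axis_def)
    have "linear S" by (rule linearI) (auto simp: S_def algebra_simps)
    then have bl: "bounded_linear S" by (simp add: linear_conv_bounded_linear)
    have Se: "S e1 = e2" "S e2 = e1" by (simp_all add: S_def vec_eq_iff forall_2 axis_def)
    have tm: "tangent_map (\<lambda>x. \<phi> (S x)) x u = tangent_map \<phi> (S x) (S u)" for x u
    proof -
      have "((\<lambda>x. \<phi> (S x)) has_derivative (\<lambda>u. tangent_map \<phi> (S x) (S u))) (at x)"
        unfolding tangent_map_def
        by (rule has_derivative_compose[OF bounded_linear_imp_has_derivative[OF bl] Cinf_on_has_derivative[OF cD(1)]]) simp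
      from frechet_derivative_at[OF this] show ?thesis unfolding tangent_map_def by metis
    qed
    have "sphere_chart p (\<lambda>x. \<phi> (S x)) (\<lambda>q. S (\<pi> q)) W"
      unfolding sphere_chart_def
      by (intro conjI allI ballI impI Cinf_on_compose[OF cD(1) Cinf_on_linear[OF open_UNIV bl]]
          Cinf_on_bounded_linear[OF cD(2) bl cD(3)] cD)
         (use cD S in auto)
    moreover have "s * orient (\<lambda>x. \<phi> (S x)) x > 0" for x
    proof -
      have "orient (\<lambda>x. \<phi> (S x)) x = - orient \<phi> (S x)"
        unfolding orient_def tm Se by (subst cross_skew) simp
      then show ?thesis using 2 by simp
    qed
    ultimately show ?thesis by blast
  qed
qed

section \<open>From plane orbits to magnetic geodesics\<close>

text \<open>The vector \<open>v\<close> has the direction angle \<open>\<theta>\<close> in the frame dual to \<open>\<xi>1, \<xi>2\<close>; it is a multiple of the rotated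
  \<open>\<theta>\<close>-derivative of the unit covector, because the latter annihilates it.\<close>

lemma frame_velocity:
  fixes \<xi>1 \<xi>2 :: "real^2" and \<epsilon> \<theta> :: real
  assumes w: "J \<xi>1 \<bullet> \<xi>2 > 0"
  defines "v \<equiv> - (\<epsilon> / (J \<xi>1 \<bullet> \<xi>2)) *\<^sub>R J (- sin \<theta> *\<^sub>R \<xi>1 + cos \<theta> *\<^sub>R \<xi>2)"
  shows "\<xi>1 \<bullet> v = \<epsilon> * cos \<theta>" "\<xi>2 \<bullet> v = \<epsilon> * sin \<theta>"
    "J v = (\<epsilon> / (J \<xi>1 \<bullet> \<xi>2)) *\<^sub>R (- sin \<theta> *\<^sub>R \<xi>1 + cos \<theta> *\<^sub>R \<xi>2)"
proof -
  have "\<xi>1 \<bullet> J (- sin \<theta> *\<^sub>R \<xi>1 + cos \<theta> *\<^sub>R \<xi>2) = - cos \<theta> * (J \<xi>1 \<bullet> \<xi>2)"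
    unfolding J_inner_right by (simp add: inner_diff_right inner_add_right)
  then show "\<xi>1 \<bullet> v = \<epsilon> * cos \<theta>" using w by (simp add: v_def)
  have "\<xi>2 \<bullet> J (- sin \<theta> *\<^sub>R \<xi>1 + cos \<theta> *\<^sub>R \<xi>2) = - sin \<theta> * (J \<xi>1 \<bullet> \<xi>2)"
    unfolding J_inner_right by (simp add: inner_diff_right inner_add_right J_inner_swap[of \<xi>2 \<xi>1])
  then show "\<xi>2 \<bullet> v = \<epsilon> * sin \<theta>" using w by (simp add: v_def)
  show "J v = (\<epsilon> / (J \<xi>1 \<bullet> \<xi>2)) *\<^sub>R (- sin \<theta> *\<^sub>R \<xi>1 + cos \<theta> *\<^sub>R \<xi>2)"
    unfolding v_def J_scaleR J_J by (simp add: algebra_simps)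
qed

text \<open>In an arbitrary local parametrization \<open>\<psi>\<close> the coframe is pulled back along the change of coordinates
  \<open>h = \<pi> \<circ> \<psi>\<close>, defined off the centre \<open>p\<close> of the projection, which the curve avoids. The exterior derivatives
  of the coframe and of any primitive of \<open>\<sigma>\<close> are then known in terms of \<open>curl\<close> and \<open>\<beta>\<close>, and they balance by the
  equation for \<open>\<theta>\<close>.\<close>

lemma magnetic_geodesic_from_plane:
  fixes \<xi>1 \<xi>2 :: "real^2 \<Rightarrow> real^2" and y :: "real \<Rightarrow> real^2"
  assumes c: "sphere_chart p \<phi> \<pi> W"
    and \<xi>: "Cinf_on UNIV \<xi>1" "Cinf_on UNIV \<xi>2" and w: "\<And>x. J (\<xi>1 x) \<bullet> \<xi>2 x > 0"
    and metric: "\<And>x u. pullback2 \<phi> g x u u = (\<xi>1 x \<bullet> u)\<^sup>2 + (\<xi>2 x \<bullet> u)\<^sup>2"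
    and area: "\<And>x u v. pullback2 \<phi> \<sigma> x u v = \<beta> x * (J u \<bullet> v)"
    and smooth: "Cinf_on UNIV y"
    and y': "\<And>t. (y has_vector_derivative
      - (\<epsilon> / (J (\<xi>1 (y t)) \<bullet> \<xi>2 (y t))) *\<^sub>R J (- sin (\<theta> t) *\<^sub>R \<xi>1 (y t) + cos (\<theta> t) *\<^sub>R \<xi>2 (y t))) (at t)"
    and \<theta>': "\<And>t. (\<theta> has_real_derivative
      - ((\<beta> (y t) + \<epsilon> * (cos (\<theta> t) * curl \<xi>1 (y t) + sin (\<theta> t) * curl \<xi>2 (y t))) / (J (\<xi>1 (y t)) \<bullet> \<xi>2 (y t)))) (at t)"
  shows "magnetic_geodesic g \<sigma> (\<lambda>t. \<phi> (y t))"
    "(\<phi> (y t), vector_derivative (\<lambda>t. \<phi> (y t)) (at t)) \<in> energy_level g (\<epsilon>\<^sup>2 / 2)"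
proof -
  note cD = sphere_chartD[OF c]
  define v where "v t = - (\<epsilon> / (J (\<xi>1 (y t)) \<bullet> \<xi>2 (y t))) *\<^sub>R J (- sin (\<theta> t) *\<^sub>R \<xi>1 (y t) + cos (\<theta> t) *\<^sub>R \<xi>2 (y t))" for t
  have v: "\<xi>1 (y t) \<bullet> v t = \<epsilon> * cos (\<theta> t)" "\<xi>2 (y t) \<bullet> v t = \<epsilon> * sin (\<theta> t)"
    "J (v t) = (\<epsilon> / (J (\<xi>1 (y t)) \<bullet> \<xi>2 (y t))) *\<^sub>R (- sin (\<theta> t) *\<^sub>R \<xi>1 (y t) + cos (\<theta> t) *\<^sub>R \<xi>2 (y t))" for t
    using frame_velocity[OF w[of "y t"], where \<epsilon> = \<epsilon> and \<theta> = "\<theta> t"] unfolding v_def by blast+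
  have yv: "(y has_vector_derivative v t) (at t)" for t unfolding v_def by (rule y')
  define \<gamma> where "\<gamma> t = \<phi> (y t)" for t
  have \<gamma>s: "Cinf_on UNIV \<gamma>" unfolding \<gamma>_def by (rule Cinf_on_compose[OF cD(1) smooth]) auto
  have \<gamma>v: "(\<gamma> has_vector_derivative tangent_map \<phi> (y t) (v t)) (at t)" for t
    unfolding \<gamma>_def has_vector_derivative_def tangent_map_def
    by (rule has_derivative_eq_rhs[OF has_derivative_compose[OF yv[unfolded has_vector_derivative_def] Cinf_on_has_derivative[OF cD(1) UNIV_I]]])
       (simp add: linear_scale[OF has_derivative_linear[OF Cinf_on_has_derivative[OF cD(1) UNIV_I]]])
  have range\<phi>: "range \<phi> \<subseteq> S2" using cD(4) by auto
  have tan: "tangent_map \<phi> x u \<in> tangent_space (\<phi> x)" for x u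
    by (rule frechet_tangent[OF cD(1) open_UNIV range\<phi>]) simp
  have "g (\<gamma> t) (tangent_map \<phi> (y t) (v t)) (tangent_map \<phi> (y t) (v t)) = \<epsilon>\<^sup>2" for t
  proof -
    have "g (\<gamma> t) (tangent_map \<phi> (y t) (v t)) (tangent_map \<phi> (y t) (v t)) = (\<epsilon> * cos (\<theta> t))\<^sup>2 + (\<epsilon> * sin (\<theta> t))\<^sup>2"
      using metric[of "y t" "v t"] v by (simp add: pullback2_def \<gamma>_def)
    also have "\<dots> = \<epsilon>\<^sup>2 * ((cos (\<theta> t))\<^sup>2 + (sin (\<theta> t))\<^sup>2)" by (simp only: power_mult_distrib distrib_left)
    finally show ?thesis by simp
  qed
  then show "(\<phi> (y t), vector_derivative (\<lambda>t. \<phi> (y t)) (at t)) \<in> energy_level g (\<epsilon>\<^sup>2 / 2)"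
    using cD(4) tan vector_derivative_at[OF \<gamma>v, unfolded \<gamma>_def[abs_def]]
    by (simp add: energy_level_def kinetic_energy_def \<gamma>_def)
  have "magnetic_geodesic g \<sigma> \<gamma>"
    unfolding magnetic_geodesic_def
  proof (intro conjI allI impI)
    show "smooth_on UNIV \<gamma>" using \<gamma>s by (simp add: smooth_on_open_iff)
    show "range \<gamma> \<subseteq> S2" using cD(4) by (auto simp: \<gamma>_def)
    fix U \<Theta> assume U\<Theta>: "openin (top_of_set S2) U \<and> primitive_on U \<sigma> \<Theta>"
    then have U: "U \<subseteq> S2" by (auto dest: openin_imp_subset)
    show "euler_lagrange_on U (magnetic_lagrangian g \<Theta>) \<gamma>"
      unfolding euler_lagrange_on_def Let_def
    proof (intro allI impI)
      fix V \<psi> t e assume V\<psi>: "local_param V \<psi> \<and> \<psi> ` V \<subseteq> U" and t: "\<gamma> t \<in> \<psi> ` V"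
      then have V: "open V" "inj_on \<psi> V" "openin (top_of_set S2) (\<psi> ` V)" "smooth_on (\<psi> ` V) (inv_into V \<psi>)"
        and \<psi>: "Cinf_on V \<psi>" "\<psi> ` V \<subseteq> U"
        by (auto simp: local_param_def smooth_on_open_iff)
      have \<psi>S: "\<psi> ` V \<subseteq> S2" using \<psi>(2) U by blast
      obtain Q where Q: "open Q" "\<psi> ` V = S2 \<inter> Q" using V(3) by (auto simp: openin_open)
      define T where "T = \<gamma> -` Q"
      have T: "open T" unfolding T_def
        using Q(1) Cinf_on_continuous[OF \<gamma>s] by (intro open_vimage) (auto simp: continuous_on_eq_continuous_at)
      have T_iff: "s \<in> T \<longleftrightarrow> \<gamma> s \<in> \<psi> ` V" for s
        using Q(2) cD(4) by (auto simp: T_def \<gamma>_def)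
      define cc where "cc s = inv_into V \<psi> (\<gamma> s)" for s
      define cc' where "cc' s = vector_derivative cc (at s)" for s
      have cc: "cc s \<in> V" "\<psi> (cc s) = \<gamma> s" if "s \<in> T" for s
        using that inv_into_into[of "\<gamma> s" \<psi> V] f_inv_into_f[of "\<gamma> s" \<psi> V] by (auto simp: T_iff cc_def)
      have "Cinf_on T cc"
        unfolding cc_def
        by (rule smooth_on_compose[OF V(4) T Cinf_on_subset[OF \<gamma>s]]) (auto simp: T_iff)
      then have ccd: "(cc has_vector_derivative cc' s) (at s)" if "s \<in> T" for s
        unfolding cc'_def vector_derivative_works[symmetric]
        using Cinf_on_has_derivative[OF _ that] by (auto intro: differentiableI)
      define V0 where "V0 = {x \<in> V. \<psi> x \<noteq> p}"
      have "V0 = V \<inter> \<psi> -` (- {p})" by (auto simp: V0_def)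
      then have V0: "open V0"
        using continuous_open_preimage[OF Cinf_on_continuous[OF \<psi>(1)] V(1), of "- {p}"] by (simp add: open_Compl)
      have V0V: "V0 \<subseteq> V" by (auto simp: V0_def)
      have cc0: "cc s \<in> V0" if "s \<in> T" for s
        using cc[OF that] cD(6) by (auto simp: V0_def \<gamma>_def)
      define h where "h x = \<pi> (\<psi> x)" for x
      have \<psi>0: "\<psi> x \<in> S2" "\<psi> x \<noteq> p" if "x \<in> V0" for x using that \<psi>S by (auto simp: V0_def)
      have h: "Cinf_on V0 h"
        unfolding h_def
        by (rule Cinf_on_compose[OF cD(3) Cinf_on_subset[OF \<psi>(1) V0V] V0 cD(2)]) (use \<psi>0 cD(8) in auto)
      have \<phi>h: "\<phi> (h x) = \<psi> x" if "x \<in> V0" for x using \<psi>0[OF that] cD(9) by (simp add: h_def)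
      have hc: "h (cc s) = y s" if "s \<in> T" for s
        using cc(2)[OF that] cD(7) by (simp add: h_def \<gamma>_def)
      define h' where "h' x = frechet_derivative h (at x)" for x
      have hd: "(h has_derivative h' x) (at x)" if "x \<in> V0" for x
        unfolding h'_def by (rule Cinf_on_has_derivative[OF h that])
      have lh: "linear (h' x)" if "x \<in> V0" for x using hd[OF that] has_derivative_linear by blast
      have tm: "tangent_map \<psi> x u = tangent_map \<phi> (h x) (h' x u)" if x: "x \<in> V0" for x u
      proof -
        have "((\<lambda>x. \<phi> (h x)) has_derivative (\<lambda>u. tangent_map \<phi> (h x) (h' x u))) (at x)"
          unfolding tangent_map_def
          by (rule has_derivative_compose[OF hd[OF x] Cinf_on_has_derivative[OF cD(1) UNIV_I]])
        then have "(\<psi> has_derivative (\<lambda>u. tangent_map \<phi> (h x) (h' x u))) (at x)"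
          by (rule has_derivative_transform_within_open[OF _ V0 x]) (rule \<phi>h)
        from frechet_derivative_at[OF this] show ?thesis unfolding tangent_map_def by metis
      qed
      have hv: "h' (cc s) (cc' s) = v s" if s: "s \<in> T" for s
      proof -
        have "((\<lambda>s. h (cc s)) has_vector_derivative h' (cc s) (cc' s)) (at s)"
          using vector_derivative_diff_chain_within[OF ccd[OF s], of h "h' (cc s)"] hd[OF cc0[OF s]]
          by (simp add: o_def has_derivative_at_withinI)
        then have "(y has_vector_derivative h' (cc s) (cc' s)) (at s)"
          by (rule has_vector_derivative_transform_within_open[OF _ T s]) (rule hc)
        then show ?thesis using yv vector_derivative_unique_at by blast
      qed
      define \<zeta>1 \<zeta>2 where "\<zeta>1 x u = \<xi>1 (h x) \<bullet> h' x u" and "\<zeta>2 x u = \<xi>2 (h x) \<bullet> h' x u" for x u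
      define \<alpha> where "\<alpha> = pullback1 \<psi> \<Theta>"
      have one: "one_form_on U \<Theta>" using U\<Theta> by (simp add: primitive_on_def)
      have tT: "t \<in> T" using t by (simp add: T_iff)
      note x = cc0[OF tT]
      have d\<alpha>: "ext_deriv_plane \<alpha> (cc t) (cc' t) e = \<beta> (y t) * (J (v t) \<bullet> h' (cc t) e)"
      proof -
        have "ext_deriv_plane \<alpha> (cc t) (cc' t) e = pullback2 \<psi> \<sigma> (cc t) (cc' t) e"
          using U\<Theta> V\<psi> cc(1)[OF tT] unfolding primitive_on_def \<alpha>_def by blast
        also have "\<dots> = pullback2 \<phi> \<sigma> (y t) (v t) (h' (cc t) e)"
          unfolding pullback2_def tm[OF x] hv[OF tT] hc[OF tT] using cc(2)[OF tT] by (simp add: \<gamma>_def)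
        finally show ?thesis by (simp add: area)
      qed
      note d\<zeta> = ext_deriv_pullback[OF h V0 x \<xi>(1), folded h'_def, folded \<zeta>1_def]
        ext_deriv_pullback[OF h V0 x \<xi>(2), folded h'_def, folded \<zeta>2_def]
      have lin: "linear (\<zeta>1 x)" "linear (\<zeta>2 x)" "linear (\<alpha> x)" if "x \<in> V0" for x
      proof -
        show "linear (\<zeta>1 x)" "linear (\<zeta>2 x)"
          unfolding \<zeta>1_def \<zeta>2_def
          by (auto intro!: linearI simp: linear_add[OF lh[OF that]] linear_scale[OF lh[OF that]] inner_add_right)
        show "linear (\<alpha> x)" unfolding \<alpha>_def
          by (rule linear_pullback1[OF one \<psi>(1) V(1) \<psi>(2) U]) (use that V0V in auto)
      qed
      have "((\<lambda>s. frechet_derivative (\<lambda>w. magnetic_lagrangian g \<Theta> (\<psi> (cc s)) (tangent_map \<psi> (cc s) w)) (at (cc' s)) e)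
          has_real_derivative
          frechet_derivative (\<lambda>x. magnetic_lagrangian g \<Theta> (\<psi> x) (tangent_map \<psi> x (cc' t))) (at (cc t)) e) (at t)"
      proof (rule euler_lagrange_in_coordinates[where c = cc and c' = cc' and \<theta> = \<theta> and \<epsilon> = \<epsilon> and
            ?\<zeta>1.0 = \<zeta>1 and ?\<zeta>2.0 = \<zeta>2 and \<alpha> = \<alpha> and V = V0 and
            l = "\<lambda>x u. magnetic_lagrangian g \<Theta> (\<psi> x) (tangent_map \<psi> x u)",
            OF V0 T tT lin d\<zeta>(1) d\<zeta>(3) _ _ cc0 ccd[OF tT] _ _ \<theta>'[of t]])
        show "(\<lambda>x. \<alpha> x u) differentiable at (cc t)" for u
          unfolding \<alpha>_def
          using Cinf_on_has_derivative[OF Cinf_on_pullback1[OF one \<psi>(1) V(1) \<psi>(2) U] cc(1)[OF tT]]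
          by (auto intro: differentiableI)
        show "magnetic_lagrangian g \<Theta> (\<psi> x) (tangent_map \<psi> x u) = ((\<zeta>1 x u)\<^sup>2 + (\<zeta>2 x u)\<^sup>2) / 2 + \<alpha> x u"
          if x: "x \<in> V0" for x u
          using metric[of "h x" "h' x u"]
          by (simp add: magnetic_lagrangian_def kinetic_energy_def \<alpha>_def pullback1_def pullback2_def
              \<zeta>1_def \<zeta>2_def tm[OF x] \<phi>h[OF x])
        show "\<zeta>1 (cc s) (cc' s) = \<epsilon> * cos (\<theta> s)" "\<zeta>2 (cc s) (cc' s) = \<epsilon> * sin (\<theta> s)" if "s \<in> T" for s
          using v by (simp_all add: \<zeta>1_def \<zeta>2_def hv[OF that] hc[OF that])
        let ?w = "J (\<xi>1 (y t)) \<bullet> \<xi>2 (y t)" and ?E = "h' (cc t) e"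
        let ?B = "\<beta> (y t) + \<epsilon> * (cos (\<theta> t) * curl \<xi>1 (y t) + sin (\<theta> t) * curl \<xi>2 (y t))"
        define m where "m = - sin (\<theta> t) * (\<xi>1 (y t) \<bullet> ?E) + cos (\<theta> t) * (\<xi>2 (y t) \<bullet> ?E)"
        have JE: "J (v t) \<bullet> ?E = \<epsilon> / ?w * m"
          unfolding v(3) m_def by (simp add: inner_add_left inner_diff_left)
        show "\<epsilon> * (cos (\<theta> t) * ext_deriv_plane \<zeta>1 (cc t) (cc' t) e + sin (\<theta> t) * ext_deriv_plane \<zeta>2 (cc t) (cc' t) e)
            + ext_deriv_plane \<alpha> (cc t) (cc' t) e
            + \<epsilon> * - (?B / ?w) * (- sin (\<theta> t) * \<zeta>1 (cc t) e + cos (\<theta> t) * \<zeta>2 (cc t) e) = 0"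
          unfolding d\<zeta>(2,4) d\<alpha> hv[OF tT] hc[OF tT] \<zeta>1_def \<zeta>2_def JE m_def[symmetric]
          using w[of "y t"] by (simp add: field_simps)
      qed
      then show "((\<lambda>s. frechet_derivative
              (\<lambda>w. magnetic_lagrangian g \<Theta> (\<psi> (inv_into V \<psi> (\<gamma> s))) (tangent_map \<psi> (inv_into V \<psi> (\<gamma> s)) w))
              (at (vector_derivative (\<lambda>t. inv_into V \<psi> (\<gamma> t)) (at s))) e) has_real_derivative
           frechet_derivative
            (\<lambda>x. magnetic_lagrangian g \<Theta> (\<psi> x) (tangent_map \<psi> x (vector_derivative (\<lambda>t. inv_into V \<psi> (\<gamma> t)) (at t))))
            (at (inv_into V \<psi> (\<gamma> t))) e) (at t)"
        unfolding cc'_def cc_def[abs_def] .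
    qed
  qed
  then show "magnetic_geodesic g \<sigma> (\<lambda>t. \<phi> (y t))" unfolding \<gamma>_def .
qed

text \<open>Here \<open>\<rho>\<close> is the modulus of the derivative of the time with respect to the direction angle. The minus sign
  is that of the Lorentz force: for a positive density the velocity turns clockwise.\<close>

lemma time_change:
  fixes x :: "real \<Rightarrow> 'a::real_normed_vector" and \<rho> :: "real \<Rightarrow> real"
  assumes x: "\<And>t. x (t + 2 * pi) = x t" and \<rho>: "continuous_on UNIV \<rho>" "\<And>t. \<rho> t > 0" "\<And>t. \<rho> (t + 2 * pi) = \<rho> t"
  shows "\<exists>\<theta> T. T > 0 \<and> (\<forall>t. x (\<theta> (t + T)) = x (\<theta> t)) \<and> (\<forall>t. (\<theta> has_real_derivative - (1 / \<rho> (\<theta> t))) (at t))"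
proof -
  obtain \<tau> where \<tau>: "\<tau> 0 = 0" "\<And>t. (\<tau> has_real_derivative \<rho> t) (at t)"
    using continuous_primitive[OF \<rho>(1)] by (auto simp: has_real_derivative_iff_has_vector_derivative)
  have mono: "\<tau> a < \<tau> b" if "a < b" for a b
    using DERIV_pos_imp_increasing[OF that, of \<tau>] \<tau>(2) \<rho>(2) by blast
  have cont: "isCont \<tau> t" for t using \<tau>(2) DERIV_isCont by blast
  define T where "T = \<tau> (2 * pi)"
  have T: "T > 0" using mono[of 0 "2 * pi"] \<tau>(1) by (simp add: T_def)
  have shift: "\<tau> (t + 2 * pi) = \<tau> t + T" for t
  proof -
    have "((\<lambda>t. \<tau> (t + 2 * pi) - \<tau> t) has_real_derivative 0) (at t)" for t
    proof -
      have "((\<lambda>t. \<tau> (t + 2 * pi)) has_real_derivative \<rho> (t + 2 * pi)) (at t)"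
        using \<tau>(2)[of "t + 2 * pi"] by (simp add: DERIV_shift)
      from DERIV_diff[OF this \<tau>(2)[of t]] show ?thesis by (simp add: \<rho>(3))
    qed
    then have "\<tau> (t + 2 * pi) - \<tau> t = \<tau> (0 + 2 * pi) - \<tau> 0"
      using DERIV_isconst_all[of "\<lambda>t. \<tau> (t + 2 * pi) - \<tau> t" t 0] by blast
    then show ?thesis by (simp add: T_def \<tau>(1))
  qed
  have multi: "\<tau> (of_int n * (2 * pi)) = of_int n * T" for n
  proof (induction n rule: int_induct[where k = 0])
    case (step1 i) then show ?case using shift[of "of_int i * (2 * pi)"] by (simp add: algebra_simps)
  next
    case (step2 i) then show ?case using shift[of "of_int (i - 1) * (2 * pi)"] by (simp add: algebra_simps)
  qed (simp add: \<tau>(1))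
  have surj: "\<exists>s. \<tau> s = t" for t
  proof -
    define n where "n = \<lfloor>t / T\<rfloor>"
    have "of_int n \<le> t / T" "t / T < of_int n + 1" by (auto simp: n_def)
    then have "of_int n * T \<le> t" "t \<le> of_int (n + 1) * T"
      using T by (simp_all add: field_simps)
    then have "\<tau> (of_int n * (2 * pi)) \<le> t" "t \<le> \<tau> (of_int (n + 1) * (2 * pi))"
      by (simp_all only: multi)
    moreover have "of_int n * (2 * pi) \<le> of_int (n + 1) * (2 * pi)" by (simp add: distrib_right)
    ultimately show ?thesis using IVT[of \<tau> "of_int n * (2 * pi)" t "of_int (n + 1) * (2 * pi)"] cont by auto
  qed
  define \<Theta> where "\<Theta> t = (SOME s. \<tau> s = t)" for t
  have \<tau>\<Theta>: "\<tau> (\<Theta> t) = t" for t unfolding \<Theta>_def by (rule someI_ex[OF surj])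
  have \<Theta>\<tau>: "\<Theta> (\<tau> s) = s" for s
    using \<tau>\<Theta>[of "\<tau> s"] mono by (metis less_irrefl linorder_cases)
  have \<Theta>cont: "isCont \<Theta> t" for t
    using isCont_inverse_function[of 1 "\<Theta> t" \<Theta> \<tau>] \<Theta>\<tau> cont by (simp add: \<tau>\<Theta>)
  have \<Theta>d: "(\<Theta> has_real_derivative inverse (\<rho> (\<Theta> t))) (at t)" for t
    by (rule DERIV_inverse_function[of \<tau> _ _ _ "t - 1" "t + 1"])
       (use \<tau>(2) \<rho>(2)[of "\<Theta> t"] \<tau>\<Theta> \<Theta>cont in auto)
  have \<Theta>shift: "\<Theta> (t - T) = \<Theta> t - 2 * pi" for t
    using shift[of "\<Theta> t - 2 * pi"] \<Theta>\<tau> \<tau>\<Theta> by (metis add_diff_cancel_right' diff_add_cancel)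
  show ?thesis
  proof (intro exI[of _ "\<lambda>t. \<Theta> (- t)"] exI[of _ T] conjI allI T)
    fix t
    show "x (\<Theta> (- (t + T))) = x (\<Theta> (- t))"
    proof -
      have "\<Theta> (- (t + T)) = \<Theta> (- t) - 2 * pi" using \<Theta>shift[of "- t"] by (simp only: minus_add_distrib diff_conv_add_uminus)
      then show ?thesis using x[of "\<Theta> (- t) - 2 * pi"] by simp
    qed
    have "((\<lambda>t. \<Theta> (- t)) has_real_derivative inverse (\<rho> (\<Theta> (- t))) * - 1) (at t)"
      by (rule DERIV_chain2[OF \<Theta>d]) (auto intro!: derivative_eq_intros)
    then show "((\<lambda>t. \<Theta> (- t)) has_real_derivative - (1 / \<rho> (\<Theta> (- t)))) (at t)"
      by (simp add: inverse_eq_divide)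
  qed
qed

text \<open>Position and direction angle together solve an autonomous equation with smooth coefficients, which makes
  the curve smooth.\<close>

lemma geodesic_of_plane_orbit:
  fixes \<xi>1 \<xi>2 :: "real^2 \<Rightarrow> real^2" and \<beta> :: "real^2 \<Rightarrow> real" and \<epsilon> :: real and x :: "real \<Rightarrow> real^2"
  defines "w \<equiv> \<lambda>x. J (\<xi>1 x) \<bullet> \<xi>2 x"
    and "B \<equiv> \<lambda>x t. \<beta> x + \<epsilon> * (cos t * curl \<xi>1 x + sin t * curl \<xi>2 x)"
  assumes c: "sphere_chart p \<phi> \<pi> W"
    and \<xi>: "Cinf_on UNIV \<xi>1" "Cinf_on UNIV \<xi>2" "Cinf_on UNIV \<beta>" and w: "\<And>x. w x > 0"
    and metric: "\<And>x u. pullback2 \<phi> g x u u = (\<xi>1 x \<bullet> u)\<^sup>2 + (\<xi>2 x \<bullet> u)\<^sup>2"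
    and area: "\<And>x u v. pullback2 \<phi> \<sigma> x u v = \<beta> x * (J u \<bullet> v)"
    and x: "\<And>t. x (t + 2 * pi) = x t" "\<And>t. B (x t) t > 0"
      "\<And>t. (x has_vector_derivative (\<epsilon> / B (x t) t) *\<^sub>R J (- sin t *\<^sub>R \<xi>1 (x t) + cos t *\<^sub>R \<xi>2 (x t))) (at t)"
  shows "\<exists>\<theta>. closed_magnetic_geodesic g \<sigma> (\<epsilon>\<^sup>2 / 2) (\<lambda>t. \<phi> (x (\<theta> t)))"
proof -
  have cx: "continuous_on UNIV x"
    using has_vector_derivative_continuous[OF x(3)] by (auto intro: continuous_at_imp_continuous_on)
  have cc: "continuous_on UNIV (\<lambda>t. k (x t))" if "Cinf_on UNIV k" for k :: "real^2 \<Rightarrow> 'c::euclidean_space"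
    by (rule continuous_on_compose2[OF Cinf_on_continuous[OF that] cx]) auto
  have smooth_w: "Cinf_on UNIV w"
    unfolding w_def by (intro Cinf_intros Cinf_on_bounded_linear[OF _ bounded_linear_J] \<xi> open_UNIV)
  have cB: "continuous_on UNIV (\<lambda>t. B (x t) t)"
    unfolding B_def by (intro continuous_intros cc \<xi> Cinf_on_curl)
  have "continuous_on UNIV (\<lambda>t. w (x t) / B (x t) t)"
    using x(2) by (intro continuous_intros cc smooth_w cB) (metis less_irrefl)
  moreover have "w (x t) / B (x t) t > 0" for t using w x(2) by simp
  moreover have "w (x (t + 2 * pi)) / B (x (t + 2 * pi)) (t + 2 * pi) = w (x t) / B (x t) t" for t
    by (simp add: x(1) B_def)
  ultimately obtain \<theta> T where T: "T > 0" and per: "\<And>t. x (\<theta> (t + T)) = x (\<theta> t)"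
    and \<theta>0: "\<And>t. (\<theta> has_real_derivative - (1 / (w (x (\<theta> t)) / B (x (\<theta> t)) (\<theta> t)))) (at t)"
    using time_change[of x "\<lambda>t. w (x t) / B (x t) t"] x(1) by blast
  define y where "y t = x (\<theta> t)" for t
  have \<theta>: "(\<theta> has_real_derivative - (B (y t) (\<theta> t) / w (y t))) (at t)" for t
    using \<theta>0[of t] by (simp add: y_def)
  have y: "(y has_vector_derivative - (\<epsilon> / w (y t)) *\<^sub>R J (- sin (\<theta> t) *\<^sub>R \<xi>1 (y t) + cos (\<theta> t) *\<^sub>R \<xi>2 (y t))) (at t)" for t
  proof -
    let ?v = "J (- sin (\<theta> t) *\<^sub>R \<xi>1 (y t) + cos (\<theta> t) *\<^sub>R \<xi>2 (y t))"
    have "((x \<circ> \<theta>) has_vector_derivative (- (B (y t) (\<theta> t) / w (y t))) *\<^sub>R ((\<epsilon> / B (x (\<theta> t)) (\<theta> t)) *\<^sub>R ?v)) (at t)"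
      unfolding y_def
      by (rule vector_diff_chain_at[OF \<theta>[unfolded has_real_derivative_iff_has_vector_derivative y_def] x(3)])
    moreover have "- (B (y t) (\<theta> t) / w (y t)) * (\<epsilon> / B (x (\<theta> t)) (\<theta> t)) = - (\<epsilon> / w (y t))"
      using x(2)[of "\<theta> t"] by (simp add: y_def)
    ultimately show ?thesis unfolding scaleR_scaleR o_def y_def[symmetric] by simp
  qed
  define H where "H z = (- (\<epsilon> / w (fst z)) *\<^sub>R J (- sin (snd z) *\<^sub>R \<xi>1 (fst z) + cos (snd z) *\<^sub>R \<xi>2 (fst z)),
      - (B (fst z) (snd z) / w (fst z)))" for z :: "(real^2) \<times> real"
  have comp: "Cinf_on UNIV (\<lambda>z::(real^2) \<times> real. k (fst z))" if "Cinf_on UNIV k" for k :: "real^2 \<Rightarrow> 'c::euclidean_space"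
    by (rule Cinf_on_compose[OF that Cinf_on_fst[OF open_UNIV Cinf_on_id[OF open_UNIV]]]) auto
  have "Cinf_on UNIV H"
    unfolding H_def B_def using less_imp_neq[OF w, symmetric]
    by (intro Cinf_intros Cinf_on_bounded_linear[OF _ bounded_linear_J] comp \<xi> smooth_w Cinf_on_curl open_UNIV)
  moreover have "((\<lambda>t. (y t, \<theta> t)) has_vector_derivative H (y t, \<theta> t)) (at t)" for t
    unfolding H_def fst_conv snd_conv
    by (rule has_vector_derivative_Pair[OF y \<theta>[unfolded has_real_derivative_iff_has_vector_derivative]])
  ultimately have "Cinf_on UNIV (\<lambda>t. (y t, \<theta> t))" by (rule Cinf_on_ode_solution)
  from Cinf_on_fst[OF open_UNIV this] have sy: "Cinf_on UNIV y" by simp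
  note mg = magnetic_geodesic_from_plane[OF c \<xi>(1,2) w[unfolded w_def] metric area sy y[unfolded w_def] \<theta>[unfolded w_def B_def]]
  have "closed_magnetic_geodesic g \<sigma> (\<epsilon>\<^sup>2 / 2) (\<lambda>t. \<phi> (y t))"
    unfolding closed_magnetic_geodesic_def using mg T per by (auto simp: y_def)
  then show ?thesis unfolding y_def by blast
qed

section \<open>Closed magnetic geodesics where the density has a given sign\<close>

text \<open>The Cholesky decomposition of the matrix with entries \<open>E, F, F, H\<close>.\<close>

lemma orthonormal_coframe:
  fixes E F H :: real
  assumes "E > 0" "E * H - F\<^sup>2 > 0"
  defines "\<xi>1 \<equiv> sqrt E *\<^sub>R e1 + (F / sqrt E) *\<^sub>R e2" and "\<xi>2 \<equiv> (sqrt (E * H - F\<^sup>2) / sqrt E) *\<^sub>R e2"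
  shows "J \<xi>1 \<bullet> \<xi>2 = sqrt (E * H - F\<^sup>2)"
    "(\<xi>1 \<bullet> u)\<^sup>2 + (\<xi>2 \<bullet> u)\<^sup>2 = E * (u $ 1)\<^sup>2 + 2 * F * (u $ 1 * u $ 2) + H * (u $ 2)\<^sup>2"
proof -
  define r where "r = sqrt E"
  define d where "d = sqrt (E * H - F\<^sup>2)"
  have r: "r > 0" "r\<^sup>2 = E" using assms(1) by (auto simp: r_def)
  have d: "d\<^sup>2 = E * H - F\<^sup>2" using assms(2) by (auto simp: d_def)
  have n: "\<xi>1 $ 1 = r" "\<xi>1 $ 2 = F / r" "\<xi>2 $ 1 = 0" "\<xi>2 $ 2 = d / r"
    by (simp_all add: \<xi>1_def \<xi>2_def r_def d_def axis_def)
  show "J \<xi>1 \<bullet> \<xi>2 = sqrt (E * H - F\<^sup>2)"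
    using r(1) by (simp add: inner_vec_def sum_2 n d_def)
  have "(\<xi>1 \<bullet> u)\<^sup>2 + (\<xi>2 \<bullet> u)\<^sup>2
      = r\<^sup>2 * (u $ 1)\<^sup>2 + 2 * F * (u $ 1 * u $ 2) + ((F\<^sup>2 + d\<^sup>2) / r\<^sup>2) * (u $ 2)\<^sup>2"
    using r(1) by (simp add: inner_vec_def sum_2 n field_simps power2_eq_square)
  also have "(F\<^sup>2 + d\<^sup>2) / r\<^sup>2 = H" unfolding d r(2) using assms(1) by simp
  finally show "(\<xi>1 \<bullet> u)\<^sup>2 + (\<xi>2 \<bullet> u)\<^sup>2 = E * (u $ 1)\<^sup>2 + 2 * F * (u $ 1 * u $ 2) + H * (u $ 2)\<^sup>2"
    by (simp only: r(2))
qed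

text \<open>Projecting from a point where \<open>s f\<close> is negative turns the set where \<open>s f\<close> is at least half its maximum into a
  compact subset \<open>K\<close> of the plane. The orientation \<open>s\<close> of the chart makes the pulled back form \<open>\<beta>\<close> positive on
  \<open>K\<close>, so that the same argument applies to the maximum and to the minimum of \<open>f\<close>.\<close>

lemma region_geodesic:
  assumes g: "riemannian_metric g" and \<sigma>: "two_form \<sigma>" and f: "density_of g \<sigma> f"
    and s: "s = 1 \<or> s = (-1 :: real)" and p: "p \<in> S2" "s * f p < 0" and q: "q \<in> S2" "s * f q > 0"
  shows "\<exists>\<tau>>0. \<forall>k. 0 < k \<and> k < \<tau> \<longrightarrow>
    (\<exists>\<gamma>. closed_magnetic_geodesic g \<sigma> k \<gamma> \<and> (\<forall>t. s * f (\<gamma> t) > 0))"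
proof -
  obtain \<phi> \<pi> W where c: "sphere_chart p \<phi> \<pi> W" and or: "\<And>x. s * orient \<phi> x > 0"
    using chart_oriented[OF p(1) s] by blast
  note cD = sphere_chartD[OF c]
  have range\<phi>: "\<phi> ` UNIV \<subseteq> S2" using cD(4) by auto
  have Bg: "bilinear_field_on S2 g" using g by (simp add: riemannian_metric_def)
  have Bs: "bilinear_field_on S2 \<sigma>" using \<sigma> by (simp add: two_form_def)
  have tan: "tangent_map \<phi> x u \<in> tangent_space (\<phi> x)" for x u
    by (rule frechet_tangent[OF cD(1) open_UNIV range\<phi> UNIV_I])
  note l = linear_tangent_map[OF cD(1) UNIV_I]
  define E F H where "E x = pullback2 \<phi> g x e1 e1" and "F x = pullback2 \<phi> g x e1 e2"
    and "H x = pullback2 \<phi> g x e2 e2" for x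
  define w where "w x = sqrt (E x * H x - (F x)\<^sup>2)" for x
  define \<beta> where "\<beta> x = pullback2 \<phi> \<sigma> x e1 e2" for x
  have gram: "E x > 0" "E x * H x - (F x)\<^sup>2 > 0" for x
    using gram_pos[OF g cD(4) tan tan chart_cross_nonzero[OF c]]
    by (simp_all add: E_def F_def H_def pullback2_def)
  have w: "w x > 0" for x using gram(2) by (simp add: w_def)
  define \<xi>1 \<xi>2 where "\<xi>1 x = sqrt (E x) *\<^sub>R e1 + (F x / sqrt (E x)) *\<^sub>R e2"
    and "\<xi>2 x = (sqrt (E x * H x - (F x)\<^sup>2) / sqrt (E x)) *\<^sub>R e2" for x
  note coframe = orthonormal_coframe[OF gram, folded \<xi>1_def \<xi>2_def]
  have smooth: "Cinf_on UNIV E" "Cinf_on UNIV F" "Cinf_on UNIV H" "Cinf_on UNIV \<beta>"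
    unfolding E_def F_def H_def \<beta>_def
    by (intro Cinf_on_pullback2[OF Bg cD(1) open_UNIV range\<phi>] Cinf_on_pullback2[OF Bs cD(1) open_UNIV range\<phi>])+
  have E0: "sqrt (E x) \<noteq> 0" for x using gram(1)[of x] by simp
  have \<xi>: "Cinf_on UNIV \<xi>1" "Cinf_on UNIV \<xi>2"
    unfolding \<xi>1_def \<xi>2_def by (intro Cinf_intros smooth gram E0 open_UNIV)+
  have Jw: "J (\<xi>1 x) \<bullet> \<xi>2 x = w x" for x unfolding w_def by (rule coframe(1))
  have metric: "pullback2 \<phi> g x u u = (\<xi>1 x \<bullet> u)\<^sup>2 + (\<xi>2 x \<bullet> u)\<^sup>2" for x u
  proof -
    note l1 = linear_pullback2_left[OF Bg cD(1) open_UNIV range\<phi> UNIV_I]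
    note l2 = linear_pullback2_right[OF Bg cD(1) open_UNIV range\<phi> UNIV_I]
    have sym: "pullback2 \<phi> g x e2 e1 = F x"
      using g cD(4) tan unfolding F_def pullback2_def riemannian_metric_def by blast
    have "pullback2 \<phi> g x u u = pullback2 \<phi> g x ((u $ 1) *\<^sub>R e1 + (u $ 2) *\<^sub>R e2) ((u $ 1) *\<^sub>R e1 + (u $ 2) *\<^sub>R e2)"
      by (simp only: plane_expand[symmetric])
    also have "\<dots> = u $ 1 * (u $ 1 * E x + u $ 2 * F x) + u $ 2 * (u $ 1 * F x + u $ 2 * H x)"
      by (simp only: linear_add[OF l1] linear_scale[OF l1] linear_add[OF l2] linear_scale[OF l2] sym
          E_def[symmetric] F_def[symmetric] H_def[symmetric] real_scaleR_def)
    finally show ?thesis unfolding coframe(2) by (simp add: algebra_simps power2_eq_square)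
  qed
  have area: "pullback2 \<phi> \<sigma> x u v = \<beta> x * (J u \<bullet> v)" for x u v
  proof -
    note l1 = linear_pullback2_left[OF Bs cD(1) open_UNIV range\<phi> UNIV_I]
    note l2 = linear_pullback2_right[OF Bs cD(1) open_UNIV range\<phi> UNIV_I]
    have alt: "pullback2 \<phi> \<sigma> x u u = 0" for u
      using \<sigma> cD(4) tan unfolding pullback2_def two_form_def by blast
    have "pullback2 \<phi> \<sigma> x (e1 + e2) (e1 + e2) = \<beta> x + pullback2 \<phi> \<sigma> x e2 e1"
      unfolding linear_add[OF l1] linear_add[OF l2] by (simp add: alt \<beta>_def)
    then have skew: "pullback2 \<phi> \<sigma> x e2 e1 = - \<beta> x" using alt[of "e1 + e2"] by simp
    have "pullback2 \<phi> \<sigma> x u v = pullback2 \<phi> \<sigma> x ((u $ 1) *\<^sub>R e1 + (u $ 2) *\<^sub>R e2) ((v $ 1) *\<^sub>R e1 + (v $ 2) *\<^sub>R e2)"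
      by (simp only: plane_expand[symmetric])
    also have "\<dots> = u $ 1 * (v $ 2 * \<beta> x) + u $ 2 * (v $ 1 * - \<beta> x)"
      unfolding linear_add[OF l1] linear_scale[OF l1] linear_add[OF l2] linear_scale[OF l2] alt skew \<beta>_def[symmetric]
      by simp
    finally show ?thesis by (simp add: inner_vec_def sum_2 algebra_simps)
  qed
  have \<beta>_eq: "\<beta> x = s * f (\<phi> x) * w x" for x
  proof -
    have "\<beta> x = f (\<phi> x) * (sgn (orient \<phi> x) * w x)"
      using f[unfolded density_of_def, rule_format, OF cD(4) tan tan, of x e1 e2]
      by (simp add: \<beta>_def pullback2_def area_form_def orient_def w_def E_def F_def H_def)
    moreover have "sgn (orient \<phi> x) = s" using or[of x] s by (auto simp: sgn_real_def)
    ultimately show ?thesis by simp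
  qed
  have cf: "continuous_on S2 (\<lambda>q. s * f q)"
    by (intro continuous_intros density_continuous[OF g \<sigma> f])
  have "compact S2" by (simp add: S2_def compact_sphere)
  then obtain qm where qm: "qm \<in> S2" "\<And>q. q \<in> S2 \<Longrightarrow> s * f q \<le> s * f qm"
    using continuous_attains_sup[OF _ _ cf] q(1) by blast
  define m where "m = s * f qm"
  have m: "m > 0" using qm(2)[OF q(1)] q(2) by (simp add: m_def)
  have "qm \<noteq> p" using m p(2) by (auto simp: m_def)
  define C where "C = {q \<in> S2. s * f q \<ge> m / 2}"
  have Cp: "p \<notin> C" using p(2) m by (auto simp: C_def)
  have "compact C"
    using continuous_closedin_preimage[OF cf closed_atLeast[of "m / 2"]] \<open>compact S2\<close>
    by (auto simp: C_def vimage_def Int_def closedin_compact conj_commute dest: closedin_compact[rotated])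
  define K where "K = {x. s * f (\<phi> x) \<ge> m / 2}"
  have KC: "K = \<pi> ` C"
  proof
    show "K \<subseteq> \<pi> ` C"
    proof
      fix x assume "x \<in> K"
      then have "\<phi> x \<in> C" using cD(4) by (simp add: K_def C_def)
      then show "x \<in> \<pi> ` C" using cD(7)[of x] by (metis imageI)
    qed
    show "\<pi> ` C \<subseteq> K" using cD(9) Cp by (force simp: K_def C_def)
  qed
  have "C \<subseteq> W" using cD(8) Cp by (auto simp: C_def)
  then have "compact K"
    unfolding KC using Cinf_on_continuous[OF cD(3)] \<open>compact C\<close> continuous_on_subset compact_continuous_image by blast
  define x1 where "x1 = \<pi> qm"
  have \<phi>x1: "\<phi> x1 = qm" unfolding x1_def by (rule cD(9)[OF qm(1) \<open>qm \<noteq> p\<close>])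
  then have x1: "x1 \<in> K" using m by (simp add: K_def m_def[symmetric])
  have \<beta>_pos: "\<beta> x > 0" if "x \<in> K" for x
    using that m w[of x] by (simp add: \<beta>_eq K_def)
  have cf\<phi>: "continuous_on UNIV (\<lambda>x. s * f (\<phi> x))"
    by (rule continuous_on_compose2[OF cf Cinf_on_continuous[OF cD(1)] range\<phi>])
  have ratio: "w x / \<beta> x = 1 / (s * f (\<phi> x))" for x using w[of x] by (simp add: \<beta>_eq)
  have bdry: "J (\<xi>1 x) \<bullet> \<xi>2 x / \<beta> x \<ge> J (\<xi>1 x1) \<bullet> \<xi>2 x1 / \<beta> x1 + 1 / m"
    if "x \<in> K" "x \<notin> interior K" for x
  proof -
    have "open {x. m / 2 < s * f (\<phi> x)}"
      by (rule open_Collect_less[OF continuous_on_const cf\<phi>])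
    then have "{x. m / 2 < s * f (\<phi> x)} \<subseteq> interior K"
      by (rule interior_maximal[rotated]) (auto simp: K_def)
    then have half: "s * f (\<phi> x) = m / 2" using that by (force simp: K_def)
    show ?thesis unfolding Jw ratio \<phi>x1 m_def[symmetric] half using m by simp
  qed
  obtain \<epsilon>0 where \<epsilon>0: "\<epsilon>0 > 0" and orbit: "\<And>\<epsilon>. 0 < \<epsilon> \<Longrightarrow> \<epsilon> < \<epsilon>0 \<Longrightarrow>
    \<exists>x. (\<forall>t. x (t + 2 * pi) = x t) \<and>
      (\<forall>t. \<beta> (x t) > 0 \<and> \<beta> (x t) + \<epsilon> * (cos t * curl \<xi>1 (x t) + sin t * curl \<xi>2 (x t)) > 0 \<and>
       (x has_vector_derivative
         (\<epsilon> / (\<beta> (x t) + \<epsilon> * (cos t * curl \<xi>1 (x t) + sin t * curl \<xi>2 (x t)))) *\<^sub>R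
           J (- sin t *\<^sub>R \<xi>1 (x t) + cos t *\<^sub>R \<xi>2 (x t))) (at t))"
    using smooth_planar_orbit[OF smooth(4) \<xi> \<open>compact K\<close> x1 \<beta>_pos _ bdry] m by auto
  show ?thesis
  \<comment> \<open>speed \<open>\<epsilon>\<close> corresponds to the energy \<open>\<epsilon>\<^sup>2 / 2\<close>\<close>
  proof (intro exI[of _ "\<epsilon>0\<^sup>2 / 2"] conjI allI impI)
    show "\<epsilon>0\<^sup>2 / 2 > 0" using \<epsilon>0 by simp
    fix k assume k: "0 < k \<and> k < \<epsilon>0\<^sup>2 / 2"
    define \<epsilon> where "\<epsilon> = sqrt (2 * k)"
    have \<epsilon>: "\<epsilon> > 0" "\<epsilon>\<^sup>2 / 2 = k" using k by (auto simp: \<epsilon>_def)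
    have "\<epsilon>\<^sup>2 < \<epsilon>0\<^sup>2" using k \<epsilon>(2) by simp
    then have "\<epsilon> < \<epsilon>0" using \<epsilon>0 by (rule power2_less_imp_less[OF _ less_imp_le])
    then obtain x where x: "\<And>t. x (t + 2 * pi) = x t" "\<And>t. \<beta> (x t) > 0"
      "\<And>t. \<beta> (x t) + \<epsilon> * (cos t * curl \<xi>1 (x t) + sin t * curl \<xi>2 (x t)) > 0"
      "\<And>t. (x has_vector_derivative
         (\<epsilon> / (\<beta> (x t) + \<epsilon> * (cos t * curl \<xi>1 (x t) + sin t * curl \<xi>2 (x t)))) *\<^sub>R
           J (- sin t *\<^sub>R \<xi>1 (x t) + cos t *\<^sub>R \<xi>2 (x t))) (at t)"
      using orbit[OF \<epsilon>(1)] by blast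
    have "J (\<xi>1 x) \<bullet> \<xi>2 x > 0" for x unfolding Jw by (rule w)
    from geodesic_of_plane_orbit[OF c \<xi> smooth(4) this metric area x(1,3,4)]
    obtain \<theta> where "closed_magnetic_geodesic g \<sigma> k (\<lambda>t. \<phi> (x (\<theta> t)))" unfolding \<epsilon>(2) by blast
    moreover have "s * f (\<phi> (x t)) > 0" for t
      using x(2)[of t] w[of "x t"] unfolding \<beta>_eq by (simp add: zero_less_mult_iff)
    ultimately show "\<exists>\<gamma>. closed_magnetic_geodesic g \<sigma> k \<gamma> \<and> (\<forall>t. s * f (\<gamma> t) > 0)" by blast
  qed
qed

theorem mainTheorem6:
  fixes g \<sigma> :: "real^3 \<Rightarrow> real^3 \<Rightarrow> real^3 \<Rightarrow> real"
  assumes "riemannian_metric g"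
    and "two_form \<sigma>"
    and "\<not> exact_form \<sigma>"
    and "oscillating g \<sigma>"
  shows "\<exists>\<tau>>0. AE k in lborel. k \<in> {0<..<\<tau>} \<longrightarrow>
           (\<exists>\<gamma>\<^sub>1 \<gamma>\<^sub>2. closed_magnetic_geodesic g \<sigma> k \<gamma>\<^sub>1 \<and> closed_magnetic_geodesic g \<sigma> k \<gamma>\<^sub>2 \<and>
              geometrically_distinct \<gamma>\<^sub>1 \<gamma>\<^sub>2)"
proof -
  obtain f p q where f: "density_of g \<sigma> f" and p: "p \<in> S2" "f p > 0" and q: "q \<in> S2" "f q < 0"
    using assms(4) unfolding oscillating_def by blast
  obtain \<tau>1 where \<tau>1: "\<tau>1 > 0" "\<And>k. 0 < k \<Longrightarrow> k < \<tau>1 \<Longrightarrow>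
      \<exists>\<gamma>. closed_magnetic_geodesic g \<sigma> k \<gamma> \<and> (\<forall>t. f (\<gamma> t) > 0)"
    using region_geodesic[OF assms(1,2) f, of 1 q p] p q by auto
  obtain \<tau>2 where \<tau>2: "\<tau>2 > 0" "\<And>k. 0 < k \<Longrightarrow> k < \<tau>2 \<Longrightarrow>
      \<exists>\<gamma>. closed_magnetic_geodesic g \<sigma> k \<gamma> \<and> (\<forall>t. f (\<gamma> t) < 0)"
    using region_geodesic[OF assms(1,2) f, of "-1" p q] p q by auto
  have "\<exists>\<gamma>\<^sub>1 \<gamma>\<^sub>2. closed_magnetic_geodesic g \<sigma> k \<gamma>\<^sub>1 \<and> closed_magnetic_geodesic g \<sigma> k \<gamma>\<^sub>2 \<and>
              geometrically_distinct \<gamma>\<^sub>1 \<gamma>\<^sub>2" if "k \<in> {0<..<min \<tau>1 \<tau>2}" for k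
  proof -
    have k: "0 < k" "k < \<tau>1" "k < \<tau>2" using that by auto
    obtain \<gamma>1 where \<gamma>1: "closed_magnetic_geodesic g \<sigma> k \<gamma>1" "\<And>t. f (\<gamma>1 t) > 0"
      using \<tau>1(2)[OF k(1,2)] by blast
    obtain \<gamma>2 where \<gamma>2: "closed_magnetic_geodesic g \<sigma> k \<gamma>2" "\<And>t. f (\<gamma>2 t) < 0"
      using \<tau>2(2)[OF k(1,3)] by blast
    have "geometrically_distinct \<gamma>1 \<gamma>2"
      unfolding geometrically_distinct_def using \<gamma>1(2) \<gamma>2(2) by (metis less_asym)
    then show ?thesis using \<gamma>1(1) \<gamma>2(1) by blast
  qed
  then show ?thesis
    using \<tau>1(1) \<tau>2(1) by (intro exI[of _ "min \<tau>1 \<tau>2"] conjI AE_I2) auto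
qed

end
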